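(* Suppose that the standing assumptions on $b,f,g$ stated in the context hold, and let $\bar u(\cdot)\in L^2$ be an optimal control, i.e. a minimizer of $J$ over $L^2$, with corresponding state $\bar x(\cdot)$ and adjoint $\bar p(\cdot)$. Then the second-order coercivity condition at $\bar u(\cdot)$ holds for some constant $\alpha>0$, i.e. $$\int_0^T\begin{pmatrix}y(t)\\ v(t)\end{pmatrix}^\top H_{(x,u)^2}(t,\bar x(t),\bar u(t),\bar p(t))\begin{pmatrix}y(t)\\ v(t)\end{pmatrix}dt+y(T)^\top g_{xx}(\bar x(T))y(T)\ge\alpha\|v\|_2^2\qquad\forall v(\cdot)\in L^2,$$ where $y(\cdot)$ solves $\dot y(t)=b_x(t,\bar x(t),\bar u(t))y(t)+b_u(t,\bar x(t),\bar u(t))v(t)$, $y(0)=0$, if and only if the Riccati equation $$\dot P(t)+P(t)A+A^\top P(t)+Q-(B^\top P(t)+S)^\top R^{-1}(B^\top P(t)+S)=0\ \text{ for a.e. }t\in[0,T],\qquad P(T)=G,$$ with coefficients $$A=b_x(\cdot,\bar x,\bar u),\ B=b_u(\cdot,\bar x,\bar u),\ Q=H_{xx}(\cdot,\bar x,\bar u,\bar p),\ S=H_{ux}(\cdot,\bar x,\bar u,\bar p),\ R=H_{uu}(\cdot,\bar x,\bar u,\bar p),\ G=g_{xx}(\bar x(T)),$$ admits a strongly regular solution. Furthermore, if the second-order coercivity condition holds with a constant $\alpha>0$, then $R(t)\ge\alpha I$ for a.e. $t\in[0,T]$.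
   Context: Setting. Fix $T>0$, $n,m\in\mathbb{N}$, $x_0\in\mathbb{R}^n$ and maps $b:[0,T]\times\mathbb{R}^n\times\mathbb{R}^m\to\mathbb{R}^n$, $f:[0,T]\times\mathbb{R}^n\times\mathbb{R}^m\to\mathbb{R}$, $g:\mathbb{R}^n\to\mathbb{R}$. $|\cdot|$ is the Euclidean norm (for matrices and higher-order arrays, that of the entries). $L^2=L^2(0,T;\mathbb{R}^m)$ with norm $\|\cdot\|_2$. Derivatives. $b_x,b_u$ are Jacobians ($n\times n$, $n\times m$); gradients $f_x,f_u,g_x,H_x,H_u$ are column vectors; $H_{xu}$ is the derivative of $H_x$ with respect to $u$ (an $n\times m$ matrix), $H_{ux}=H_{xu}^\top$; $\varphi_{(x,u)^2}$ is the full second derivative (Hessian) of $\varphi$ in $(x,u)$. Standing assumptions. $b,f,g$ are measurable; for every $t$, $b(t,\cdot,\cdot)$ and $f(t,\cdot,\cdot)$ are twice differentiable, and $g$ is twice differentiable; there is a constant $L>0$, independent of $t$, such that for all $t\in[0,T]$, $x,\bar x\in\mathbb{R}^n$, $u,\bar u\in\mathbb{R}^m$: $|b(t,x,u)|\le L(|x|+|u|+1)$, $|b_x(t,x,u)|+|b_u(t,x,u)|\le L$, $|b_{(x,u)^2}(t,x,u)|\le L$, $|b_{(x,u)^2}(t,x,u)-b_{(x,u)^2}(t,\bar x,\bar u)|\le L(|x-\bar x|+|u-\bar u|)$; $|f(t,x,u)|\le L(|x|^2+|u|^2+1)$, $|f_x(t,x,u)|+|f_u(t,x,u)|\le L(|x|+|u|+1)$,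 $|f_{(x,u)^2}(t,x,u)|\le L$, $|f_{(x,u)^2}(t,x,u)-f_{(x,u)^2}(t,\bar x,\bar u)|\le L(|x-\bar x|+|u-\bar u|)$; $|g(x)|\le L(|x|^2+1)$, $|g_x(x)|\le L(|x|+1)$, $|g_{xx}(x)|\le L$, $|g_{xx}(x)-g_{xx}(\bar x)|\le L|x-\bar x|$. State, cost, adjoint. For $u(\cdot)\in L^2$, the state $x(\cdot)$ is the unique solution of $\dot x(t)=b(t,x(t),u(t))$, $x(0)=x_0$; the cost is $J(u(\cdot))=\int_0^Tf(t,x(t),u(t))\,dt+g(x(T))$; the adjoint $p(\cdot)$ is the unique solution of $\dot p(t)=-b_x(t,x(t),u(t))^\top p(t)-f_x(t,x(t),u(t))$, $p(T)=g_x(x(T))$. The Hamiltonian is $H(t,x,u,p)=b(t,x,u)^\top p+f(t,x,u)$. Strongly regular solution. The Riccati equation is said to admit a strongly regular solution if there is $\lambda>0$ with $R(t)\ge\lambda I$ for a.e. $t\in[0,T]$ (in the sense of symmetric matrices) and the Riccati equation has an (absolutely continuous, symmetric-matrix-valued) solution $P(\cdot)$ on the entire interval $[0,T]$. *)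

theory Defs
  imports "HOL-Analysis.Analysis"
begin

section \<open>Derivatives\<close>

text \<open>An array with n rows and m columns has type \<open>real ^ 'm ^ 'n\<close>; the norm of this type is the
  Euclidean norm of the entries, also for nested arrays of higher order.\<close>

definition grad :: "(real ^ 'k::finite \<Rightarrow> real) \<Rightarrow> real ^ 'k \<Rightarrow> real ^ 'k" where
  "grad \<phi> z = (THE D. GDERIV \<phi> z :> D)"

definition hessian :: "(real ^ 'k::finite \<Rightarrow> real) \<Rightarrow> real ^ 'k \<Rightarrow> real ^ 'k ^ 'k" where
  "hessian \<phi> z = jacobian (grad \<phi>) (at z)"

definition twice_differentiable :: "(real ^ 'k::finite \<Rightarrow> real) \<Rightarrow> bool" where
  "twice_differentiable \<phi> \<longleftrightarrow>
     (\<forall>z. \<phi> differentiable (at z)) \<and> (\<forall>z. grad \<phi> differentiable (at z))"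

text \<open>The pair (x, u) is encoded as one column vector indexed by the disjoint sum of the two index
  types, so that full second derivatives in (x, u) are ordinary matrices.\<close>

definition join :: "real ^ 'n::finite \<Rightarrow> real ^ 'm::finite \<Rightarrow> real ^ ('n + 'm)" where
  "join x u = (\<chi> k. case k of Inl i \<Rightarrow> x $ i | Inr j \<Rightarrow> u $ j)"

definition on_join ::
    "(real ^ 'n::finite \<Rightarrow> real ^ 'm::finite \<Rightarrow> 'a) \<Rightarrow> real ^ ('n + 'm) \<Rightarrow> 'a" where
  "on_join \<phi> z = \<phi> (\<chi> i. z $ Inl i) (\<chi> j. z $ Inr j)"

definition hessian_xu ::
    "(real ^ 'n::finite \<Rightarrow> real ^ 'm::finite \<Rightarrow> real) \<Rightarrow> real ^ 'n \<Rightarrow> real ^ 'm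
      \<Rightarrow> real ^ ('n + 'm) ^ ('n + 'm)" where
  "hessian_xu \<phi> x u = hessian (on_join \<phi>) (join x u)"

definition hessian_xu_vec ::
    "(real ^ 'n::finite \<Rightarrow> real ^ 'm::finite \<Rightarrow> real ^ 'l::finite) \<Rightarrow> real ^ 'n \<Rightarrow> real ^ 'm
      \<Rightarrow> real ^ ('n + 'm) ^ ('n + 'm) ^ 'l" where
  "hessian_xu_vec \<phi> x u = (\<chi> i. hessian_xu (\<lambda>x u. \<phi> x u $ i) x u)"

definition jac_x :: "(real ^ 'n::finite \<Rightarrow> real ^ 'm::finite \<Rightarrow> real ^ 'l::finite)
    \<Rightarrow> real ^ 'n \<Rightarrow> real ^ 'm \<Rightarrow> real ^ 'n ^ 'l" where
  "jac_x \<phi> x u = jacobian (\<lambda>x. \<phi> x u) (at x)"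

definition jac_u :: "(real ^ 'n::finite \<Rightarrow> real ^ 'm::finite \<Rightarrow> real ^ 'l::finite)
    \<Rightarrow> real ^ 'n \<Rightarrow> real ^ 'm \<Rightarrow> real ^ 'm ^ 'l" where
  "jac_u \<phi> x u = jacobian (\<lambda>u. \<phi> x u) (at u)"

definition grad_x :: "(real ^ 'n::finite \<Rightarrow> real ^ 'm::finite \<Rightarrow> real)
    \<Rightarrow> real ^ 'n \<Rightarrow> real ^ 'm \<Rightarrow> real ^ 'n" where
  "grad_x \<phi> x u = grad (\<lambda>x. \<phi> x u) x"

definition grad_u :: "(real ^ 'n::finite \<Rightarrow> real ^ 'm::finite \<Rightarrow> real)
    \<Rightarrow> real ^ 'n \<Rightarrow> real ^ 'm \<Rightarrow> real ^ 'm" where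
  "grad_u \<phi> x u = grad (\<lambda>u. \<phi> x u) u"


section \<open>Standing assumptions\<close>

definition standing_assumptions ::
    "real \<Rightarrow> (real \<Rightarrow> real ^ 'n::finite \<Rightarrow> real ^ 'm::finite \<Rightarrow> real ^ 'n)
      \<Rightarrow> (real \<Rightarrow> real ^ 'n \<Rightarrow> real ^ 'm \<Rightarrow> real) \<Rightarrow> (real ^ 'n \<Rightarrow> real) \<Rightarrow> bool" where
  "standing_assumptions T b f g \<longleftrightarrow>
     (\<lambda>(t, x, u). b t x u) \<in> borel_measurable (lebesgue_on ({0..T} \<times> UNIV)) \<and>
     (\<lambda>(t, x, u). f t x u) \<in> borel_measurable (lebesgue_on ({0..T} \<times> UNIV)) \<and>
     g \<in> borel_measurable lebesgue \<and>
     (\<forall>t\<in>{0..T}. (\<forall>i. twice_differentiable (on_join (\<lambda>x u. b t x u $ i))) \<and>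
                  twice_differentiable (on_join (f t))) \<and>
     twice_differentiable g \<and>
     (\<exists>L>0. \<forall>t\<in>{0..T}. \<forall>x x' u u'.
        norm (b t x u) \<le> L * (norm x + norm u + 1) \<and>
        norm (jac_x (b t) x u) + norm (jac_u (b t) x u) \<le> L \<and>
        norm (hessian_xu_vec (b t) x u) \<le> L \<and>
        norm (hessian_xu_vec (b t) x u - hessian_xu_vec (b t) x' u')
          \<le> L * (norm (x - x') + norm (u - u')) \<and>
        \<bar>f t x u\<bar> \<le> L * ((norm x)\<^sup>2 + (norm u)\<^sup>2 + 1) \<and>
        norm (grad_x (f t) x u) + norm (grad_u (f t) x u) \<le> L * (norm x + norm u + 1) \<and>
        norm (hessian_xu (f t) x u) \<le> L \<and>
        norm (hessian_xu (f t) x u - hessian_xu (f t) x' u')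
          \<le> L * (norm (x - x') + norm (u - u')) \<and>
        \<bar>g x\<bar> \<le> L * ((norm x)\<^sup>2 + 1) \<and>
        norm (grad g x) \<le> L * (norm x + 1) \<and>
        norm (hessian g x) \<le> L \<and>
        norm (hessian g x - hessian g x') \<le> L * norm (x - x'))"


section \<open>Controls, states, cost and adjoints\<close>

text \<open>Elements of \<open>L2 T\<close> are representatives; only their values on [0,T] matter.\<close>

definition L2 :: "real \<Rightarrow> (real \<Rightarrow> real ^ 'm::finite) set" where
  "L2 T = {u. u \<in> borel_measurable (lebesgue_on {0..T}) \<and>
              integrable (lebesgue_on {0..T}) (\<lambda>t. (norm (u t))\<^sup>2)}"

definition L2_norm :: "real \<Rightarrow> (real \<Rightarrow> real ^ 'm::finite) \<Rightarrow> real" where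
  "L2_norm T u = sqrt (LINT t|lebesgue_on {0..T}. (norm (u t))\<^sup>2)"

text \<open>The usual epsilon-delta absolute continuity: \<open>D\<close> ranges over the finite families of
  non-overlapping compact intervals \<open>K = [Inf K, Sup K]\<close> contained in \<open>S\<close>.\<close>

definition abs_continuous_on :: "real set \<Rightarrow> (real \<Rightarrow> 'a::real_normed_vector) \<Rightarrow> bool" where
  "abs_continuous_on S x \<longleftrightarrow>
     (\<forall>\<epsilon>>0. \<exists>\<delta>>0. \<forall>D. D division_of \<Union>D \<and> \<Union>D \<subseteq> S \<and> (\<Sum>K\<in>D. Sup K - Inf K) < \<delta>
        \<longrightarrow> (\<Sum>K\<in>D. norm (x (Sup K) - x (Inf K))) < \<epsilon>)"

definition solves_ode :: "real \<Rightarrow> (real \<Rightarrow> 'a::real_normed_vector \<Rightarrow> 'a) \<Rightarrow> (real \<Rightarrow> 'a) \<Rightarrow> bool" where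
  "solves_ode T F x \<longleftrightarrow> abs_continuous_on {0..T} x \<and>
     (AE t in lebesgue_on {0..T}. (x has_vector_derivative F t (x t)) (at t within {0..T}))"

definition is_state ::
    "real \<Rightarrow> real ^ 'n::finite \<Rightarrow> (real \<Rightarrow> real ^ 'n \<Rightarrow> real ^ 'm::finite \<Rightarrow> real ^ 'n)
      \<Rightarrow> (real \<Rightarrow> real ^ 'm) \<Rightarrow> (real \<Rightarrow> real ^ 'n) \<Rightarrow> bool" where
  "is_state T x0 b u x \<longleftrightarrow> solves_ode T (\<lambda>t \<xi>. b t \<xi> (u t)) x \<and> x 0 = x0"

text \<open>The state is unique only as a function on [0,T], so the definite description is applied to the
  value of the cost rather than to the state.\<close>

definition cost ::
    "real \<Rightarrow> real ^ 'n::finite \<Rightarrow> (real \<Rightarrow> real ^ 'n \<Rightarrow> real ^ 'm::finite \<Rightarrow> real ^ 'n)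
      \<Rightarrow> (real \<Rightarrow> real ^ 'n \<Rightarrow> real ^ 'm \<Rightarrow> real) \<Rightarrow> (real ^ 'n \<Rightarrow> real)
      \<Rightarrow> (real \<Rightarrow> real ^ 'm) \<Rightarrow> real" where
  "cost T x0 b f g u =
     (THE J. \<exists>x. is_state T x0 b u x \<and>
        J = (LINT t|lebesgue_on {0..T}. f t (x t) (u t)) + g (x T))"

definition optimal_control ::
    "real \<Rightarrow> real ^ 'n::finite \<Rightarrow> (real \<Rightarrow> real ^ 'n \<Rightarrow> real ^ 'm::finite \<Rightarrow> real ^ 'n)
      \<Rightarrow> (real \<Rightarrow> real ^ 'n \<Rightarrow> real ^ 'm \<Rightarrow> real) \<Rightarrow> (real ^ 'n \<Rightarrow> real)
      \<Rightarrow> (real \<Rightarrow> real ^ 'm) \<Rightarrow> bool" where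
  "optimal_control T x0 b f g u \<longleftrightarrow>
     u \<in> L2 T \<and> (\<forall>v\<in>L2 T. cost T x0 b f g u \<le> cost T x0 b f g v)"

definition is_adjoint ::
    "real \<Rightarrow> (real \<Rightarrow> real ^ 'n::finite \<Rightarrow> real ^ 'm::finite \<Rightarrow> real ^ 'n)
      \<Rightarrow> (real \<Rightarrow> real ^ 'n \<Rightarrow> real ^ 'm \<Rightarrow> real) \<Rightarrow> (real ^ 'n \<Rightarrow> real)
      \<Rightarrow> (real \<Rightarrow> real ^ 'm) \<Rightarrow> (real \<Rightarrow> real ^ 'n) \<Rightarrow> (real \<Rightarrow> real ^ 'n) \<Rightarrow> bool" where
  "is_adjoint T b f g u x p \<longleftrightarrow>
     solves_ode T (\<lambda>t q. - (transpose (jac_x (b t) (x t) (u t)) *v q) - grad_x (f t) (x t) (u t)) p \<and>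
     p T = grad g (x T)"


section \<open>Hamiltonian and second-order coercivity\<close>

definition hamiltonian ::
    "(real \<Rightarrow> real ^ 'n::finite \<Rightarrow> real ^ 'm::finite \<Rightarrow> real ^ 'n)
      \<Rightarrow> (real \<Rightarrow> real ^ 'n \<Rightarrow> real ^ 'm \<Rightarrow> real)
      \<Rightarrow> real \<Rightarrow> real ^ 'n \<Rightarrow> real ^ 'm \<Rightarrow> real ^ 'n \<Rightarrow> real" where
  "hamiltonian b f t x u p = b t x u \<bullet> p + f t x u"

definition H_xx where
  "H_xx b f t x u p = hessian (\<lambda>x. hamiltonian b f t x u p) x"

definition H_xu where
  "H_xu b f t x u p = jac_u (\<lambda>x u. grad_x (\<lambda>x u. hamiltonian b f t x u p) x u) x u"

definition H_ux where
  "H_ux b f t x u p = transpose (H_xu b f t x u p)"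

definition H_uu where
  "H_uu b f t x u p = hessian (\<lambda>u. hamiltonian b f t x u p) u"

definition H_xu_full where
  "H_xu_full b f t x u p = hessian_xu (\<lambda>x u. hamiltonian b f t x u p) x u"

definition is_linearized_state ::
    "real \<Rightarrow> (real \<Rightarrow> real ^ 'n::finite \<Rightarrow> real ^ 'm::finite \<Rightarrow> real ^ 'n)
      \<Rightarrow> (real \<Rightarrow> real ^ 'm) \<Rightarrow> (real \<Rightarrow> real ^ 'n)
      \<Rightarrow> (real \<Rightarrow> real ^ 'm) \<Rightarrow> (real \<Rightarrow> real ^ 'n) \<Rightarrow> bool" where
  "is_linearized_state T b u x v y \<longleftrightarrow>
     solves_ode T (\<lambda>t \<eta>. jac_x (b t) (x t) (u t) *v \<eta> + jac_u (b t) (x t) (u t) *v v t) y \<and> y 0 = 0"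

definition coercive ::
    "real \<Rightarrow> (real \<Rightarrow> real ^ 'n::finite \<Rightarrow> real ^ 'm::finite \<Rightarrow> real ^ 'n)
      \<Rightarrow> (real \<Rightarrow> real ^ 'n \<Rightarrow> real ^ 'm \<Rightarrow> real) \<Rightarrow> (real ^ 'n \<Rightarrow> real)
      \<Rightarrow> (real \<Rightarrow> real ^ 'm) \<Rightarrow> (real \<Rightarrow> real ^ 'n) \<Rightarrow> (real \<Rightarrow> real ^ 'n) \<Rightarrow> real \<Rightarrow> bool" where
  "coercive T b f g u x p \<alpha> \<longleftrightarrow>
     (\<forall>v\<in>L2 T. \<forall>y. is_linearized_state T b u x v y \<longrightarrow>
        (LINT t|lebesgue_on {0..T}.
           join (y t) (v t) \<bullet> (H_xu_full b f t (x t) (u t) (p t) *v join (y t) (v t)))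
        + y T \<bullet> (hessian g (x T) *v y T)
        \<ge> \<alpha> * (L2_norm T v)\<^sup>2)"


section \<open>Riccati equation\<close>

definition sym_matrix_le :: "real ^ 'k::finite ^ 'k \<Rightarrow> real ^ 'k ^ 'k \<Rightarrow> bool" where
  "sym_matrix_le M N \<longleftrightarrow>
     transpose M = M \<and> transpose N = N \<and> (\<forall>v. v \<bullet> (M *v v) \<le> v \<bullet> (N *v v))"

definition riccati_solution ::
    "real \<Rightarrow> (real \<Rightarrow> real ^ 'n::finite ^ 'n) \<Rightarrow> (real \<Rightarrow> real ^ 'm::finite ^ 'n)
      \<Rightarrow> (real \<Rightarrow> real ^ 'n ^ 'n) \<Rightarrow> (real \<Rightarrow> real ^ 'n ^ 'm) \<Rightarrow> (real \<Rightarrow> real ^ 'm ^ 'm)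
      \<Rightarrow> real ^ 'n ^ 'n \<Rightarrow> (real \<Rightarrow> real ^ 'n ^ 'n) \<Rightarrow> bool" where
  "riccati_solution T A B Q S R G P \<longleftrightarrow>
     abs_continuous_on {0..T} P \<and> (\<forall>t\<in>{0..T}. transpose (P t) = P t) \<and>
     (AE t in lebesgue_on {0..T}. \<exists>P'. (P has_vector_derivative P') (at t within {0..T}) \<and>
        P' + P t ** A t + transpose (A t) ** P t + Q t
          - transpose (transpose (B t) ** P t + S t) ** matrix_inv (R t)
              ** (transpose (B t) ** P t + S t) = 0) \<and>
     P T = G"

definition has_strongly_regular_solution ::
    "real \<Rightarrow> (real \<Rightarrow> real ^ 'n::finite ^ 'n) \<Rightarrow> (real \<Rightarrow> real ^ 'm::finite ^ 'n)
      \<Rightarrow> (real \<Rightarrow> real ^ 'n ^ 'n) \<Rightarrow> (real \<Rightarrow> real ^ 'n ^ 'm) \<Rightarrow> (real \<Rightarrow> real ^ 'm ^ 'm)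
      \<Rightarrow> real ^ 'n ^ 'n \<Rightarrow> bool" where
  "has_strongly_regular_solution T A B Q S R G \<longleftrightarrow>
     (\<exists>c>0. AE t in lebesgue_on {0..T}. sym_matrix_le (c *\<^sub>R mat 1) (R t)) \<and>
     (\<exists>P. riccati_solution T A B Q S R G P)"

end

theory Submission
  imports Defs
begin

text \<open>
  If \<open>P\<close> solves the Riccati equation, then the quadratic functional equals
  \<open>\<integral> w \<bullet> R w\<close> with \<open>w = v + R\<inverse> (B\<^sup>T P + S) y\<close>, and Gronwall's inequality for the closed-loop equation bounds
  \<open>v\<close> by \<open>w\<close> in the square mean. Conversely, testing coercivity with controls supported on sets of small measure
  gives \<open>R \<ge> \<alpha>\<close>. Then the linear Hamiltonian system with terminal value \<open>(X, Y)(T) = (1, G)\<close> is well posed,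
  and \<open>X\<close> is invertible throughout: if \<open>X s c = 0\<close>, then the solution through \<open>c\<close>, set to zero before
  time \<open>s\<close>, is a linearised state of cost zero, so its control vanishes, so the state vanishes and \<open>c = 0\<close>.
  Hence \<open>P = Y X\<inverse>\<close> is a global solution, and it is Lipschitz.\<close>

section \<open>Absolutely continuous functions\<close>

text \<open>The coefficients are only measurable in \<open>t\<close>, and solutions are
  differentiable only almost everywhere. Every energy identity must therefore be integrated for
  absolutely continuous functions, and existence must be of Caratheodory type; the analysis that
  precedes the control problem supplies both. In the direction from coercivity the obstacle is
  blow-up: the Riccati equation is quadratic in \<open>P\<close> and has no global solution a
  priori. The Hamiltonian system is linear, and the lower bound on \<open>R\<close> bounds its
  inverse uniformly in \<open>t\<close>, so the system is solvable on the whole interval and a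
  singular \<open>X\<close> is the only way to fail. Compactness of the interval times the unit
  sphere turns pointwise invertibility of \<open>X\<close> into a uniform bound on its inverse.
  \<open>P\<close> is symmetric because the system preserves a symplectic form that vanishes at time
  \<open>T\<close>. The coefficients are blocks of one Hessian. Its symmetry is derived from twice
  differentiability, its measurability in \<open>t\<close> from difference quotients.\<close>

lemma AE_lebesgue_on_iff_negligible:
  assumes "S \<in> sets lebesgue"
  shows "(AE x in lebesgue_on S. P x) \<longleftrightarrow> negligible {x \<in> S. \<not> P x}"
proof -
  have "{x. \<not> (x \<in> S \<longrightarrow> P x)} = {x \<in> S. \<not> P x}" by auto
  then show ?thesis
    using assms by (simp add: AE_restrict_space_iff completion.AE_iff_null_sets negligible_iff_null_sets)
qed

lemma real_division_member:
  fixes D :: "real set set"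
  assumes "D division_of \<Union>D" "\<Union>D \<subseteq> S" "K \<in> D"
  shows "Inf K \<le> Sup K" "K = {Inf K..Sup K}" "{Inf K..Sup K} \<subseteq> S"
proof -
  obtain a b where K: "K = cbox a b" "K \<noteq> {}"
    using division_ofD(3,4)[OF assms(1,3)] by blast
  then have "a \<le> b" by auto
  with K assms show "Inf K \<le> Sup K" "K = {Inf K..Sup K}" "{Inf K..Sup K} \<subseteq> S" by auto
qed

text \<open>The common source of the closure properties below: a bound on increments transfers the
  epsilon-delta condition, with the smaller of the two moduli.\<close>

lemma abs_continuous_on_dominated:
  assumes x: "abs_continuous_on S x" and y: "abs_continuous_on S y"
    and le: "\<And>s t. s \<in> S \<Longrightarrow> t \<in> S \<Longrightarrow> norm (z t - z s) \<le> C * (norm (x t - x s) + norm (y t - y s))"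
  shows "abs_continuous_on S z"
  unfolding abs_continuous_on_def
proof (intro allI impI)
  fix \<epsilon> :: real assume "\<epsilon> > 0"
  \<comment> \<open>Half of \<epsilon> goes to each of \<open>x\<close> and \<open>y\<close>. The
    factor \<open>\<bar>C\<bar> + 1\<close> replaces \<open>C\<close>, which may be zero or
    negative.\<close>
  define e where "e = \<epsilon> / (2 * (\<bar>C\<bar> + 1))"
  have e: "e > 0" using \<open>\<epsilon> > 0\<close> by (simp add: e_def)
  obtain d1 where d1: "d1 > 0" "\<And>D. D division_of \<Union>D \<and> \<Union>D \<subseteq> S \<and> (\<Sum>K\<in>D. Sup K - Inf K) < d1
        \<Longrightarrow> (\<Sum>K\<in>D. norm (x (Sup K) - x (Inf K))) < e"
    using x e unfolding abs_continuous_on_def by meson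
  obtain d2 where d2: "d2 > 0" "\<And>D. D division_of \<Union>D \<and> \<Union>D \<subseteq> S \<and> (\<Sum>K\<in>D. Sup K - Inf K) < d2
        \<Longrightarrow> (\<Sum>K\<in>D. norm (y (Sup K) - y (Inf K))) < e"
    using y e unfolding abs_continuous_on_def by meson
  show "\<exists>\<delta>>0. \<forall>D. D division_of \<Union>D \<and> \<Union>D \<subseteq> S \<and> (\<Sum>K\<in>D. Sup K - Inf K) < \<delta>
        \<longrightarrow> (\<Sum>K\<in>D. norm (z (Sup K) - z (Inf K))) < \<epsilon>"
  proof (intro exI[of _ "min d1 d2"] conjI allI impI)
    fix D :: "real set set"
    assume D: "D division_of \<Union>D \<and> \<Union>D \<subseteq> S \<and> (\<Sum>K\<in>D. Sup K - Inf K) < min d1 d2"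
    have *: "norm (z (Sup K) - z (Inf K)) \<le>
        (\<bar>C\<bar> + 1) * (norm (x (Sup K) - x (Inf K)) + norm (y (Sup K) - y (Inf K)))" if K: "K \<in> D" for K
    proof -
      have "norm (z (Sup K) - z (Inf K)) \<le>
          C * (norm (x (Sup K) - x (Inf K)) + norm (y (Sup K) - y (Inf K)))"
      proof (rule le)
        show "Inf K \<in> S" "Sup K \<in> S"
          using real_division_member(1,3)[of D S K] D K by auto
      qed
      also have "\<dots> \<le> (\<bar>C\<bar> + 1) * (norm (x (Sup K) - x (Inf K)) + norm (y (Sup K) - y (Inf K)))"
        by (intro mult_right_mono) auto
      finally show ?thesis .
    qed
    have "(\<Sum>K\<in>D. norm (z (Sup K) - z (Inf K))) \<le>
       (\<Sum>K\<in>D. (\<bar>C\<bar> + 1) * (norm (x (Sup K) - x (Inf K)) + norm (y (Sup K) - y (Inf K))))"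
      by (intro sum_mono *)
    also have "\<dots> = (\<bar>C\<bar> + 1) * ((\<Sum>K\<in>D. norm (x (Sup K) - x (Inf K))) + (\<Sum>K\<in>D. norm (y (Sup K) - y (Inf K))))"
      by (simp only: sum_distrib_left[symmetric] sum.distrib)
    also have "\<dots> < (\<bar>C\<bar> + 1) * (e + e)"
      using d1(2)[of D] d2(2)[of D] D by (intro mult_strict_left_mono add_strict_mono) auto
    also have "\<dots> = \<epsilon>" by (simp add: e_def add_nonneg_eq_0_iff field_simps)
    finally show "(\<Sum>K\<in>D. norm (z (Sup K) - z (Inf K))) < \<epsilon>" .
  qed (use d1 d2 in auto)
qed

lemma abs_continuous_on_id: "abs_continuous_on S (\<lambda>t::real. t)"
  unfolding abs_continuous_on_def
proof (intro allI impI)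
  fix \<epsilon> :: real assume "\<epsilon> > 0"
  show "\<exists>\<delta>>0. \<forall>D. D division_of \<Union>D \<and> \<Union>D \<subseteq> S \<and> (\<Sum>K\<in>D. Sup K - Inf K) < \<delta>
        \<longrightarrow> (\<Sum>K\<in>D. norm (Sup K - Inf K)) < \<epsilon>"
  proof (intro exI[of _ \<epsilon>] conjI allI impI \<open>\<epsilon> > 0\<close>)
    fix D :: "real set set"
    assume D: "D division_of \<Union>D \<and> \<Union>D \<subseteq> S \<and> (\<Sum>K\<in>D. Sup K - Inf K) < \<epsilon>"
    have "norm (Sup K - Inf K) = Sup K - Inf K" if K: "K \<in> D" for K
      using real_division_member(1)[of D S K] D K by simp
    then show "(\<Sum>K\<in>D. norm (Sup K - Inf K)) < \<epsilon>" using D by simp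
  qed
qed

text \<open>Domination by the identity, which is used for both comparison functions; hence the
  constant is halved.\<close>

lemma lipschitz_imp_abs_continuous_on:
  assumes "\<And>s t. s \<in> S \<Longrightarrow> t \<in> S \<Longrightarrow> norm (z t - z s) \<le> C * \<bar>t - s\<bar>"
  shows "abs_continuous_on S z"
proof (rule abs_continuous_on_dominated[OF abs_continuous_on_id abs_continuous_on_id])
  show "norm (z t - z s) \<le> C / 2 * (norm (t - s) + norm (t - s))" if "s \<in> S" "t \<in> S" for s t
    using assms[OF that] by simp
qed

lemma abs_continuous_on_subset:
  "abs_continuous_on S x \<Longrightarrow> S' \<subseteq> S \<Longrightarrow> abs_continuous_on S' x"
  unfolding abs_continuous_on_def by (meson subset_trans)

text \<open>For families that consist of a single interval the definition is uniform
  continuity.\<close>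

lemma abs_continuous_on_imp_continuous_on:
  fixes x :: "real \<Rightarrow> 'a::real_normed_vector"
  assumes ac: "abs_continuous_on {a..b} x"
  shows "continuous_on {a..b} x"
  unfolding continuous_on_iff
proof (intro ballI allI impI)
  fix s e :: real assume s: "s \<in> {a..b}" and e: "e > 0"
  obtain d where d: "d > 0" "\<And>D. D division_of \<Union>D \<and> \<Union>D \<subseteq> {a..b} \<and> (\<Sum>K\<in>D. Sup K - Inf K) < d
        \<Longrightarrow> (\<Sum>K\<in>D. norm (x (Sup K) - x (Inf K))) < e"
    using ac e unfolding abs_continuous_on_def by meson
  have *: "norm (x v - x u) < e" if "u \<le> v" "u \<in> {a..b}" "v \<in> {a..b}" "v - u < d" for u v
  proof -
    have "{{u..v}} division_of \<Union>{{u..v}}"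
      using that division_of_self[of u v] by simp
    then show ?thesis using d(2)[of "{{u..v}}"] that by auto
  qed
  show "\<exists>d>0. \<forall>t\<in>{a..b}. dist t s < d \<longrightarrow> dist (x t) (x s) < e"
  proof (intro exI[of _ d] conjI ballI impI d(1))
    fix t assume t: "t \<in> {a..b}" "dist t s < d"
    show "dist (x t) (x s) < e"
      using *[of s t] *[of t s] t s by (cases "s \<le> t") (auto simp: dist_norm norm_minus_commute)
  qed
qed

text \<open>Both factors are bounded on the compact interval, so the usual splitting of a product
  increment is dominated by the sum of the increments.\<close>

lemma abs_continuous_on_bilinear:
  fixes x :: "real \<Rightarrow> 'a::real_normed_vector" and y :: "real \<Rightarrow> 'b::real_normed_vector"
  assumes "bounded_bilinear h" and x: "abs_continuous_on {a..b} x" and y: "abs_continuous_on {a..b} y"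
  shows "abs_continuous_on {a..b} (\<lambda>t. h (x t) (y t))"
proof -
  interpret bounded_bilinear h by fact
  obtain K where K: "\<And>u v. norm (h u v) \<le> norm u * norm v * K" "K > 0" using pos_bounded by blast
  have "bounded (x ` {a..b})" "bounded (y ` {a..b})"
    using x y by (auto intro!: compact_imp_bounded compact_continuous_image abs_continuous_on_imp_continuous_on)
  then obtain M N where M: "\<And>t. t \<in> {a..b} \<Longrightarrow> norm (x t) \<le> M" and N: "\<And>t. t \<in> {a..b} \<Longrightarrow> norm (y t) \<le> N"
    unfolding bounded_iff by blast
  show ?thesis
  proof (rule abs_continuous_on_dominated[OF x y])
    fix s t assume st: "s \<in> {a..b}" "t \<in> {a..b}"
    have "h (x t) (y t) - h (x s) (y s) = h (x t - x s) (y t) + h (x s) (y t - y s)"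
      by (simp add: diff_left diff_right)
    then have "norm (h (x t) (y t) - h (x s) (y s)) \<le>
        norm (x t - x s) * norm (y t) * K + norm (x s) * norm (y t - y s) * K"
      using K(1) norm_triangle_mono by metis
    also have "\<dots> \<le> norm (x t - x s) * (\<bar>M\<bar> + \<bar>N\<bar>) * K + (\<bar>M\<bar> + \<bar>N\<bar>) * norm (y t - y s) * K"
      using K(2) M[OF st(1)] N[OF st(2)]
      by (intro add_mono mult_right_mono mult_left_mono) auto
    finally show "norm (h (x t) (y t) - h (x s) (y s)) \<le>
        (\<bar>M\<bar> + \<bar>N\<bar>) * K * (norm (x t - x s) + norm (y t - y s))"
      by (simp add: algebra_simps)
  qed
qed

text \<open>This links measure to absolute continuity: intervals inside an open set of measure below
  \<delta> have total length below \<delta>.\<close>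

lemma sum_lengths_division_le:
  fixes D :: "real set set"
  assumes D: "D division_of \<Union>D" and sub: "\<Union>D \<subseteq> U" and U: "U \<in> lmeasurable"
  shows "(\<Sum>K\<in>D. Sup K - Inf K) \<le> measure lebesgue U"
proof -
  have "(\<Sum>K\<in>D. Sup K - Inf K) = (\<Sum>K\<in>D. measure lebesgue K)"
  proof (rule sum.cong[OF refl])
    fix K assume "K \<in> D"
    then have "Inf K \<le> Sup K" "K = {Inf K..Sup K}"
      using real_division_member(1,2)[OF D sub] by blast+
    then show "Sup K - Inf K = measure lebesgue K"
      by (metis content_real measure_completion sets_lborel atLeastAtMost_borel)
  qed
  also have "\<dots> = measure lebesgue (\<Union>D)"
    using content_division[OF D] by simp
  also have "\<dots> \<le> measure lebesgue U"
    using sub U D by (intro measure_mono_fmeasurable) (auto intro: fmeasurableD lmeasurable_division)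
  finally show ?thesis .
qed

text \<open>With a gauge integral the two kinds of tags can be treated separately. At a tag where
  the derivative exists, the gauge makes the increment of \<open>F\<close> nearly linear. At a tag
  in the exceptional null set it confines the interval to an open set of small measure, where
  absolute continuity makes the increments small. Integrability of \<open>f\<close> comes out
  together with the value.\<close>

theorem abs_continuous_on_has_integral:
  fixes F :: "real \<Rightarrow> 'a::banach"
  assumes ab: "a \<le> b" and ac: "abs_continuous_on {a..b} F"
    and der: "AE t in lebesgue_on {a..b}. (F has_vector_derivative f t) (at t within {a..b})"
  shows "(f has_integral (F b - F a)) {a..b}"
proof -
  define N where "N = {t \<in> {a..b}. \<not> (F has_vector_derivative f t) (at t within {a..b})}"
  have N: "negligible N" unfolding N_def using der by (subst (asm) AE_lebesgue_on_iff_negligible) auto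
  \<comment> \<open>Zero on the null set, so that a tag there contributes nothing but the increment
    of \<open>F\<close>.\<close>
  define g where "g t = (if t \<in> N then 0 else f t)" for t
  have "(g has_integral (F b - F a)) {a..b}"
    unfolding has_integral_real
  proof (intro allI impI)
    fix e :: real assume e: "e > 0"
    obtain \<delta> where \<delta>: "\<delta> > 0" "\<And>D. D division_of \<Union>D \<and> \<Union>D \<subseteq> {a..b} \<and> (\<Sum>K\<in>D. Sup K - Inf K) < \<delta>
        \<Longrightarrow> (\<Sum>K\<in>D. norm (F (Sup K) - F (Inf K))) < e / 2"
      using ac e unfolding abs_continuous_on_def by (meson half_gt_zero)
    obtain U where U: "open U" "N \<subseteq> U" "U \<in> lmeasurable" "measure lebesgue U < \<delta>"
    proof -
      obtain U where U: "open U" "N \<subseteq> U" "(U - N) \<in> lmeasurable" "emeasure lebesgue (U - N) < ennreal \<delta>"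
        using sets_lebesgue_outer_open[OF negligible_imp_sets[OF N] \<delta>(1)] by blast
      have neg: "negligible ((U - N) - U \<union> (U - (U - N)))"
        by (rule negligible_subset[OF N]) auto
      have "measure lebesgue U = measure lebesgue (U - N)"
        using measure_negligible_symdiff[OF U(3) neg] .
      moreover have "U \<in> lmeasurable"
        using lmeasurable_negligible_symdiff[OF U(3) neg] .
      moreover have "measure lebesgue (U - N) < \<delta>"
        using U(3,4) \<delta>(1) by (simp add: emeasure_eq_measure2 ennreal_less_iff)
      ultimately show ?thesis
        using that[of U] U(1,2) by simp
    qed
    \<comment> \<open>The errors at good tags add up to \<open>e' * (b - a)\<close>, which is below
      \<open>e / 2\<close>; the added 1 covers \<open>a = b\<close>.\<close>
    define e' where "e' = e / (2 * (b - a + 1))"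
    have e': "e' > 0" using e ab by (simp add: e'_def)
    have "\<exists>d>0. \<forall>y\<in>{a..b}. \<bar>y - x\<bar> < d \<longrightarrow> norm (F y - F x - (y - x) *\<^sub>R f x) \<le> e' * \<bar>y - x\<bar>"
      if "x \<in> {a..b} - N" for x
    proof -
      have "(F has_derivative (\<lambda>h. h *\<^sub>R f x)) (at x within {a..b})"
        using that by (auto simp: N_def has_vector_derivative_def)
      then show ?thesis
        unfolding has_derivative_within_alt using e' by auto
    qed
    then obtain d where d: "\<And>x. x \<in> {a..b} - N \<Longrightarrow> d x > 0"
      and dF: "\<And>x y. x \<in> {a..b} - N \<Longrightarrow> y \<in> {a..b} \<Longrightarrow> \<bar>y - x\<bar> < d x \<Longrightarrow>
                 norm (F y - F x - (y - x) *\<^sub>R f x) \<le> e' * \<bar>y - x\<bar>"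
      by metis
    \<comment> \<open>The last branch only makes the gauge total: all tags lie in the
      interval.\<close>
    define \<gamma> where "\<gamma> x = (if x \<in> N then U else if x \<in> {a..b} then ball x (d x) else ball x 1)" for x
    have "gauge \<gamma>" using U d by (auto simp: gauge_def \<gamma>_def)
    moreover have "norm ((\<Sum>(x,k)\<in>p. measure lborel k *\<^sub>R g x) - (F b - F a)) < e"
      if p: "p tagged_division_of {a..b}" "\<gamma> fine p" for p
    proof -
      have finp: "finite p" using p by auto
      define c where "c = (\<lambda>(x::real,k::real set). measure lborel k *\<^sub>R g x - (F (Sup k) - F (Inf k)))"
      define pN where "pN = {q \<in> p. fst q \<in> N}"
      have K: "\<exists>u v. u \<le> v \<and> K = {u..v} \<and> Inf K = u \<and> Sup K = v \<and> x \<in> {u..v} \<and> {u..v} \<subseteq> {a..b} \<and> {u..v} \<subseteq> \<gamma> x"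
        if "(x,K) \<in> p" for x K
        using tagged_division_ofD(2,3,4)[OF p(1) that] fineD[OF p(2) that] by fastforce
      have 1: "norm (c q) \<le> e' * measure lborel (snd q)" if q: "q \<in> p - pN" for q
      proof -
        obtain x K where q': "q = (x,K)" by force
        with q have xK: "(x,K) \<in> p" "x \<notin> N" by (auto simp: pN_def)
        then obtain u v where uv: "u \<le> v" "K = {u..v}" "x \<in> {u..v}" "{u..v} \<subseteq> {a..b}" "{u..v} \<subseteq> \<gamma> x"
          using K by meson
        then have x: "x \<in> {a..b} - N" using xK by auto
        then have ball: "{u..v} \<subseteq> ball x (d x)" using uv by (auto simp: \<gamma>_def)
        then have "u \<in> ball x (d x)" "v \<in> ball x (d x)" using uv(1) by auto
        then have u: "norm (F u - F x - (u - x) *\<^sub>R f x) \<le> e' * \<bar>u - x\<bar>"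
          and v: "norm (F v - F x - (v - x) *\<^sub>R f x) \<le> e' * \<bar>v - x\<bar>"
          using dF[OF x, of u] dF[OF x, of v] uv by (auto simp: dist_real_def abs_minus_commute)
        \<comment> \<open>The tag splits its interval, so both endpoints are compared with the value
          at the tag, and the two error terms add up to the length of the interval.\<close>
        have "c q = (F u - F x - (u - x) *\<^sub>R f x) - (F v - F x - (v - x) *\<^sub>R f x)"
          using uv x by (simp add: c_def q' g_def algebra_simps)
        then have "norm (c q) \<le> e' * \<bar>u - x\<bar> + e' * \<bar>v - x\<bar>"
          using u v by (metis add_mono norm_triangle_ineq4 order_trans)
        also have "\<dots> = e' * measure lborel (snd q)" using uv by (simp add: q' algebra_simps)
        finally show ?thesis .
      qed
      have "(\<Sum>q\<in>p - pN. norm (c q)) \<le> (\<Sum>q\<in>p - pN. e' * measure lborel (snd q))"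
        by (intro sum_mono 1)
      also have "\<dots> \<le> (\<Sum>q\<in>p. e' * measure lborel (snd q))"
        using finp e' by (intro sum_mono2) auto
      also have "\<dots> = e' * (b - a)"
        using additive_content_tagged_division[of p a b] p(1) ab by (simp add: sum_distrib_left[symmetric] split_def)
      also have "\<dots> < e / 2"
        using ab e by (simp add: e'_def field_simps)
      finally have A: "(\<Sum>q\<in>p - pN. norm (c q)) < e / 2" .
      have tp: "pN tagged_division_of \<Union>(snd ` pN)"
      proof (rule tagged_partial_division_of_Union_self)
        show "pN tagged_partial_division_of {a..b}"
          by (rule tagged_partial_division_subset[OF tagged_division_of_def[THEN iffD1, OF p(1), THEN conjunct1]])
            (simp add: pN_def)
      qed
      then have dv: "snd ` pN division_of \<Union>(snd ` pN)" by (rule division_of_tagged_division)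
      have "k \<subseteq> U \<inter> {a..b}" if "(x, k) \<in> pN" for x k
      proof -
        have "(x, k) \<in> p" "x \<in> N" using that by (auto simp: pN_def)
        moreover from K[OF this(1)] have "k \<subseteq> {a..b}" "k \<subseteq> \<gamma> x" by blast+
        ultimately show ?thesis by (simp add: \<gamma>_def)
      qed
      then have subU: "\<Union>(snd ` pN) \<subseteq> U" and sub: "\<Union>(snd ` pN) \<subseteq> {a..b}" by fastforce+
      \<comment> \<open>The value 0 on the empty set, where \<open>Sup\<close> and
        \<open>Inf\<close> carry no meaning, makes \<open>\<Delta>\<close> vanish on all degenerate
        intervals. This is what permits passing from a sum over tagged pairs to a sum over
        intervals.\<close>
      define \<Delta> where "\<Delta> k = (if k = {} then 0 else norm (F (Sup k) - F (Inf k)))" for k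
      have "(\<Sum>q\<in>pN. norm (c q)) = (\<Sum>(x,k)\<in>pN. \<Delta> k)"
      proof (rule sum.cong[OF refl])
        fix q assume q: "q \<in> pN"
        then have "snd q \<noteq> {}" using tagged_division_ofD(2)[OF tp, of "fst q" "snd q"] by auto
        then show "norm (c q) = (case q of (x, k) \<Rightarrow> \<Delta> k)"
          using q by (simp add: c_def pN_def g_def norm_minus_commute \<Delta>_def split_def)
      qed
      also have "\<dots> = (\<Sum>k\<in>snd ` pN. \<Delta> k)"
      proof (rule sum.over_tagged_division_lemma[OF tp])
        fix u v :: real assume "box u v = {}"
        then show "\<Delta> (cbox u v) = 0" by (auto simp: not_less \<Delta>_def)
      qed
      also have "\<dots> = (\<Sum>k\<in>snd ` pN. norm (F (Sup k) - F (Inf k)))"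
        using division_ofD(3)[OF dv] by (intro sum.cong) (auto simp: \<Delta>_def)
      also have "\<dots> < e / 2"
        using \<delta>(2)[of "snd ` pN"] dv sub sum_lengths_division_le[OF dv subU U(3)] U(4) by auto
      finally have B: "(\<Sum>q\<in>pN. norm (c q)) < e / 2" .
      have "(\<Sum>(x,k)\<in>p. measure lborel k *\<^sub>R g x) - (F b - F a) = (\<Sum>q\<in>p. c q)"
        using additive_tagged_division_1[OF ab p(1), of F] by (simp add: c_def split_def sum_subtractf)
      then have "norm ((\<Sum>(x,k)\<in>p. measure lborel k *\<^sub>R g x) - (F b - F a)) \<le> (\<Sum>q\<in>p. norm (c q))"
        by (simp add: norm_sum)
      also have "\<dots> = (\<Sum>q\<in>p - pN. norm (c q)) + (\<Sum>q\<in>pN. norm (c q))"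
        using finp by (intro sum.subset_diff) (auto simp: pN_def)
      finally show ?thesis using A B by linarith
    qed
    ultimately show "\<exists>\<gamma>. gauge \<gamma> \<and> (\<forall>\<D>. \<D> tagged_division_of {a..b} \<and> \<gamma> fine \<D> \<longrightarrow>
        norm ((\<Sum>(x,k)\<in>\<D>. measure lborel k *\<^sub>R g x) - (F b - F a)) < e)"
      by (intro exI[of _ \<gamma>] conjI allI impI) simp_all
  qed
  moreover have "f t = g t" if "t \<in> {a..b} - N" for t using that by (simp add: g_def)
  ultimately show ?thesis using has_integral_spike[OF N] by metis
qed

section \<open>Lebesgue's differentiation theorem\<close>

text \<open>The Vitali covering theorem extracts from the intervals on which the difference quotient is bad a
  disjoint family, and Henstock's lemma bounds the total length of that family.\<close>

theorem lebesgue_differentiation: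
  fixes f :: "real \<Rightarrow> 'a::euclidean_space"
  assumes f: "f integrable_on {a..b}"
  shows "AE t in lebesgue_on {a..b}. ((\<lambda>t. integral {a..t} f) has_vector_derivative f t) (at t within {a..b})"
proof -
  define F where "F t = integral {a..t} f" for t
  define bad where "bad \<epsilon> x y \<longleftrightarrow> y \<noteq> x \<and> norm (F y - F x - (y - x) *\<^sub>R f x) > \<epsilon> * \<bar>y - x\<bar>" for \<epsilon> x y
  \<comment> \<open>The points where the quotient misses \<open>f x\<close> by more than \<epsilon>
    at arbitrarily small scales. Off the union of these sets for \<epsilon> = 1/(n+1) the derivative
    exists.\<close>
  define E where "E \<epsilon> = {x \<in> {a..b}. \<forall>d>0. \<exists>y\<in>{a..b}. \<bar>y - x\<bar> < d \<and> bad \<epsilon> x y}" for \<epsilon>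
  have neg: "negligible (E \<epsilon>)" if \<epsilon>: "\<epsilon> > 0" for \<epsilon>
    unfolding negligible_outer_le
  proof (intro allI impI)
    fix e :: real assume e: "e > 0"
    have "f integrable_on cbox a b" using f by simp
    \<comment> \<open>On a bad interval the Henstock error is at least \<epsilon> times the length.
      The tolerance \<open>\<epsilon> * e\<close> therefore gives total length at most
      \<open>e\<close>.\<close>
    then obtain \<gamma> where \<gamma>: "gauge \<gamma>" and H: "\<And>p. \<lbrakk>p tagged_partial_division_of cbox a b; \<gamma> fine p\<rbrakk> \<Longrightarrow>
             (\<Sum>(x,k)\<in>p. norm (measure lborel k *\<^sub>R f x - integral k f)) < \<epsilon> * e"
      by (rule Henstock_lemma[OF _ mult_pos_pos[OF \<epsilon> e]]) blast
    \<comment> \<open>The family is indexed by pairs of a tag and the other endpoint, and the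
      intervals are rewritten as balls about their midpoints for the covering theorem. The last
      condition makes every finite subfamily fine for the gauge.\<close>
    define K where "K = {(x, y). x \<in> E \<epsilon> \<and> y \<in> {a..b} \<and> bad \<epsilon> x y \<and> {min x y..max x y} \<subseteq> \<gamma> x}"
    define c where "c = (\<lambda>(x::real, y). (x + y) / 2)"
    define r where "r = (\<lambda>(x::real, y). \<bar>y - x\<bar> / 2)"
    have cb: "cball (c (x, y)) (r (x, y)) = {min x y..max x y}" for x y
    proof -
      have "(x + y) / 2 - \<bar>y - x\<bar> / 2 = min x y" "(x + y) / 2 + \<bar>y - x\<bar> / 2 = max x y"
        by (simp_all add: min_def max_def abs_if field_simps)
      then show ?thesis by (simp add: c_def r_def cball_eq_atLeastAtMost)
    qed
    have cov: "\<exists>i. i \<in> K \<and> x \<in> cball (c i) (r i) \<and> r i < d" if x: "x \<in> E \<epsilon>" and d: "d > 0" for x d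
    proof -
      obtain \<eta> where \<eta>: "\<eta> > 0" "ball x \<eta> \<subseteq> \<gamma> x"
        using \<gamma> unfolding gauge_def by (meson openE)
      obtain y where y: "y \<in> {a..b}" "\<bar>y - x\<bar> < min d \<eta>" "bad \<epsilon> x y"
        using x d \<eta>(1) unfolding E_def by (smt (verit) mem_Collect_eq)
      have "{min x y..max x y} \<subseteq> ball x \<eta>"
        using y(2) by (auto simp: dist_real_def)
      then have "(x, y) \<in> K" using x y \<eta> by (auto simp: K_def)
      then show ?thesis
        using y(2) d cb[of x y] by (intro exI[of _ "(x, y)"]) (auto simp: r_def)
    qed
    have pos: "0 < r i" if "i \<in> K" for i
      using that by (auto simp: K_def r_def bad_def)
    obtain C where C: "countable C" "C \<subseteq> K"
      and disj: "pairwise (\<lambda>i j. disjnt (cball (c i) (r i)) (cball (c j) (r j))) C"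
      and negC: "negligible (E \<epsilon> - (\<Union>i\<in>C. cball (c i) (r i)))"
      by (rule Vitali_covering_theorem_cballs[of K r "E \<epsilon>" c, OF pos cov]) (assumption | rule that)+
    have len: "measure lebesgue (\<Union>i\<in>G. cball (c i) (r i)) \<le> e" if G: "G \<subseteq> C" "finite G" for G
    proof -
      define p where "p = (\<lambda>(x, y). (x, {min x y..max x y})) ` G"
      have GK: "G \<subseteq> K" using G C by blast
      have inj: "inj_on (\<lambda>(x, y). (x, {min x y..max x y})) G"
        by (auto simp: inj_on_def min_def max_def split: if_splits)
      have ptp: "p tagged_partial_division_of cbox a b"
        unfolding tagged_partial_division_of_def
      proof (intro conjI allI impI)
        show "finite p" using G by (simp add: p_def)
        fix x k assume "(x, k) \<in> p"
        then obtain y where y: "(x, y) \<in> G" "k = {min x y..max x y}" by (auto simp: p_def)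
        then have xy: "x \<in> {a..b}" "y \<in> {a..b}" using GK by (auto simp: K_def E_def)
        show "x \<in> k" "k \<subseteq> cbox a b" using y xy by auto
        show "\<exists>u v. k = cbox u v" using y by (metis box_real(2))
      next
        fix x k x' k' assume A: "(x, k) \<in> p \<and> (x', k') \<in> p \<and> (x, k) \<noteq> (x', k')"
        then obtain y y' where y: "(x, y) \<in> G" "k = {min x y..max x y}"
          and y': "(x', y') \<in> G" "k' = {min x' y'..max x' y'}" by (auto simp: p_def)
        then have "(x, y) \<noteq> (x', y')" using A by auto
        then have "disjnt (cball (c (x, y)) (r (x, y))) (cball (c (x', y')) (r (x', y')))"
          using pairwiseD[OF disj, of "(x, y)" "(x', y')"] y(1) y'(1) G(1) by blast
        then have "k \<inter> k' = {}" unfolding cb using y y' by (simp add: disjnt_def)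
        then show "interior k \<inter> interior k' = {}" using interior_subset by blast
      qed
      moreover have "\<gamma> fine p" using GK by (auto simp: fine_def p_def K_def)
      ultimately have less: "(\<Sum>(x,k)\<in>p. norm (measure lborel k *\<^sub>R f x - integral k f)) < \<epsilon> * e" by (rule H)
      have bd: "\<epsilon> * \<bar>y - x\<bar> \<le> norm (measure lborel {min x y..max x y} *\<^sub>R f x - integral {min x y..max x y} f)"
        if "(x, y) \<in> G" for x y
      proof -
        have xy: "x \<in> {a..b}" "y \<in> {a..b}" "bad \<epsilon> x y" using that GK by (auto simp: K_def E_def)
        have "integral {u..v} f = F v - F u" if "u \<le> v" "u \<in> {a..b}" "v \<in> {a..b}" for u v
        proof -
          have "f integrable_on {a..v}" using f that by (auto intro: integrable_subinterval_real)
          then show ?thesis using Henstock_Kurzweil_Integration.integral_combine[of a u v f] that by (auto simp: F_def algebra_simps)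
        qed
        then have "integral {min x y..max x y} f = F (max x y) - F (min x y)" using xy by auto
        then have "measure lborel {min x y..max x y} *\<^sub>R f x - integral {min x y..max x y} f
            = (if x \<le> y then - (F y - F x - (y - x) *\<^sub>R f x) else F y - F x - (y - x) *\<^sub>R f x)"
          by (cases "x \<le> y") (simp_all add: min_def max_def algebra_simps)
        then have "norm (measure lborel {min x y..max x y} *\<^sub>R f x - integral {min x y..max x y} f)
            = norm (F y - F x - (y - x) *\<^sub>R f x)"
          by (metis norm_minus_cancel)
        then show ?thesis using xy(3) by (simp add: bad_def)
      qed
      have "\<epsilon> * (\<Sum>i\<in>G. 2 * r i) = (\<Sum>(x,y)\<in>G. \<epsilon> * \<bar>y - x\<bar>)"
        by (simp add: sum_distrib_left r_def split_def)
      also have "\<dots> \<le> (\<Sum>(x,y)\<in>G. norm (measure lborel {min x y..max x y} *\<^sub>R f x - integral {min x y..max x y} f))"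
        using bd by (intro sum_mono) (auto simp del: content_real_if)
      also have "\<dots> = (\<Sum>(x,k)\<in>p. norm (measure lborel k *\<^sub>R f x - integral k f))"
        unfolding p_def by (subst sum.reindex[OF inj]) (auto simp: o_def split_def simp del: content_real_if intro!: sum.cong)
      finally have "(\<Sum>i\<in>G. 2 * r i) \<le> e" using less \<epsilon> by (smt (verit) mult_less_cancel_left_pos)
      moreover have "measure lebesgue (\<Union>i\<in>G. cball (c i) (r i)) \<le> (\<Sum>i\<in>G. measure lebesgue (cball (c i) (r i)))"
        using G(2) by (intro measure_UNION_le) auto
      moreover have "measure lebesgue (cball (c i) (r i)) = 2 * r i" if "i \<in> G" for i
      proof -
        obtain x y where i: "i = (x, y)" by force
        have "measure lebesgue {min x y..max x y} = \<bar>y - x\<bar>" by (simp add: min_def max_def)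
        then show ?thesis unfolding i cb by (simp add: r_def)
      qed
      ultimately show ?thesis by simp
    qed
    have meas: "cball (c i) (r i) \<in> lmeasurable" for i by simp
    \<comment> \<open>The bound \<open>len\<close> is uniform over finite subfamilies and so passes
      to the countable union.\<close>
    have U: "(\<Union>i\<in>C. cball (c i) (r i)) \<in> lmeasurable" "measure lebesgue (\<Union>i\<in>C. cball (c i) (r i)) \<le> e"
      using fmeasurable_UN_bound[OF C(1) meas len] measure_UN_bound[OF C(1) meas len] by auto
    let ?T = "(E \<epsilon> - (\<Union>i\<in>C. cball (c i) (r i))) \<union> (\<Union>i\<in>C. cball (c i) (r i))"
    have "?T \<in> lmeasurable"
      using U(1) negligible_imp_measurable[OF negC] by (rule fmeasurable.Un[rotated])
    moreover have "measure lebesgue ?T \<le> e"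
      using U negligible_imp_measurable[OF negC] negligible_imp_measure0[OF negC]
        measure_Un_le[of "E \<epsilon> - (\<Union>i\<in>C. cball (c i) (r i))" lebesgue "\<Union>i\<in>C. cball (c i) (r i)"]
      by (auto simp: fmeasurableD)
    ultimately show "\<exists>T. E \<epsilon> \<subseteq> T \<and> T \<in> lmeasurable \<and> measure lebesgue T \<le> e"
      by (intro exI[of _ ?T] conjI) auto
  qed
  have negU: "negligible (\<Union>n. E (1 / real (Suc n)))" by (intro negligible_Union_nat neg) simp
  have derF: "(F has_vector_derivative f x) (at x within {a..b})"
    if x: "x \<in> {a..b}" and nE: "x \<notin> (\<Union>n. E (1 / real (Suc n)))" for x
    unfolding has_vector_derivative_def has_derivative_within_alt
  proof (intro conjI allI impI)
    fix e :: real assume "e > 0"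
    then obtain n where n: "1 / real (Suc n) < e" by (metis nat_approx_posE inverse_eq_divide)
    obtain d where d: "d > 0" "\<And>y. y \<in> {a..b} \<Longrightarrow> \<bar>y - x\<bar> < d \<Longrightarrow> \<not> bad (1 / real (Suc n)) x y"
    proof -
      have "x \<notin> E (1 / real (Suc n))" using nE by blast
      then show ?thesis using x that unfolding E_def by auto
    qed
    show "\<exists>d>0. \<forall>y\<in>{a..b}. norm (y - x) < d \<longrightarrow> norm (F y - F x - (y - x) *\<^sub>R f x) \<le> e * norm (y - x)"
    proof (intro exI[of _ d] conjI ballI impI d(1))
      fix y assume y: "y \<in> {a..b}" "norm (y - x) < d"
      have "norm (F y - F x - (y - x) *\<^sub>R f x) \<le> 1 / real (Suc n) * \<bar>y - x\<bar>"
        using d(2)[OF y(1)] y(2) by (cases "y = x") (auto simp: bad_def not_less)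
      also have "\<dots> \<le> e * norm (y - x)"
        unfolding real_norm_def using n by (intro mult_right_mono) auto
      finally show "norm (F y - F x - (y - x) *\<^sub>R f x) \<le> e * norm (y - x)" .
    qed
  qed (simp add: bounded_linear_scaleR_left)
  have "negligible {t \<in> {a..b}. \<not> (F has_vector_derivative f t) (at t within {a..b})}"
    by (rule negligible_subset[OF negU]) (use derF in blast)
  moreover have "(\<lambda>t. integral {a..t} f) = F" by (simp add: F_def fun_eq_iff)
  ultimately show ?thesis by (simp add: AE_lebesgue_on_iff_negligible)
qed

section \<open>Differential equations with measurable coefficients\<close>

text \<open>The weighted majorant \<open>h\<close> has derivative K (\<phi> - G) exp (-K s), which
  is at most 0 by hypothesis, so \<open>h\<close> stays below its initial value
  \<open>a\<close>.\<close>

lemma gronwall: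
  fixes \<phi> :: "real \<Rightarrow> real"
  assumes cont: "continuous_on {0..T} \<phi>" and K: "K \<ge> 0"
    and le: "\<And>t. t \<in> {0..T} \<Longrightarrow> \<phi> t \<le> a + K * integral {0..t} \<phi>"
    and t: "t \<in> {0..T}"
  shows "\<phi> t \<le> a * exp (K * t)"
proof -
  define G where "G t = a + K * integral {0..t} \<phi>" for t
  define h where "h t = G t * exp (- (K * t))" for t
  have der: "(h has_derivative (\<lambda>x. x * (K * (\<phi> s - G s) * exp (- (K * s))))) (at s within {0..t})"
    if s: "s \<in> {0..t}" for s
  proof -
    have "((\<lambda>u. integral {0..u} \<phi>) has_vector_derivative \<phi> s) (at s within {0..t})"
      using s t cont by (intro integral_has_vector_derivative) (auto intro: continuous_on_subset)
    then have "((\<lambda>u. integral {0..u} \<phi>) has_real_derivative \<phi> s) (at s within {0..t})"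
      by (simp add: has_real_derivative_iff_has_vector_derivative)
    then have "(h has_real_derivative (K * \<phi> s * exp (- (K * s)) + G s * (exp (- (K * s)) * (- K)))) (at s within {0..t})"
      unfolding h_def G_def by (auto intro!: derivative_eq_intros)
    moreover have "K * \<phi> s * exp (- (K * s)) + G s * (exp (- (K * s)) * (- K)) = K * (\<phi> s - G s) * exp (- (K * s))"
      by (simp add: algebra_simps)
    ultimately show ?thesis by (simp add: has_field_derivative_def mult_commute_abs)
  qed
  obtain s where s: "s \<in> {0..t}" "h t - h 0 = (t - 0) * (K * (\<phi> s - G s) * exp (- (K * s)))"
    using mvt_very_simple[of 0 t h "\<lambda>s x. x * (K * (\<phi> s - G s) * exp (- (K * s)))"] der t by auto
  have "\<phi> s \<le> G s" using le[of s] s t by (simp add: G_def)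
  then have "(t - 0) * (K * (\<phi> s - G s) * exp (- (K * s))) \<le> 0"
    using K t by (intro mult_nonneg_nonpos mult_nonpos_nonneg) auto
  then have "h t \<le> a" using s(2) by (simp add: h_def G_def)
  then have "G t \<le> a * exp (K * t)"
    by (simp add: h_def exp_minus field_simps)
  then show ?thesis using le[OF t] by (simp add: G_def)
qed

text \<open>The growth condition is imposed along the given solution only. Hence the same bound
  applies to the state equation forced by the control and to its closed-loop form forced by a
  residual.\<close>

lemma solves_ode_norm_bound:
  fixes y :: "real \<Rightarrow> 'a::euclidean_space"
  assumes sol: "solves_ode T F y" and y0: "y 0 = 0" and K: "K \<ge> 0"
    and le: "AE t in lebesgue_on {0..T}. norm (F t (y t)) \<le> K * norm (y t) + k t"
    and k: "integrable (lebesgue_on {0..T}) k" "\<And>t. t \<in> {0..T} \<Longrightarrow> k t \<ge> 0"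
    and t: "t \<in> {0..T}"
  shows "norm (y t) \<le> (LINT t|lebesgue_on {0..T}. k t) * exp (K * t)"
proof (rule gronwall[where T = T and \<phi> = "\<lambda>t. norm (y t)", OF _ K _ t])
  have ac: "abs_continuous_on {0..T} y"
    and der: "AE t in lebesgue_on {0..T}. (y has_vector_derivative F t (y t)) (at t within {0..T})"
    using sol by (auto simp: solves_ode_def)
  show cont: "continuous_on {0..T} (\<lambda>t. norm (y t))"
    by (intro continuous_on_norm abs_continuous_on_imp_continuous_on ac)
  fix u assume u: "u \<in> {0..T}"
  \<comment> \<open>A representative of the right-hand side that obeys the growth bound at every
    point, as the comparison of integrals below requires.\<close>
  define g where "g s = (if norm (F s (y s)) \<le> K * norm (y s) + k s then F s (y s) else 0)" for s
  define N where "N = {s \<in> {0..T}. \<not> norm (F s (y s)) \<le> K * norm (y s) + k s}"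
  have N: "negligible N" unfolding N_def using le by (subst (asm) AE_lebesgue_on_iff_negligible) auto
  have "negligible {s \<in> {0..u}. \<not> (y has_vector_derivative F s (y s)) (at s within {0..u})}"
    using der unfolding AE_lebesgue_on_iff_negligible[of "{0..T}", simplified]
    by (rule negligible_subset) (use u in \<open>auto intro: has_vector_derivative_within_subset\<close>)
  then have "AE s in lebesgue_on {0..u}. (y has_vector_derivative F s (y s)) (at s within {0..u})"
    by (simp add: AE_lebesgue_on_iff_negligible)
  then have "((\<lambda>s. F s (y s)) has_integral (y u - y 0)) {0..u}"
    using u by (intro abs_continuous_on_has_integral abs_continuous_on_subset[OF ac]) auto
  then have g: "(g has_integral (y u)) {0..u}"
    using y0 u by (intro has_integral_spike[OF N, of _ g]) (auto simp: g_def N_def)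
  have kT: "k integrable_on {0..T}" using integrable_on_lebesgue_on[OF k(1)] by simp
  then have ku: "k integrable_on {0..u}" using u by (auto intro: integrable_subinterval_real)
  have yu: "(\<lambda>s. norm (y s)) integrable_on {0..u}"
    using u by (intro integrable_continuous_real continuous_on_subset[OF cont]) auto
  have "norm (y u) = norm (integral {0..u} g)" using g by (simp add: integral_unique)
  also have "\<dots> \<le> integral {0..u} (\<lambda>s. K * norm (y s) + k s)"
  proof (rule integral_norm_bound_integral)
    show "g integrable_on {0..u}" using g by blast
    show "(\<lambda>s. K * norm (y s) + k s) integrable_on {0..u}"
      using integrable_add[OF integrable_on_cmult_left[OF yu, of K] ku] by simp
    show "norm (g s) \<le> K * norm (y s) + k s" if "s \<in> {0..u}" for s
      using k(2)[of s] K that u by (auto simp: g_def)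
  qed
  also have "\<dots> = K * integral {0..u} (\<lambda>s. norm (y s)) + integral {0..u} k"
    using integral_add[OF integrable_on_cmult_left[OF yu, of K] ku] by simp
  \<comment> \<open>Since \<open>k\<close> is nonnegative, its integral may be extended to the whole
    interval; this makes the constant in Gronwall's inequality independent of
    \<open>u\<close>.\<close>
  also have "integral {0..u} k \<le> integral {0..T} k"
    using u k(2) by (intro integral_subset_le ku kT) auto
  also have "integral {0..T} k = (LINT t|lebesgue_on {0..T}. k t)"
    using k(1) by (simp add: lebesgue_integral_eq_integral)
  finally show "norm (y u) \<le> (LINT t|lebesgue_on {0..T}. k t) + K * integral {0..u} (\<lambda>s. norm (y s))"
    by simp
qed

text \<open>The exponential weight makes the Picard operator a contraction on the whole interval.\<close>

theorem caratheodory_lipschitz_ode_exists: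
  fixes F :: "real \<Rightarrow> 'a::euclidean_space \<Rightarrow> 'a"
  assumes t0: "t0 \<in> {0..T}" and K: "K > 0"
    and meas: "\<And>z. continuous_on {0..T} z \<Longrightarrow> (\<lambda>t. F t (z t)) \<in> borel_measurable (lebesgue_on {0..T})"
    and lip: "\<And>t x y. t \<in> {0..T} \<Longrightarrow> norm (F t x - F t y) \<le> K * norm (x - y)"
    and bd: "\<And>t. t \<in> {0..T} \<Longrightarrow> norm (F t 0) \<le> K0"
  obtains z C where "\<And>s t. s \<in> {0..T} \<Longrightarrow> t \<in> {0..T} \<Longrightarrow> norm (z t - z s) \<le> C * \<bar>t - s\<bar>"
    and "solves_ode T F z" and "z t0 = z0"
proof -
  \<comment> \<open>The rate \<open>2 * K\<close>, twice the Lipschitz constant, yields the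
    contraction factor 1/2. The absolute value serves both sides of \<open>t0\<close>, in particular
    terminal value problems.\<close>
  define W where "W t = exp (2 * K * \<bar>t - t0\<bar>)" for t
  have W0: "W t > 0" for t by (simp add: W_def)
  have Wc: "continuous_on S W" for S unfolding W_def by (intro continuous_intros)
  have Fb: "norm (F t x) \<le> K * norm x + K0" if "t \<in> {0..T}" for t x
    using lip[OF that, of x 0] bd[OF that] norm_triangle_ineq2[of "F t x" "F t 0"] by simp
  have bdd: "\<exists>B. \<forall>t\<in>{0..T}. norm (F t (z t)) \<le> B" if z: "continuous_on {0..T} z" for z
  proof -
    have "bounded (z ` {0..T})" by (intro compact_imp_bounded compact_continuous_image z) simp
    then obtain M where M: "\<And>t. t \<in> {0..T} \<Longrightarrow> norm (z t) \<le> M" unfolding bounded_iff by blast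
    have "norm (F t (z t)) \<le> K * M + K0" if "t \<in> {0..T}" for t
      using Fb[OF that, of "z t"] mult_left_mono[OF M[OF that], of K] K by linarith
    then show ?thesis by blast
  qed
  have int: "(\<lambda>t. F t (z t)) integrable_on {0..T}" if z: "continuous_on {0..T} z" for z
  proof -
    obtain B where "\<And>t. t \<in> {0..T} \<Longrightarrow> norm (F t (z t)) \<le> B" using bdd[OF z] by blast
    then show ?thesis
      by (intro measurable_bounded_by_integrable_imp_integrable[OF meas[OF z], where g = "\<lambda>_. B"]) auto
  qed
  \<comment> \<open>The signed integral from \<open>t0\<close> to \<open>t\<close> is written as
    \<open>I z t - I z t0\<close>, which avoids orienting intervals.\<close>
  define I where "I z t = integral {0..t} (\<lambda>s. F s (z s))" for z t
  have Idiff: "I z t - I z s = integral {s..t} (\<lambda>s. F s (z s))"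
    and intst: "(\<lambda>s. F s (z s)) integrable_on {s..t}"
    if z: "continuous_on {0..T} z" and st: "s \<in> {0..T}" "t \<in> {0..T}" "s \<le> t" for z s t
  proof -
    have "(\<lambda>s. F s (z s)) integrable_on {0..t}"
      using int[OF z] st by (auto intro: integrable_subinterval_real)
    then show "I z t - I z s = integral {s..t} (\<lambda>s. F s (z s))"
      using Henstock_Kurzweil_Integration.integral_combine[of 0 s t "\<lambda>s. F s (z s)"] st by (auto simp: I_def algebra_simps)
    show "(\<lambda>s. F s (z s)) integrable_on {s..t}"
      using int[OF z] st by (auto intro: integrable_subinterval_real)
  qed
  have Ilip: "norm (I z t - I z s) \<le> B * \<bar>t - s\<bar>"
    if z: "continuous_on {0..T} z" and B: "\<And>t. t \<in> {0..T} \<Longrightarrow> norm (F t (z t)) \<le> B"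
      and st: "s \<in> {0..T}" "t \<in> {0..T}" for z B s t
  proof -
    have *: "norm (I z v - I z u) \<le> B * (v - u)" if "u \<in> {0..T}" "v \<in> {0..T}" "u \<le> v" for u v
    proof -
      have "norm (integral {u..v} (\<lambda>s. F s (z s))) \<le> integral {u..v} (\<lambda>_. B)"
        using that B by (intro integral_norm_bound_integral intst[OF z]) auto
      then show ?thesis using Idiff[OF z that] that(3) by (simp add: mult.commute)
    qed
    show ?thesis using *[OF st] *[OF st(2,1)] by (cases "s \<le> t") (auto simp: norm_minus_commute)
  qed
  have Ic: "continuous_on {0..T} (I z)" if z: "continuous_on {0..T} z" for z
  proof -
    obtain B where B: "\<And>t. t \<in> {0..T} \<Longrightarrow> norm (F t (z t)) \<le> B" using bdd[OF z] by blast
    have "abs_continuous_on {0..T} (I z)"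
      by (rule lipschitz_imp_abs_continuous_on[OF Ilip[OF z B]])
    then show ?thesis by (rule abs_continuous_on_imp_continuous_on)
  qed
  have contr: "norm ((I z1 t - I z1 t0) - (I z2 t - I z2 t0)) \<le> N / 2 * W t"
    if z: "continuous_on {0..T} z1" "continuous_on {0..T} z2"
      and N: "N \<ge> 0" "\<And>t. t \<in> {0..T} \<Longrightarrow> norm (z1 t - z2 t) \<le> N * W t" and t: "t \<in> {0..T}" for z1 z2 N t
  proof -
    have *: "norm ((I z1 v - I z1 u) - (I z2 v - I z2 u)) \<le> N / 2 * W t"
      if uv: "u = min t t0" "v = max t t0" for u v
    proof -
      have uvT: "u \<in> {0..T}" "v \<in> {0..T}" "u \<le> v" using t t0 uv by auto
      \<comment> \<open>On the interval between \<open>t\<close> and \<open>t0\<close> this sign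
        removes the absolute value in the weight, which becomes an exponential with an explicit
        primitive.\<close>
      define \<sigma> where "\<sigma> = (if t \<ge> t0 then 1 else - 1 :: real)"
      have Wint: "((\<lambda>s. K * (N * W s)) has_integral (N / 2 * (W t - 1))) {u..v}"
      proof -
        have "((\<lambda>s. K * N * exp (2 * K * \<sigma> * (s - t0))) has_integral
           (\<sigma> * N / 2 * exp (2 * K * \<sigma> * (v - t0)) - \<sigma> * N / 2 * exp (2 * K * \<sigma> * (u - t0)))) {u..v}"
        proof (rule fundamental_theorem_of_calculus[OF uvT(3)])
          fix s
          have "\<sigma> * \<sigma> = 1" by (simp add: \<sigma>_def)
          then show "((\<lambda>s. \<sigma> * N / 2 * exp (2 * K * \<sigma> * (s - t0))) has_vector_derivative
              K * N * exp (2 * K * \<sigma> * (s - t0))) (at s within {u..v})"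
            unfolding has_real_derivative_iff_has_vector_derivative[symmetric]
            by (auto intro!: derivative_eq_intros simp: algebra_simps)
        qed
        moreover have "\<sigma> * N / 2 * exp (2 * K * \<sigma> * (v - t0)) - \<sigma> * N / 2 * exp (2 * K * \<sigma> * (u - t0)) = N / 2 * (W t - 1)"
          using uv by (auto simp: \<sigma>_def W_def algebra_simps min_def max_def)
        moreover have "K * N * exp (2 * K * \<sigma> * (s - t0)) = K * (N * W s)" if "s \<in> {u..v}" for s
          using that uv by (auto simp: \<sigma>_def W_def min_def max_def split: if_splits)
        ultimately show ?thesis by (metis (no_types, lifting) has_integral_eq)
      qed
      have "(I z1 v - I z1 u) - (I z2 v - I z2 u) = integral {u..v} (\<lambda>s. F s (z1 s) - F s (z2 s))"
        using Idiff[OF z(1) uvT] Idiff[OF z(2) uvT] integral_diff[OF intst[OF z(1) uvT] intst[OF z(2) uvT]] by simp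
      also have "norm \<dots> \<le> integral {u..v} (\<lambda>s. K * (N * W s))"
      proof (rule integral_norm_bound_integral)
        show "(\<lambda>s. F s (z1 s) - F s (z2 s)) integrable_on {u..v}"
          by (intro integrable_diff intst[OF z(1) uvT] intst[OF z(2) uvT])
        show "(\<lambda>s. K * (N * W s)) integrable_on {u..v}" using Wint by blast
        fix s assume "s \<in> {u..v}"
        then have s: "s \<in> {0..T}" using uvT by auto
        show "norm (F s (z1 s) - F s (z2 s)) \<le> K * (N * W s)"
          using lip[OF s, of "z1 s" "z2 s"] mult_left_mono[OF N(2)[OF s], of K] K by linarith
      qed
      also have "\<dots> = N / 2 * (W t - 1)" using Wint by blast
      also have "\<dots> \<le> N / 2 * W t" using N(1) by (simp add: algebra_simps)
      finally show ?thesis .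
    qed
    show ?thesis
    proof (cases "t0 \<le> t")
      case True
      then show ?thesis using *[of t0 t] by simp
    next
      case False
      have "(I z1 t - I z1 t0) - (I z2 t - I z2 t0) = - ((I z1 t0 - I z1 t) - (I z2 t0 - I z2 t))"
        by simp
      then have "norm ((I z1 t - I z1 t0) - (I z2 t - I z2 t0)) = norm ((I z1 t0 - I z1 t) - (I z2 t0 - I z2 t))"
        by (metis norm_minus_cancel)
      then show ?thesis using *[of t t0] False by simp
    qed
  qed
  \<comment> \<open>Bounded continuous functions are taken on the whole line; clamping extends the
    Picard iterate from the interval to the line.\<close>
  define cl where "cl t = max 0 (min T t)" for t
  have cl: "cl t \<in> {0..T}" "continuous_on UNIV cl" for t
    using t0 by (auto simp: cl_def intro!: continuous_intros)
  have clid: "cl t = t" if "t \<in> {0..T}" for t using that by (simp add: cl_def)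
  \<comment> \<open>The fixed point is sought for the quotient by the weight, so that the plain
    supremum distance of \<open>w\<close> is the weighted distance of \<open>Z w\<close>.\<close>
  define Z where "Z w t = W t *\<^sub>R apply_bcontfun w t" for w :: "real \<Rightarrow>\<^sub>C 'a" and t
  have Zc: "continuous_on {0..T} (Z w)" for w
    unfolding Z_def using continuous_on_subset[OF continuous_on_apply_bcontfun]
    by (intro continuous_on_scaleR Wc) auto
  define \<Psi> where "\<Psi> w t = (1 / W t) *\<^sub>R (z0 + (I (Z w) t - I (Z w) t0))" for w t
  have \<Psi>c: "continuous_on {0..T} (\<Psi> w)" for w
    unfolding \<Psi>_def using W0 by (intro continuous_intros Ic Zc Wc) (metis less_irrefl)
  have bc: "(\<lambda>t. \<Psi> w (cl t)) \<in> bcontfun" for w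
  proof -
    have "continuous_on UNIV (\<lambda>t. \<Psi> w (cl t))"
      by (rule continuous_on_compose2[OF \<Psi>c cl(2)]) (use cl(1) in auto)
    moreover have "bounded (\<Psi> w ` {0..T})"
      by (intro compact_imp_bounded compact_continuous_image \<Psi>c) simp
    then have "bounded (range (\<lambda>t. \<Psi> w (cl t)))"
      by (rule bounded_subset) (use cl(1) in auto)
    ultimately show ?thesis by (simp add: bcontfun_def)
  qed
  define P where "P w = Bcontfun (\<lambda>t. \<Psi> w (cl t))" for w
  have P: "apply_bcontfun (P w) t = \<Psi> w (cl t)" for w t
    using bc by (simp add: P_def Bcontfun_inverse)
  have "dist (P w1) (P w2) \<le> 1 / 2 * dist w1 w2" for w1 w2
  proof (rule dist_bound)
    fix t
    have N: "norm (Z w1 s - Z w2 s) \<le> dist w1 w2 * W s" for s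
    proof -
      have "norm (Z w1 s - Z w2 s) = W s * dist (apply_bcontfun w1 s) (apply_bcontfun w2 s)"
        using W0[of s] by (simp add: Z_def dist_norm flip: scaleR_diff_right)
      also have "\<dots> \<le> W s * dist w1 w2"
        using W0[of s] by (intro mult_left_mono dist_bounded) auto
      finally show ?thesis by (simp add: mult.commute)
    qed
    let ?t = "cl t"
    have "dist (apply_bcontfun (P w1) t) (apply_bcontfun (P w2) t) =
        norm ((1 / W ?t) *\<^sub>R ((I (Z w1) ?t - I (Z w1) t0) - (I (Z w2) ?t - I (Z w2) t0)))"
      by (simp add: P \<Psi>_def dist_norm algebra_simps)
    also have "\<dots> = 1 / W ?t * norm ((I (Z w1) ?t - I (Z w1) t0) - (I (Z w2) ?t - I (Z w2) t0))"
      using W0[of ?t] by simp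
    also have "\<dots> \<le> 1 / W ?t * (dist w1 w2 / 2 * W ?t)"
      using W0[of ?t] by (intro mult_left_mono contr[OF Zc Zc _ N cl(1)]) auto
    also have "\<dots> = 1 / 2 * dist w1 w2" using W0[of ?t] by simp
    finally show "dist (apply_bcontfun (P w1) t) (apply_bcontfun (P w2) t) \<le> 1 / 2 * dist w1 w2" .
  qed
  then have "\<exists>!w. P w = w" by (intro banach_fix_type[of "1 / 2"]) auto
  then obtain w where w: "P w = w" by blast
  have zeq: "Z w t = z0 + (I (Z w) t - I (Z w) t0)" if "t \<in> {0..T}" for t
  proof -
    have "apply_bcontfun w t = \<Psi> w t" using P[of w t] w clid[OF that] by simp
    then show ?thesis using W0[of t] by (simp add: Z_def[of w t] \<Psi>_def)
  qed
  obtain B where B: "\<And>t. t \<in> {0..T} \<Longrightarrow> norm (F t (Z w t)) \<le> B" using bdd[OF Zc] by blast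
  have lipz: "norm (Z w t - Z w s) \<le> B * \<bar>t - s\<bar>" if "s \<in> {0..T}" "t \<in> {0..T}" for s t
    using Ilip[OF Zc B that] zeq[OF that(1)] zeq[OF that(2)] by simp
  have der: "(Z w has_vector_derivative F t (Z w t)) (at t within {0..T})"
    if t: "t \<in> {0..T}" and d: "((\<lambda>t. integral {0..t} (\<lambda>s. F s (Z w s))) has_vector_derivative F t (Z w t)) (at t within {0..T})" for t
  proof -
    have "((\<lambda>t. z0 + (I (Z w) t - I (Z w) t0)) has_vector_derivative F t (Z w t)) (at t within {0..T})"
      using d unfolding I_def by (auto intro!: derivative_eq_intros)
    then show ?thesis
      by (rule has_vector_derivative_transform[OF t, of "Z w" "\<lambda>t. z0 + (I (Z w) t - I (Z w) t0)", rotated])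
        (rule zeq)
  qed
  have "solves_ode T F (Z w)"
    unfolding solves_ode_def
  proof
    show "abs_continuous_on {0..T} (Z w)" by (rule lipschitz_imp_abs_continuous_on[OF lipz])
    show "AE t in lebesgue_on {0..T}. (Z w has_vector_derivative F t (Z w t)) (at t within {0..T})"
      by (rule lebesgue_on_mono[OF lebesgue_differentiation[OF int[OF Zc]]]) (rule der)
  qed
  moreover have "Z w t0 = z0" using zeq[OF t0] by simp
  ultimately show thesis using lipz that[of "Z w" B] by blast
qed

section \<open>Measurability of derivatives\<close>

text \<open>This is completeness of Lebesgue measure: preimages under the two functions differ by a
  null set.\<close>

lemma borel_measurable_lebesgue_on_AE_eq:
  assumes f: "f \<in> borel_measurable (lebesgue_on S)" and S: "S \<in> sets lebesgue"
    and eq: "AE x in lebesgue_on S. f x = g x"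
  shows "g \<in> borel_measurable (lebesgue_on S)"
proof (rule measurableI)
  fix A :: "'b set" assume A: "A \<in> sets borel"
  have Ssets: "B \<in> sets (lebesgue_on S) \<longleftrightarrow> B \<subseteq> S \<and> B \<in> sets lebesgue" for B
    using S by (auto simp: sets_restrict_space_iff)
  have fA: "f -` A \<inter> S \<in> sets lebesgue"
    using measurable_sets[OF f A] S by (auto simp: Ssets)
  have "AE x in lebesgue. x \<in> f -` A \<inter> S \<longleftrightarrow> x \<in> g -` A \<inter> S"
    using eq S by (auto simp: AE_restrict_space_iff elim!: eventually_mono)
  then have "g -` A \<inter> S \<in> sets lebesgue"
    using fA by (rule completion.in_sets_AE) auto
  then show "g -` A \<inter> space (lebesgue_on S) \<in> sets (lebesgue_on S)"
    by (simp add: Ssets)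
qed simp

lemma borel_measurable_vecI:
  fixes f :: "'x \<Rightarrow> 'a::euclidean_space ^ 'n::finite"
  assumes "\<And>i. (\<lambda>x. f x $ i) \<in> borel_measurable M"
  shows "f \<in> borel_measurable M"
proof (rule iffD2[OF borel_measurable_euclidean_space], rule ballI)
  fix v :: "'a ^ 'n" assume "v \<in> Basis"
  then obtain i u where "v = axis i u" by (auto simp: Basis_vec_def)
  then show "(\<lambda>x. f x \<bullet> v) \<in> borel_measurable M"
    using assms by (simp add: inner_axis borel_measurable_inner)
qed

lemma borel_measurable_vec_nth:
  fixes f :: "'x \<Rightarrow> 'a::euclidean_space ^ 'n::finite"
  assumes "f \<in> borel_measurable M"
  shows "(\<lambda>x. f x $ i) \<in> borel_measurable M"
  by (rule measurable_compose[OF assms borel_measurable_continuous_onI]) (intro continuous_intros)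

text \<open>Along a simple function the composition is glued from finitely many sections, each
  measurable. Continuity in the second argument passes to the limit of simple functions.\<close>

lemma borel_measurable_caratheodory:
  fixes \<phi> :: "'x \<Rightarrow> 'b::{metric_space, second_countable_topology} \<Rightarrow> 'c::metric_space"
  assumes meas: "\<And>z. (\<lambda>t. \<phi> t z) \<in> borel_measurable M"
    and cont: "\<And>t. t \<in> space M \<Longrightarrow> continuous_on UNIV (\<phi> t)"
    and z: "z \<in> borel_measurable M"
  shows "(\<lambda>t. \<phi> t (z t)) \<in> borel_measurable M"
proof -
  obtain F where F: "\<And>i. simple_function M (F i)" "\<And>x. x \<in> space M \<Longrightarrow> (\<lambda>i. F i x) \<longlonglongrightarrow> z x"
    using borel_measurable_implies_sequence_metric[OF z, of undefined] by blast
  show ?thesis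
  proof (rule borel_measurable_LIMSEQ_metric)
    fix i
    have fin: "finite (F i ` space M)" using F(1) by (simp add: simple_function_def)
    have "F i \<in> measurable M (count_space (F i ` space M))"
      using F(1)[of i] by (auto simp: measurable_def simple_function_def) 
        (metis (no_types, lifting) F(1) simple_functionD(2))
    then show "(\<lambda>t. \<phi> t (F i t)) \<in> borel_measurable M"
      by (rule measurable_compose_countable'[rotated])
        (use fin meas in \<open>auto intro: countable_finite\<close>)
  next
    fix t assume t: "t \<in> space M"
    then have "isCont (\<phi> t) (z t)" using cont by (simp add: continuous_on_eq_continuous_at)
    then show "(\<lambda>i. \<phi> t (F i t)) \<longlonglongrightarrow> \<phi> t (z t)"
      using F(2)[OF t] by (rule isCont_tendsto_compose)
  qed
qed

text \<open>By Fubini almost every section of a jointly Lebesgue measurable function is measurable; continuity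
  in the second argument extends this to every section.\<close>

lemma borel_measurable_section:
  fixes h :: "real \<Rightarrow> 'b::euclidean_space \<Rightarrow> real"
  assumes h: "(\<lambda>(t, z). h t z) \<in> borel_measurable (lebesgue_on ({a..b} \<times> UNIV))"
    and cont: "\<And>t. t \<in> {a..b} \<Longrightarrow> continuous_on UNIV (h t)"
  shows "(\<lambda>t. h t z0) \<in> borel_measurable (lebesgue_on {a..b})"
proof -
  \<comment> \<open>Fubini needs the product of Borel sigma-algebras. The function is therefore
    extended by zero and replaced by a Borel version \<open>k'\<close>, which differs from it only
    inside the null set \<open>N\<close>.\<close>
  define k where "k = (\<lambda>p :: real \<times> 'b. if p \<in> {a..b} \<times> UNIV then h (fst p) (snd p) else 0)"
  have cl: "closed ({a..b} \<times> (UNIV :: 'b set))" by (intro closed_Times) auto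
  have k: "k \<in> borel_measurable lebesgue"
    unfolding k_def
    using h cl by (subst borel_measurable_if) (auto simp: split_def)
  then obtain k' where k': "k' \<in> borel_measurable lborel" "AE p in lborel. k p = k' p"
    using completion_ex_borel_measurable_real by blast
  obtain N where N: "N \<in> null_sets (lborel :: (real \<times> 'b) measure)" "{p. k p \<noteq> k' p} \<subseteq> N"
    using k'(2) unfolding eventually_ae_filter by auto
  have N2: "N \<in> null_sets (lborel \<Otimes>\<^sub>M lborel)" using N by (simp add: lborel_prod)
  then have "AE p in (lborel \<Otimes>\<^sub>M lborel). p \<notin> N" by (rule AE_not_in)
  then have "AE t in lborel. AE z in lborel. (t, z) \<notin> N" by (rule lborel_pair.AE_pair)
  moreover have "{p \<in> space (lborel \<Otimes>\<^sub>M lborel). (fst p, snd p) \<notin> N} \<in> sets (lborel \<Otimes>\<^sub>M (lborel :: 'b measure))"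
  proof -
    have "{p \<in> space (lborel \<Otimes>\<^sub>M lborel). (fst p, snd p) \<notin> N} = space (lborel \<Otimes>\<^sub>M lborel) - N" by auto
    then show ?thesis using sets.compl_sets[OF null_setsD2[OF N2]] by simp
  qed
  ultimately have ae: "AE z in lborel. AE t in lborel. (t, z) \<notin> N"
    by (subst (asm) lborel_pair.AE_commute)
  define good where "good z \<longleftrightarrow> (AE t in lborel. (t, z) \<notin> N)" for z
  have meas: "(\<lambda>t. h t z) \<in> borel_measurable (lebesgue_on {a..b})" if "good z" for z
  proof -
    have "k' \<in> borel_measurable (borel \<Otimes>\<^sub>M borel)"
      using k'(1) by (simp add: borel_prod)
    moreover have "(\<lambda>t. (t, z)) \<in> borel \<rightarrow>\<^sub>M borel \<Otimes>\<^sub>M borel" by measurable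
    ultimately have "(\<lambda>t. k' (t, z)) \<in> borel_measurable borel"
      by (rule measurable_compose[rotated])
    then have "(\<lambda>t. k' (t, z)) \<in> borel_measurable lebesgue"
      by (intro measurable_completion) simp
    then have m: "(\<lambda>t. k' (t, z)) \<in> borel_measurable (lebesgue_on {a..b})"
      by (rule measurable_restrict_space1)
    have "AE t in lebesgue. (t, z) \<notin> N"
      using that unfolding good_def by (rule AE_completion)
    moreover have "k' (t, z) = h t z" if "(t, z) \<notin> N" "t \<in> {a..b}" for t
    proof -
      have "k (t, z) = k' (t, z)" using N(2) that(1) by blast
      then show ?thesis using that(2) by (simp add: k_def)
    qed
    ultimately have "AE t in lebesgue_on {a..b}. k' (t, z) = h t z"
      by (auto simp: AE_restrict_space_iff elim!: eventually_mono)
    then show ?thesis by (rule borel_measurable_lebesgue_on_AE_eq[OF m, rotated]) simp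
  qed
  \<comment> \<open>The exceptional values of \<open>z\<close> form a null set, which cannot fill a
    ball; the good ones are therefore dense.\<close>
  have "\<exists>z. good z \<and> dist z z0 < inverse (real (Suc n))" for n
  proof (rule ccontr)
    let ?B = "ball z0 (inverse (real (Suc n)))"
    assume "\<not> ?thesis"
    then have "AE z in lebesgue. z \<in> - ?B"
      using AE_completion[OF ae] by (auto simp: good_def dist_commute elim!: eventually_mono)
    then have "z0 \<in> - ?B"
      by (intro mem_closed_if_AE_lebesgue) auto
    then show False by simp
  qed
  then obtain \<zeta> where \<zeta>: "\<And>n. good (\<zeta> n)" "\<And>n. dist (\<zeta> n) z0 < inverse (real (Suc n))" by metis
  have lim: "\<zeta> \<longlonglongrightarrow> z0"
    by (rule tendsto_dist_iff[THEN iffD2], rule tendsto_sandwich[OF _ _ tendsto_const LIMSEQ_inverse_real_of_nat])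
      (auto intro!: always_eventually less_imp_le[OF \<zeta>(2)] simp del: of_nat_Suc)
  show ?thesis
  proof (rule borel_measurable_LIMSEQ_metric[OF meas[OF \<zeta>(1)]])
    fix t assume "t \<in> space (lebesgue_on {a..b})"
    then have "isCont (h t) z0" using cont[of t] by (simp add: continuous_on_eq_continuous_at)
    then show "(\<lambda>n. h t (\<zeta> n)) \<longlonglongrightarrow> h t z0" using lim by (rule isCont_tendsto_compose)
  qed
qed

section \<open>Gradients and Hessians as limits of difference quotients\<close>

lemma GDERIV_grad:
  fixes \<phi> :: "real ^ 'k::finite \<Rightarrow> real"
  assumes "\<phi> differentiable (at z)"
  shows "GDERIV \<phi> z :> grad \<phi> z"
proof -
  obtain D where D: "(\<phi> has_derivative D) (at z)" using assms by (auto simp: differentiable_def)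
  then have lin: "linear D" by (rule has_derivative_linear)
  define v where "v = (\<chi> i. D (axis i 1))"
  have "D h = h \<bullet> v" for h
  proof -
    have "h = (\<Sum>i\<in>UNIV. h $ i *\<^sub>R axis i 1)"
      using basis_expansion[of h] by (simp add: scalar_mult_eq_scaleR)
    then have "D h = D (\<Sum>i\<in>UNIV. h $ i *\<^sub>R axis i 1)" by simp
    also have "\<dots> = (\<Sum>i\<in>UNIV. h $ i * D (axis i 1))"
      by (simp add: linear_sum[OF lin] linear_cmul[OF lin])
    finally show ?thesis by (simp add: v_def inner_vec_def)
  qed
  then have "GDERIV \<phi> z :> v" using D by (simp add: gderiv_def has_derivative_eq_rhs fun_eq_iff)
  moreover have "w = v" if "GDERIV \<phi> z :> w" for w
  proof -
    have "(\<lambda>h. h \<bullet> w) = (\<lambda>h. h \<bullet> v)"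
      using has_derivative_unique that \<open>GDERIV \<phi> z :> v\<close> unfolding gderiv_def by blast
    then have "h \<bullet> w = h \<bullet> v" for h by (rule fun_cong)
    then show ?thesis by (metis inner_commute vector_eq_ldot)
  qed
  ultimately show ?thesis unfolding grad_def by (rule theI)
qed

lemma grad_unique:
  fixes \<phi> :: "real ^ 'k::finite \<Rightarrow> real"
  assumes "GDERIV \<phi> z :> w"
  shows "grad \<phi> z = w"
proof -
  have "\<phi> differentiable (at z)" using assms by (auto simp: gderiv_def differentiable_def)
  from GDERIV_grad[OF this] have "(\<lambda>h. h \<bullet> grad \<phi> z) = (\<lambda>h. h \<bullet> w)"
    using has_derivative_unique assms unfolding gderiv_def by blast
  then have "h \<bullet> grad \<phi> z = h \<bullet> w" for h by (rule fun_cong)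
  then show ?thesis by (metis inner_commute vector_eq_ldot)
qed

lemma has_derivative_grad:
  fixes \<phi> :: "real ^ 'k::finite \<Rightarrow> real"
  assumes "\<phi> differentiable (at z)"
  shows "(\<phi> has_derivative (\<lambda>h. h \<bullet> grad \<phi> z)) (at z)"
  using GDERIV_grad[OF assms] by (simp add: gderiv_def)

lemma has_derivative_hessian:
  assumes "grad \<phi> differentiable (at z)"
  shows "(grad \<phi> has_derivative (\<lambda>h. hessian \<phi> z *v h)) (at z)"
  unfolding hessian_def using assms by (simp add: jacobian_works)

text \<open>A sequence of steps replaces the continuous limit because measurability survives
  countable limits only.\<close>

lemma has_derivative_difference_quotient_sequence:
  fixes f :: "'a::real_normed_vector \<Rightarrow> real"
  assumes "(f has_derivative D) (at z)"
  shows "(\<lambda>n. (f (z + inverse (real (Suc n)) *\<^sub>R e) - f z) * real (Suc n)) \<longlonglongrightarrow> D e"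
proof -
  have lin: "linear D" using assms by (rule has_derivative_linear)
  have "((\<lambda>s. f (z + s *\<^sub>R e)) has_derivative (\<lambda>s. D (s *\<^sub>R e))) (at 0)"
    by (rule has_derivative_compose[of "\<lambda>s. z + s *\<^sub>R e" _ _ _ f, simplified])
      (use assms in \<open>auto intro!: derivative_eq_intros\<close>)
  then have "((\<lambda>s. f (z + s *\<^sub>R e)) has_real_derivative D e) (at 0)"
    by (simp add: has_field_derivative_def linear_cmul[OF lin] mult_commute_abs)
  then have "((\<lambda>h. (f (z + h *\<^sub>R e) - f z) / h) \<longlongrightarrow> D e) (at 0)"
    by (simp add: DERIV_def)
  moreover have "filterlim (\<lambda>n. inverse (real (Suc n))) (at 0) sequentially"
    by (rule filterlim_atI[OF LIMSEQ_inverse_real_of_nat]) simp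
  ultimately have "(\<lambda>n. (f (z + inverse (real (Suc n)) *\<^sub>R e) - f z) / inverse (real (Suc n))) \<longlonglongrightarrow> D e"
    by (rule filterlim_compose)
  then show ?thesis by (simp add: divide_inverse del: of_nat_Suc)
qed

context
  fixes \<phi> :: "'x \<Rightarrow> real ^ 'k::finite \<Rightarrow> real" and M :: "'x measure"
  assumes meas: "\<And>z. (\<lambda>t. \<phi> t z) \<in> borel_measurable M"
    and diff: "\<And>t. t \<in> space M \<Longrightarrow> twice_differentiable (\<phi> t)"
begin

text \<open>At a fixed point the entries are limits of quotients measurable in \<open>t\<close>. The
  gradient is continuous in the point, being differentiable, so a measurable argument may be
  inserted afterwards.\<close>

lemma borel_measurable_grad:
  assumes \<zeta>: "\<zeta> \<in> borel_measurable M"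
  shows "(\<lambda>t. grad (\<phi> t) (\<zeta> t)) \<in> borel_measurable M"
proof -
  have cont: "continuous_on UNIV (grad (\<phi> t))" if "t \<in> space M" for t
    using diff[OF that] by (auto simp: twice_differentiable_def intro!: differentiable_imp_continuous_on
        simp: differentiable_on_def)
  have m: "(\<lambda>t. grad (\<phi> t) z) \<in> borel_measurable M" for z
  proof (rule borel_measurable_vecI)
    fix i
    show "(\<lambda>t. grad (\<phi> t) z $ i) \<in> borel_measurable M"
    proof (rule borel_measurable_LIMSEQ_metric)
      show "(\<lambda>t. (\<phi> t (z + inverse (real (Suc n)) *\<^sub>R axis i 1) - \<phi> t z) * real (Suc n)) \<in> borel_measurable M" for n
        by (intro borel_measurable_times borel_measurable_diff meas) simp
      fix t assume "t \<in> space M"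
      then have "\<phi> t differentiable (at z)" using diff by (simp add: twice_differentiable_def)
      from has_derivative_difference_quotient_sequence[OF has_derivative_grad[OF this], of "axis i 1"]
      show "(\<lambda>n. (\<phi> t (z + inverse (real (Suc n)) *\<^sub>R axis i 1) - \<phi> t z) * real (Suc n)) \<longlonglongrightarrow> grad (\<phi> t) z $ i"
        by (simp add: inner_axis')
    qed
  qed
  show ?thesis
    by (rule borel_measurable_caratheodory[where \<phi> = "\<lambda>t. grad (\<phi> t)", OF m cont \<zeta>])
qed

text \<open>Twice differentiability does not make the Hessian continuous in the point, so the route
  through fixed points is closed. Instead the quotients of gradients are formed directly at the
  moving point \<open>\<zeta> t\<close>.\<close>

lemma borel_measurable_hessian:
  assumes \<zeta>: "\<zeta> \<in> borel_measurable M"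
  shows "(\<lambda>t. hessian (\<phi> t) (\<zeta> t)) \<in> borel_measurable M"
proof (intro borel_measurable_vecI)
  fix i j
  show "(\<lambda>t. hessian (\<phi> t) (\<zeta> t) $ i $ j) \<in> borel_measurable M"
  proof (rule borel_measurable_LIMSEQ_metric)
    show "(\<lambda>t. (grad (\<phi> t) (\<zeta> t + inverse (real (Suc n)) *\<^sub>R axis j 1) $ i - grad (\<phi> t) (\<zeta> t) $ i) * real (Suc n))
        \<in> borel_measurable M" for n
      using \<zeta> by (intro borel_measurable_times borel_measurable_diff borel_measurable_vec_nth
          borel_measurable_grad borel_measurable_add) auto
    fix t assume "t \<in> space M"
    then have "grad (\<phi> t) differentiable (at (\<zeta> t))" using diff by (simp add: twice_differentiable_def)
    from has_derivative_hessian[OF this]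
    have "((\<lambda>z. grad (\<phi> t) z $ i) has_derivative (\<lambda>h. (hessian (\<phi> t) (\<zeta> t) *v h) $ i)) (at (\<zeta> t))"
      by (rule bounded_linear.has_derivative[OF bounded_linear_vec_nth])
    from has_derivative_difference_quotient_sequence[OF this, of "axis j 1"]
    show "(\<lambda>n. (grad (\<phi> t) (\<zeta> t + inverse (real (Suc n)) *\<^sub>R axis j 1) $ i - grad (\<phi> t) (\<zeta> t) $ i) * real (Suc n))
        \<longlonglongrightarrow> hessian (\<phi> t) (\<zeta> t) $ i $ j"
      by (simp add: matrix_vector_mul_component inner_axis)
  qed
qed

end

section \<open>Second derivatives and their blocks\<close>

text \<open>The mean value theorem in direction \<open>a\<close> turns the second difference into a
  difference of two gradients near \<open>z\<close>, and differentiability of the gradient at the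
  single point \<open>z\<close> linearises both.\<close>

lemma second_difference_hessian:
  fixes \<phi> :: "real ^ 'k::finite \<Rightarrow> real"
  assumes \<phi>: "twice_differentiable \<phi>" and e: "e > 0"
  obtains d where "d > 0"
    "\<And>h. 0 < h \<Longrightarrow> h < d \<Longrightarrow>
       \<bar>\<phi> (z + h *\<^sub>R a + h *\<^sub>R b) - \<phi> (z + h *\<^sub>R a) - \<phi> (z + h *\<^sub>R b) + \<phi> z - h\<^sup>2 * (a \<bullet> (hessian \<phi> z *v b))\<bar>
         \<le> e * h\<^sup>2"
proof -
  \<comment> \<open>\<open>c\<close> dominates the factor \<open>2 * norm a * N\<close> of the final
    error; the added ones keep it positive when \<open>a\<close> or \<open>b\<close>
    vanishes.\<close>
  define c where "c = 2 * (norm a + 1) * (norm a + norm b + 1)"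
  define e' where "e' = e / c"
  have c: "c > 0" unfolding c_def by (intro mult_pos_pos) (auto intro: add_nonneg_pos)
  have e': "e' > 0" using e c by (simp add: e'_def)
  have d\<phi>: "\<phi> differentiable (at y)" and dg: "grad \<phi> differentiable (at y)" for y
    using \<phi> by (auto simp: twice_differentiable_def)
  have "(grad \<phi> has_derivative (\<lambda>h. hessian \<phi> z *v h)) (at z)"
    by (rule has_derivative_hessian[OF dg])
  then obtain d where d: "d > 0" and
    dz: "\<And>y. norm (y - z) < d \<Longrightarrow> norm (grad \<phi> y - grad \<phi> z - hessian \<phi> z *v (y - z)) \<le> e' * norm (y - z)"
    unfolding has_derivative_at_alt using e' by blast
  define N where "N = norm a + norm b + 1"
  have N: "N > 0" by (simp add: N_def add_nonneg_pos)
  show thesis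
  proof (rule that[of "d / N"])
    show "d / N > 0" using d N by simp
    fix h :: real assume h: "0 < h" "h < d / N"
    then have hN: "h * N < d" using N by (simp add: field_simps)
    define \<psi> where "\<psi> s = \<phi> (z + s *\<^sub>R a + h *\<^sub>R b) - \<phi> (z + s *\<^sub>R a)" for s
    have der: "(\<psi> has_derivative (\<lambda>r. (r *\<^sub>R a) \<bullet> grad \<phi> (z + s *\<^sub>R a + h *\<^sub>R b) - (r *\<^sub>R a) \<bullet> grad \<phi> (z + s *\<^sub>R a)))
        (at s within {0..h})" for s
      unfolding \<psi>_def
      by (intro has_derivative_diff has_derivative_compose[OF _ has_derivative_grad[OF d\<phi>]])
        (auto intro!: derivative_eq_intros)
    obtain s where s: "s \<in> {0..h}"
      and eq: "\<psi> h - \<psi> 0 = ((h - 0) *\<^sub>R a) \<bullet> grad \<phi> (z + s *\<^sub>R a + h *\<^sub>R b) - ((h - 0) *\<^sub>R a) \<bullet> grad \<phi> (z + s *\<^sub>R a)"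
      using mvt_very_simple[of 0 h \<psi> "\<lambda>s r. (r *\<^sub>R a) \<bullet> grad \<phi> (z + s *\<^sub>R a + h *\<^sub>R b) - (r *\<^sub>R a) \<bullet> grad \<phi> (z + s *\<^sub>R a)"]
        der h by auto
    have n1: "norm (s *\<^sub>R a + h *\<^sub>R b) \<le> h * N" and n2: "norm (s *\<^sub>R a) \<le> h * N"
    proof -
      have "norm (s *\<^sub>R a) \<le> h * norm a" "norm (h *\<^sub>R b) \<le> h * norm b"
        using s h by (auto intro: mult_right_mono)
      moreover have "h * norm a + h * norm b \<le> h * N" "h * norm a \<le> h * N"
        using h by (auto simp: N_def algebra_simps)
      ultimately show "norm (s *\<^sub>R a + h *\<^sub>R b) \<le> h * N" "norm (s *\<^sub>R a) \<le> h * N"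
        using norm_triangle_ineq[of "s *\<^sub>R a" "h *\<^sub>R b"] by linarith+
    qed
    define r1 where "r1 = grad \<phi> (z + s *\<^sub>R a + h *\<^sub>R b) - grad \<phi> z - hessian \<phi> z *v (s *\<^sub>R a + h *\<^sub>R b)"
    define r2 where "r2 = grad \<phi> (z + s *\<^sub>R a) - grad \<phi> z - hessian \<phi> z *v (s *\<^sub>R a)"
    have "norm r1 \<le> e' * norm (s *\<^sub>R a + h *\<^sub>R b)"
      using dz[of "z + s *\<^sub>R a + h *\<^sub>R b"] n1 hN by (simp add: r1_def add.assoc)
    also have "\<dots> \<le> e' * (h * N)" using n1 e' by (intro mult_left_mono) auto
    finally have r1: "norm r1 \<le> e' * (h * N)" .
    have "norm r2 \<le> e' * norm (s *\<^sub>R a)"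
      using dz[of "z + s *\<^sub>R a"] n2 hN by (simp add: r2_def)
    also have "\<dots> \<le> e' * (h * N)" using n2 e' by (intro mult_left_mono) auto
    finally have r2: "norm r2 \<le> e' * (h * N)" .
    have "grad \<phi> (z + s *\<^sub>R a + h *\<^sub>R b) - grad \<phi> (z + s *\<^sub>R a) = h *\<^sub>R (hessian \<phi> z *v b) + (r1 - r2)"
      by (simp add: r1_def r2_def matrix_vector_right_distrib matrix_vector_mult_scaleR)
    moreover have "\<psi> h - \<psi> 0 = h * (a \<bullet> (grad \<phi> (z + s *\<^sub>R a + h *\<^sub>R b) - grad \<phi> (z + s *\<^sub>R a)))"
      using eq by (simp add: inner_diff_right algebra_simps)
    ultimately have "\<psi> h - \<psi> 0 = h * (a \<bullet> (h *\<^sub>R (hessian \<phi> z *v b) + (r1 - r2)))"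
      by (simp only:)
    then have "\<psi> h - \<psi> 0 - h\<^sup>2 * (a \<bullet> (hessian \<phi> z *v b)) = h * (a \<bullet> (r1 - r2))"
      by (simp add: inner_add_right power2_eq_square algebra_simps)
    then have "\<bar>\<psi> h - \<psi> 0 - h\<^sup>2 * (a \<bullet> (hessian \<phi> z *v b))\<bar> = h * \<bar>a \<bullet> (r1 - r2)\<bar>"
      using h by (simp add: abs_mult)
    also have "\<dots> \<le> h * (norm a * (e' * (h * N) + e' * (h * N)))"
    proof (intro mult_left_mono)
      have "norm (r1 - r2) \<le> e' * (h * N) + e' * (h * N)"
        using norm_triangle_ineq4[of r1 r2] r1 r2 by linarith
      then have "norm a * norm (r1 - r2) \<le> norm a * (e' * (h * N) + e' * (h * N))"
        by (rule mult_left_mono) simp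
      then show "\<bar>a \<bullet> (r1 - r2)\<bar> \<le> norm a * (e' * (h * N) + e' * (h * N))"
        using Cauchy_Schwarz_ineq2[of a "r1 - r2"] by linarith
    qed (use h in auto)
    also have "\<dots> = e' * (2 * norm a * N) * h\<^sup>2" by (simp add: power2_eq_square algebra_simps)
    also have "\<dots> \<le> e' * c * h\<^sup>2"
      using e' N by (intro mult_right_mono mult_left_mono) (auto simp: c_def N_def[symmetric])
    also have "\<dots> = e * h\<^sup>2" using c by (simp add: e'_def)
    finally show "\<bar>\<phi> (z + h *\<^sub>R a + h *\<^sub>R b) - \<phi> (z + h *\<^sub>R a) - \<phi> (z + h *\<^sub>R b) + \<phi> z - h\<^sup>2 * (a \<bullet> (hessian \<phi> z *v b))\<bar>
         \<le> e * h\<^sup>2"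
      by (simp add: \<psi>_def)
  qed
qed

text \<open>The second difference is symmetric in the two directions, and after division by the
  square of \<open>h\<close> it tends to either side.\<close>

lemma inner_hessian_commute:
  fixes \<phi> :: "real ^ 'k::finite \<Rightarrow> real"
  assumes \<phi>: "twice_differentiable \<phi>"
  shows "a \<bullet> (hessian \<phi> z *v b) = b \<bullet> (hessian \<phi> z *v a)"
proof (rule ccontr)
  let ?p = "a \<bullet> (hessian \<phi> z *v b)" and ?q = "b \<bullet> (hessian \<phi> z *v a)"
  assume "?p \<noteq> ?q"
  \<comment> \<open>With a third of the gap as tolerance, the two errors together cover only two
    thirds of it.\<close>
  then have e: "\<bar>?p - ?q\<bar> / 3 > 0" by simp
  define D where "D h = \<phi> (z + h *\<^sub>R a + h *\<^sub>R b) - \<phi> (z + h *\<^sub>R a) - \<phi> (z + h *\<^sub>R b) + \<phi> z" for h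
  obtain d1 where d1: "d1 > 0" "\<And>h. 0 < h \<Longrightarrow> h < d1 \<Longrightarrow> \<bar>D h - h\<^sup>2 * ?p\<bar> \<le> \<bar>?p - ?q\<bar> / 3 * h\<^sup>2"
    using second_difference_hessian[OF \<phi> e, of z a b] unfolding D_def by metis
  have D': "D h = \<phi> (z + h *\<^sub>R b + h *\<^sub>R a) - \<phi> (z + h *\<^sub>R b) - \<phi> (z + h *\<^sub>R a) + \<phi> z" for h
    by (simp add: D_def algebra_simps)
  obtain d2 where d2: "d2 > 0" "\<And>h. 0 < h \<Longrightarrow> h < d2 \<Longrightarrow> \<bar>D h - h\<^sup>2 * ?q\<bar> \<le> \<bar>?p - ?q\<bar> / 3 * h\<^sup>2"
    using second_difference_hessian[OF \<phi> e, of z b a] unfolding D' by metis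
  define h where "h = min d1 d2 / 2"
  have h: "0 < h" "h < d1" "h < d2" using d1(1) d2(1) by (auto simp: h_def)
  have "\<bar>h\<^sup>2 * ?p - h\<^sup>2 * ?q\<bar> \<le> 2 * (\<bar>?p - ?q\<bar> / 3 * h\<^sup>2)"
    using d1(2)[OF h(1,2)] d2(2)[OF h(1,3)] by linarith
  then have "h\<^sup>2 * \<bar>?p - ?q\<bar> \<le> 2 / 3 * (h\<^sup>2 * \<bar>?p - ?q\<bar>)"
    unfolding right_diff_distrib[symmetric] abs_mult by simp
  moreover have "h\<^sup>2 * \<bar>?p - ?q\<bar> > 0" using h \<open>?p \<noteq> ?q\<close> by simp
  ultimately show False by linarith
qed

theorem transpose_hessian:
  fixes \<phi> :: "real ^ 'k::finite \<Rightarrow> real"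
  assumes "twice_differentiable \<phi>"
  shows "transpose (hessian \<phi> z) = hessian \<phi> z"
proof -
  have "hessian \<phi> z $ i $ j = hessian \<phi> z $ j $ i" for i j
    using inner_hessian_commute[OF assms, of "axis i 1" z "axis j 1"]
    by (simp add: inner_axis' matrix_vector_mult_basis column_def)
  then show ?thesis by (simp add: transpose_def vec_eq_iff)
qed

section \<open>Partial derivatives as sub-arrays of the derivatives in the joint variable\<close>

lemma sum_UNIV_sum:
  fixes f :: "'a::finite + 'b::finite \<Rightarrow> 'c::comm_monoid_add"
  shows "(\<Sum>k\<in>UNIV. f k) = (\<Sum>i\<in>UNIV. f (Inl i)) + (\<Sum>j\<in>UNIV. f (Inr j))"
  unfolding UNIV_Plus_UNIV[symmetric] by (subst sum.Plus) (auto simp: o_def)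

lemma join_nth [simp]: "join x u $ Inl i = x $ i" "join x u $ Inr j = u $ j"
  by (simp_all add: join_def)

lemma on_join_join [simp]: "on_join \<phi> (join x u) = \<phi> x u"
  by (simp add: on_join_def)

lemma inner_join: "join x u \<bullet> z = x \<bullet> (\<chi> i. z $ Inl i) + u \<bullet> (\<chi> j. z $ Inr j)"
  by (simp add: inner_vec_def sum_UNIV_sum)

lemma join_add: "join (x + x') (u + u') = join x u + join x' u'"
  by (auto simp: vec_eq_iff join_def split: sum.split)

lemma join_scaleR: "join (c *\<^sub>R x) (c *\<^sub>R u) = c *\<^sub>R join x u"
  by (auto simp: vec_eq_iff join_def split: sum.split)

lemma bounded_linear_join: "bounded_linear (\<lambda>(x, u). join x u)"
  by (intro linear_conv_bounded_linear[THEN iffD1] linearI) (auto simp: join_add join_scaleR)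

lemma has_derivative_join:
  assumes "(x has_derivative x') (at s)" "(u has_derivative u') (at s)"
  shows "((\<lambda>s. join (x s) (u s)) has_derivative (\<lambda>h. join (x' h) (u' h))) (at s)"
  using bounded_linear.has_derivative[OF bounded_linear_join has_derivative_Pair[OF assms]] by simp

lemma grad_x_eq:
  assumes "on_join \<phi> differentiable (at (join x u))"
  shows "grad_x \<phi> x u = (\<chi> i. grad (on_join \<phi>) (join x u) $ Inl i)"
    and "((\<lambda>x. \<phi> x u) has_derivative (\<lambda>h. join h 0 \<bullet> grad (on_join \<phi>) (join x u))) (at x)"
proof -
  have "((\<lambda>x. join x u) has_derivative (\<lambda>h. join h 0)) (at x)"
    by (intro has_derivative_join has_derivative_ident has_derivative_const)
  from has_derivative_compose[OF this has_derivative_grad[OF assms]]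
  show *: "((\<lambda>x. \<phi> x u) has_derivative (\<lambda>h. join h 0 \<bullet> grad (on_join \<phi>) (join x u))) (at x)"
    by simp
  then show "grad_x \<phi> x u = (\<chi> i. grad (on_join \<phi>) (join x u) $ Inl i)"
    unfolding grad_x_def by (intro grad_unique) (simp add: gderiv_def inner_join)
qed

lemma grad_u_eq:
  assumes "on_join \<phi> differentiable (at (join x u))"
  shows "grad_u \<phi> x u = (\<chi> j. grad (on_join \<phi>) (join x u) $ Inr j)"
    and "((\<lambda>u. \<phi> x u) has_derivative (\<lambda>h. join 0 h \<bullet> grad (on_join \<phi>) (join x u))) (at u)"
proof -
  have "((\<lambda>u. join x u) has_derivative (\<lambda>h. join 0 h)) (at u)"
    by (intro has_derivative_join has_derivative_ident has_derivative_const)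
  from has_derivative_compose[OF this has_derivative_grad[OF assms]]
  show *: "((\<lambda>u. \<phi> x u) has_derivative (\<lambda>h. join 0 h \<bullet> grad (on_join \<phi>) (join x u))) (at u)"
    by simp
  then show "grad_u \<phi> x u = (\<chi> j. grad (on_join \<phi>) (join x u) $ Inr j)"
    unfolding grad_u_def by (intro grad_unique) (simp add: gderiv_def inner_join)
qed

lemma jacobian_eqI:
  fixes M :: "real ^ 'a::finite ^ 'b::finite"
  assumes "(f has_derivative (\<lambda>h. M *v h)) (at z)"
  shows "jacobian f (at z) = M"
  unfolding jacobian_def frechet_derivative_at[OF assms, symmetric]
  by simp

lemma has_derivative_vecI:
  fixes f :: "'a::euclidean_space \<Rightarrow> real ^ 'n::finite"
  assumes "\<And>i. ((\<lambda>z. f z $ i) has_derivative (\<lambda>h. f' h $ i)) (at z)"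
  shows "(f has_derivative f') (at z)"
proof (rule has_derivative_componentwise_within[THEN iffD2], rule ballI)
  fix v :: "real ^ 'n" assume "v \<in> Basis"
  then obtain i where "v = axis i 1" by (auto simp: Basis_vec_def)
  then show "((\<lambda>z. f z \<bullet> v) has_derivative (\<lambda>h. f' h \<bullet> v)) (at z)"
    using assms by (simp add: inner_axis)
qed

lemma jac_x_eq:
  fixes b :: "real ^ 'n::finite \<Rightarrow> real ^ 'm::finite \<Rightarrow> real ^ 'l::finite"
  assumes "\<And>i. on_join (\<lambda>x u. b x u $ i) differentiable (at (join x u))"
  shows "jac_x b x u = (\<chi> i j. grad (on_join (\<lambda>x u. b x u $ i)) (join x u) $ Inl j)"
  unfolding jac_x_def
  by (intro jacobian_eqI has_derivative_vecI has_derivative_eq_rhs[OF grad_x_eq(2)[OF assms]])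
    (simp add: fun_eq_iff inner_join matrix_vector_mul_component inner_commute)

lemma jac_u_eq:
  fixes b :: "real ^ 'n::finite \<Rightarrow> real ^ 'm::finite \<Rightarrow> real ^ 'l::finite"
  assumes "\<And>i. on_join (\<lambda>x u. b x u $ i) differentiable (at (join x u))"
  shows "jac_u b x u = (\<chi> i j. grad (on_join (\<lambda>x u. b x u $ i)) (join x u) $ Inr j)"
  unfolding jac_u_def
  by (intro jacobian_eqI has_derivative_vecI has_derivative_eq_rhs[OF grad_u_eq(2)[OF assms]])
    (simp add: fun_eq_iff inner_join matrix_vector_mul_component inner_commute)

definition block_xx :: "real ^ ('n::finite + 'm::finite) ^ ('n + 'm) \<Rightarrow> real ^ 'n ^ 'n" where
  "block_xx M = (\<chi> i j. M $ Inl i $ Inl j)"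

definition block_xu :: "real ^ ('n::finite + 'm::finite) ^ ('n + 'm) \<Rightarrow> real ^ 'm ^ 'n" where
  "block_xu M = (\<chi> i j. M $ Inl i $ Inr j)"

definition block_uu :: "real ^ ('n::finite + 'm::finite) ^ ('n + 'm) \<Rightarrow> real ^ 'm ^ 'm" where
  "block_uu M = (\<chi> i j. M $ Inr i $ Inr j)"

lemma linear_blocks: "linear block_xx" "linear block_xu" "linear block_uu"
  by (auto intro!: linearI simp: block_xx_def block_xu_def block_uu_def vec_eq_iff)

lemma transpose_blocks:
  assumes "transpose M = M"
  shows "transpose (block_xx M) = block_xx M" "transpose (block_uu M) = block_uu M"
proof -
  have "M $ i $ j = M $ j $ i" for i j
    using arg_cong[OF assms, of "\<lambda>N. N $ j $ i"] by (simp add: transpose_def)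
  then show "transpose (block_xx M) = block_xx M" "transpose (block_uu M) = block_uu M"
    by (auto simp: transpose_def block_xx_def block_uu_def vec_eq_iff)
qed

text \<open>Symmetry identifies the lower left block with the transpose of the upper right one, so
  the two mixed terms merge. This separates the coefficients that enter the Riccati
  equation.\<close>

lemma inner_block_form:
  assumes "transpose M = M"
  shows "join y v \<bullet> (M *v join y v) =
    y \<bullet> (block_xx M *v y) + 2 * (v \<bullet> (transpose (block_xu M) *v y)) + v \<bullet> (block_uu M *v v)"
proof -
  have sym: "M $ i $ j = M $ j $ i" for i j
    using arg_cong[OF assms, of "\<lambda>N. N $ j $ i"] by (simp add: transpose_def)
  have "(\<chi> i. (M *v join y v) $ Inl i) = block_xx M *v y + block_xu M *v v"
    by (simp add: vec_eq_iff matrix_vector_mult_def sum_UNIV_sum block_xx_def block_xu_def)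
  moreover have "(\<chi> i. (M *v join y v) $ Inr i) = transpose (block_xu M) *v y + block_uu M *v v"
    by (simp add: vec_eq_iff matrix_vector_mult_def sum_UNIV_sum block_uu_def block_xu_def transpose_def sym[of "Inr i" "Inl j" for i j])
  moreover have "y \<bullet> (block_xu M *v v) = v \<bullet> (transpose (block_xu M) *v y)"
    by (metis dot_lmul_matrix inner_commute transpose_matrix_vector)
  ultimately show ?thesis by (simp add: inner_join inner_add_right)
qed

context
  fixes \<phi> :: "real ^ 'n::finite \<Rightarrow> real ^ 'm::finite \<Rightarrow> real"
  assumes td: "twice_differentiable (on_join \<phi>)"
begin

lemma differentiable_on_join: "on_join \<phi> differentiable (at z)"
  and differentiable_grad_on_join: "grad (on_join \<phi>) differentiable (at z)"
  using td by (simp_all add: twice_differentiable_def)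

lemma has_derivative_grad_on_join:
  "(grad (on_join \<phi>) has_derivative (\<lambda>h. hessian_xu \<phi> x u *v h)) (at (join x u))"
  unfolding hessian_xu_def by (rule has_derivative_hessian[OF differentiable_grad_on_join])

text \<open>Moving in a direction \<open>join h 0\<close> selects the columns of the joint Hessian,
  and reading the first components of the gradient selects its rows. The other two blocks arise in
  the same way.\<close>

lemma hessian_x_eq_block: "hessian (\<lambda>x. \<phi> x u) x = block_xx (hessian_xu \<phi> x u)"
proof -
  have "grad (\<lambda>x. \<phi> x u) = (\<lambda>x. \<chi> i. grad (on_join \<phi>) (join x u) $ Inl i)"
    using grad_x_eq(1)[OF differentiable_on_join] by (simp add: grad_x_def fun_eq_iff)
  moreover have "((\<lambda>x. \<chi> i. grad (on_join \<phi>) (join x u) $ Inl i) has_derivative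
      (\<lambda>h. block_xx (hessian_xu \<phi> x u) *v h)) (at x)"
  proof (rule has_derivative_vecI)
    fix i
    have "((\<lambda>x. join x u) has_derivative (\<lambda>h. join h 0)) (at x)"
      by (intro has_derivative_join has_derivative_ident has_derivative_const)
    from bounded_linear.has_derivative[OF bounded_linear_vec_nth
        has_derivative_compose[OF this has_derivative_grad_on_join], of "Inl i"]
    show "((\<lambda>x. (\<chi> i. grad (on_join \<phi>) (join x u) $ Inl i) $ i) has_derivative
        (\<lambda>h. (block_xx (hessian_xu \<phi> x u) *v h) $ i)) (at x)"
      by (simp add: matrix_vector_mult_def sum_UNIV_sum block_xx_def)
  qed
  ultimately show ?thesis unfolding hessian_def by (simp add: jacobian_eqI)
qed

lemma hessian_u_eq_block: "hessian (\<lambda>u. \<phi> x u) u = block_uu (hessian_xu \<phi> x u)"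
proof -
  have "grad (\<lambda>u. \<phi> x u) = (\<lambda>u. \<chi> i. grad (on_join \<phi>) (join x u) $ Inr i)"
    using grad_u_eq(1)[OF differentiable_on_join] by (simp add: grad_u_def fun_eq_iff)
  moreover have "((\<lambda>u. \<chi> i. grad (on_join \<phi>) (join x u) $ Inr i) has_derivative
      (\<lambda>h. block_uu (hessian_xu \<phi> x u) *v h)) (at u)"
  proof (rule has_derivative_vecI)
    fix i
    have "((\<lambda>u. join x u) has_derivative (\<lambda>h. join 0 h)) (at u)"
      by (intro has_derivative_join has_derivative_ident has_derivative_const)
    from bounded_linear.has_derivative[OF bounded_linear_vec_nth
        has_derivative_compose[OF this has_derivative_grad_on_join], of "Inr i"]
    show "((\<lambda>u. (\<chi> i. grad (on_join \<phi>) (join x u) $ Inr i) $ i) has_derivative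
        (\<lambda>h. (block_uu (hessian_xu \<phi> x u) *v h) $ i)) (at u)"
      by (simp add: matrix_vector_mult_def sum_UNIV_sum block_uu_def)
  qed
  ultimately show ?thesis unfolding hessian_def by (simp add: jacobian_eqI)
qed

lemma jac_u_grad_x_eq_block: "jac_u (grad_x \<phi>) x u = block_xu (hessian_xu \<phi> x u)"
proof -
  have "grad_x \<phi> = (\<lambda>x u. \<chi> i. grad (on_join \<phi>) (join x u) $ Inl i)"
    using grad_x_eq(1)[OF differentiable_on_join] by (simp add: fun_eq_iff)
  moreover have "((\<lambda>u. \<chi> i. grad (on_join \<phi>) (join x u) $ Inl i) has_derivative
      (\<lambda>h. block_xu (hessian_xu \<phi> x u) *v h)) (at u)"
  proof (rule has_derivative_vecI)
    fix i
    have "((\<lambda>u. join x u) has_derivative (\<lambda>h. join 0 h)) (at u)"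
      by (intro has_derivative_join has_derivative_ident has_derivative_const)
    from bounded_linear.has_derivative[OF bounded_linear_vec_nth
        has_derivative_compose[OF this has_derivative_grad_on_join], of "Inl i"]
    show "((\<lambda>u. (\<chi> i. grad (on_join \<phi>) (join x u) $ Inl i) $ i) has_derivative
        (\<lambda>h. (block_xu (hessian_xu \<phi> x u) *v h) $ i)) (at u)"
      by (simp add: matrix_vector_mult_def sum_UNIV_sum block_xu_def)
  qed
  ultimately show ?thesis unfolding jac_u_def by (simp add: jacobian_eqI)
qed

end

text \<open>For frozen \<open>t\<close> and \<open>p\<close> the Hamiltonian has this form: the
  weights are the entries of \<open>p\<close>, the functions \<phi> the components of
  \<open>b\<close>, and \<psi> is the running cost.\<close>

lemma linear_combination_hessian:
  fixes \<phi> :: "'i::finite \<Rightarrow> real ^ 'k::finite \<Rightarrow> real"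
  assumes \<phi>: "\<And>i. twice_differentiable (\<phi> i)" and \<psi>: "twice_differentiable \<psi>"
  shows "twice_differentiable (\<lambda>z. (\<Sum>i\<in>UNIV. c i * \<phi> i z) + \<psi> z)"
    and "hessian (\<lambda>z. (\<Sum>i\<in>UNIV. c i * \<phi> i z) + \<psi> z) z = (\<Sum>i\<in>UNIV. c i *\<^sub>R hessian (\<phi> i) z) + hessian \<psi> z"
proof -
  let ?\<chi> = "\<lambda>z. (\<Sum>i\<in>UNIV. c i * \<phi> i z) + \<psi> z"
  have d: "\<phi> i differentiable (at z)" "grad (\<phi> i) differentiable (at z)"
    "\<psi> differentiable (at z)" "grad \<psi> differentiable (at z)" for i z
    using \<phi> \<psi> by (simp_all add: twice_differentiable_def)
  have D: "(?\<chi> has_derivative (\<lambda>h. h \<bullet> ((\<Sum>i\<in>UNIV. c i *\<^sub>R grad (\<phi> i) z) + grad \<psi> z))) (at z)" for z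
  proof -
    have "(?\<chi> has_derivative (\<lambda>h. (\<Sum>i\<in>UNIV. c i * (h \<bullet> grad (\<phi> i) z)) + h \<bullet> grad \<psi> z)) (at z)"
      by (intro has_derivative_add has_derivative_sum has_derivative_mult_right has_derivative_grad d)
    then show ?thesis by (simp add: inner_add_right inner_sum_right)
  qed
  have g: "grad ?\<chi> = (\<lambda>z. (\<Sum>i\<in>UNIV. c i *\<^sub>R grad (\<phi> i) z) + grad \<psi> z)"
    using D by (intro ext grad_unique) (simp add: gderiv_def)
  have H: "(grad ?\<chi> has_derivative (\<lambda>h. ((\<Sum>i\<in>UNIV. c i *\<^sub>R hessian (\<phi> i) z) + hessian \<psi> z) *v h)) (at z)" for z
  proof -
    have "((\<lambda>z. (\<Sum>i\<in>UNIV. c i *\<^sub>R grad (\<phi> i) z) + grad \<psi> z) has_derivative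
        (\<lambda>h. (\<Sum>i\<in>UNIV. c i *\<^sub>R (hessian (\<phi> i) z *v h)) + hessian \<psi> z *v h)) (at z)"
      by (intro has_derivative_add has_derivative_sum has_derivative_scaleR_right has_derivative_hessian d)
    moreover have "(\<Sum>i\<in>I. c i *\<^sub>R hessian (\<phi> i) z) *v h = (\<Sum>i\<in>I. c i *\<^sub>R (hessian (\<phi> i) z *v h))"
      if "finite I" for I h
      using that by induct (auto simp: matrix_vector_mult_add_rdistrib scaleR_matrix_vector_assoc)
    ultimately show ?thesis unfolding g by (simp add: matrix_vector_mult_add_rdistrib)
  qed
  show "twice_differentiable ?\<chi>"
    unfolding twice_differentiable_def using D H by (blast intro: differentiableI)
  show "hessian ?\<chi> z = (\<Sum>i\<in>UNIV. c i *\<^sub>R hessian (\<phi> i) z) + hessian \<psi> z"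
    unfolding hessian_def[of ?\<chi>] by (rule jacobian_eqI[OF H])
qed

lemma on_join_hamiltonian:
  "on_join (\<lambda>x u. hamiltonian b f t x u p) =
     (\<lambda>z. (\<Sum>i\<in>UNIV. p $ i * on_join (\<lambda>x u. b t x u $ i) z) + on_join (f t) z)"
  by (simp add: fun_eq_iff on_join_def hamiltonian_def inner_vec_def mult.commute)

section \<open>Matrices and integrals\<close>

text \<open>The norm of an array is its Frobenius norm, and Cauchy-Schwarz in each row shows that it
  dominates the operator norm.\<close>

lemma norm_matrix_vector_mult_le:
  fixes M :: "real ^ 'n::finite ^ 'm::finite"
  shows "norm (M *v x) \<le> norm M * norm x"
proof -
  have "norm (M *v x) = L2_set (\<lambda>i. \<bar>M $ i \<bullet> x\<bar>) UNIV"
    by (simp add: norm_vec_def matrix_vector_mul_component)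
  also have "\<dots> \<le> L2_set (\<lambda>i. norm (M $ i) * norm x) UNIV"
    by (intro L2_set_mono Cauchy_Schwarz_ineq2) auto
  also have "\<dots> = norm M * norm x"
    by (simp add: norm_vec_def[of M] L2_set_left_distrib)
  finally show ?thesis .
qed

lemma norm_transpose:
  fixes M :: "real ^ 'n::finite ^ 'm::finite"
  shows "norm (transpose M) = norm M"
  by (simp add: norm_vec_def L2_set_def transpose_def sum_nonneg, rule sum.swap)

lemma norm_matrix_mult_le:
  fixes M :: "real ^ 'n::finite ^ 'm::finite" and N :: "real ^ 'k::finite ^ 'n"
  shows "norm (M ** N) \<le> norm M * norm N"
proof -
  have row: "(M ** N) $ i = transpose N *v (M $ i)" for i
    by (simp add: vec_eq_iff matrix_matrix_mult_def matrix_vector_mult_def transpose_def mult.commute)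
  have "norm (M ** N) = L2_set (\<lambda>i. norm (transpose N *v (M $ i))) UNIV"
    by (simp add: norm_vec_def[of "M ** N"] row del: transpose_matrix_vector)
  also have "\<dots> \<le> L2_set (\<lambda>i. norm (transpose N) * norm (M $ i)) UNIV"
    by (intro L2_set_mono norm_matrix_vector_mult_le) auto
  also have "\<dots> = norm M * norm N"
    by (simp add: norm_vec_def[of M] L2_set_right_distrib norm_transpose mult.commute)
  finally show ?thesis .
qed

lemma bounded_bilinear_matrix_vector_mult:
  "bounded_bilinear ((*v) :: real ^ 'n::finite ^ 'm::finite \<Rightarrow> real ^ 'n \<Rightarrow> real ^ 'm)"
  by (rule bounded_bilinear.intro)
    (auto simp: matrix_vector_mult_add_rdistrib matrix_vector_right_distrib scaleR_matrix_vector_assoc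
      matrix_vector_mult_scaleR intro!: exI[of _ 1] norm_matrix_vector_mult_le)

lemma scaleR_matrix_mult:
  fixes M :: "real ^ 'n::finite ^ 'm::finite" and N :: "real ^ 'k::finite ^ 'n"
  shows "(r *\<^sub>R M) ** N = r *\<^sub>R (M ** N)" "M ** (r *\<^sub>R N) = r *\<^sub>R (M ** N)"
  by (simp_all add: vec_eq_iff matrix_matrix_mult_def sum_distrib_left mult_ac)

lemma matrix_mult_add_rdistrib:
  fixes M N :: "real ^ 'n::finite ^ 'm::finite" and K :: "real ^ 'k::finite ^ 'n"
  shows "(M + N) ** K = M ** K + N ** K"
  by (simp add: vec_eq_iff matrix_matrix_mult_def sum.distrib distrib_right)

lemma bounded_bilinear_matrix_mult:
  "bounded_bilinear ((**) :: real ^ 'n::finite ^ 'm::finite \<Rightarrow> real ^ 'k::finite ^ 'n \<Rightarrow> real ^ 'k ^ 'm)"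
  by (rule bounded_bilinear.intro)
    (auto simp: matrix_mult_add_rdistrib matrix_add_ldistrib scaleR_matrix_mult
      intro!: exI[of _ 1] norm_matrix_mult_le)

lemma bounded_linear_transpose:
  "bounded_linear (transpose :: real ^ 'n::finite ^ 'm::finite \<Rightarrow> real ^ 'm ^ 'n)"
  by (intro linear_conv_bounded_linear[THEN iffD1] linearI) (auto simp: transpose_def vec_eq_iff)

lemma borel_measurable_bilinear:
  fixes f :: "'x \<Rightarrow> 'a::euclidean_space" and g :: "'x \<Rightarrow> 'b::euclidean_space"
    and h :: "'a \<Rightarrow> 'b \<Rightarrow> 'c::real_normed_vector"
  assumes "bounded_bilinear h" "f \<in> borel_measurable M" "g \<in> borel_measurable M"
  shows "(\<lambda>x. h (f x) (g x)) \<in> borel_measurable M"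
  by (intro borel_measurable_continuous_Pair[OF assms(2,3)] bounded_bilinear.continuous_on[OF assms(1)])
    (auto intro: continuous_intros)

lemma borel_measurable_linear:
  fixes f :: "'x \<Rightarrow> 'a::euclidean_space" and h :: "'a \<Rightarrow> 'b::real_normed_vector"
  assumes "bounded_linear h" "f \<in> borel_measurable M"
  shows "(\<lambda>x. h (f x)) \<in> borel_measurable M"
  by (intro measurable_compose[OF assms(2)] borel_measurable_continuous_onI linear_continuous_on assms(1))

lemmas borel_measurable_matrix_intros =
  borel_measurable_bilinear[OF bounded_bilinear_matrix_vector_mult]
  borel_measurable_bilinear[OF bounded_bilinear_matrix_mult]
  borel_measurable_bilinear[OF bounded_bilinear_inner]
  borel_measurable_linear[OF bounded_linear_transpose]

text \<open>An operator bound controls every entry. The crude dimensional factor is harmless, since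
  only the existence of a uniform bound matters later.\<close>

lemma norm_matrix_le_of_vectors:
  fixes M :: "real ^ 'n::finite ^ 'm::finite" and c :: real
  assumes "\<And>x. norm (M *v x) \<le> c * norm x"
  shows "norm M \<le> CARD('m) * (CARD('n) * c)"
proof -
  have "\<bar>M $ i $ j\<bar> \<le> c" for i j
  proof -
    have "\<bar>M $ i $ j\<bar> = \<bar>(M *v axis j 1) $ i\<bar>" by (simp add: matrix_vector_mult_basis column_def)
    also have "\<dots> \<le> norm (M *v axis j 1)" by (rule component_le_norm_cart)
    also have "\<dots> \<le> c" using assms[of "axis j 1"] by simp
    finally show ?thesis .
  qed
  then have "(\<Sum>j\<in>UNIV. \<bar>M $ i $ j\<bar>) \<le> CARD('n) * c" for i
    using sum_bounded_above[of UNIV "\<lambda>j. \<bar>M $ i $ j\<bar>" c] by simp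
  then have "norm (M $ i) \<le> CARD('n) * c" for i
    using norm_le_l1_cart[of "M $ i"] order_trans by blast
  then have "(\<Sum>i\<in>UNIV. norm (M $ i)) \<le> CARD('m) * (CARD('n) * c)"
    using sum_bounded_above[of UNIV "\<lambda>i. norm (M $ i)" "CARD('n) * c"] by simp
  moreover have "norm M \<le> (\<Sum>i\<in>UNIV. norm (M $ i))"
    unfolding norm_vec_def by (rule L2_set_le_sum) simp
  ultimately show ?thesis by linarith
qed

text \<open>A lower bound makes the square matrix injective, hence invertible, and its reciprocal
  bounds the inverse.\<close>

lemma matrix_inv_of_bounded_below:
  fixes M :: "real ^ 'n::finite ^ 'n"
  assumes c: "c > 0" and le: "\<And>x. c * norm x \<le> norm (M *v x)"
  shows "M ** matrix_inv M = mat 1" "matrix_inv M ** M = mat 1" "norm (matrix_inv M *v x) \<le> 1 / c * norm x"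
proof -
  have "x = 0" if "M *v x = 0" for x
    using le[of x] that c by (simp add: mult_le_0_iff)
  then have "invertible M" by (simp add: invertible_left_inverse matrix_left_invertible_ker)
  then have "\<exists>N. M ** N = mat 1 \<and> N ** M = mat 1" by (simp add: invertible_def)
  then show *: "M ** matrix_inv M = mat 1" "matrix_inv M ** M = mat 1"
    unfolding matrix_inv_def by (metis (mono_tags, lifting) someI_ex)+
  have "c * norm (matrix_inv M *v x) \<le> norm x"
    using le[of "matrix_inv M *v x"] * by (simp add: matrix_vector_mul_assoc)
  then show "norm (matrix_inv M *v x) \<le> 1 / c * norm x"
    using c by (simp add: field_simps)
qed

lemma bounded_below_of_coercive_form:
  fixes M :: "real ^ 'n::finite ^ 'n"
  assumes "\<And>x. c * (norm x)\<^sup>2 \<le> x \<bullet> (M *v x)"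
  shows "c * norm x \<le> norm (M *v x)"
proof (cases "x = 0")
  case False
  have "c * norm x * norm x \<le> norm x * norm (M *v x)"
    using assms[of x] Cauchy_Schwarz_ineq2[of x "M *v x"] by (simp add: power2_eq_square)
  then show ?thesis using False by (simp add: mult.commute)
qed simp

lemma inner_transpose_mult:
  fixes M :: "real ^ 'n::finite ^ 'm::finite"
  shows "x \<bullet> (transpose M *v y) = (M *v x) \<bullet> y"
  by (metis dot_lmul_matrix inner_commute transpose_matrix_vector)

lemma symmetric_inner_commute:
  fixes M :: "real ^ 'n::finite ^ 'n"
  assumes "transpose M = M"
  shows "x \<bullet> (M *v y) = (M *v x) \<bullet> y"
  using inner_transpose_mult[of x M y] assms by simp

lemma symmetricI:
  fixes M :: "real ^ 'n::finite ^ 'n"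
  assumes "\<And>x y. x \<bullet> (M *v y) = (M *v x) \<bullet> y"
  shows "transpose M = M"
proof -
  have "M $ i $ j = M $ j $ i" for i j
    using assms[of "axis i 1" "axis j 1"]
    by (simp add: inner_axis inner_axis' matrix_vector_mult_basis column_def)
  then show ?thesis by (simp add: transpose_def vec_eq_iff)
qed

text \<open>Cramer's rule shows that the inverse depends measurably on the matrix.\<close>

lemma borel_measurable_matrix_inv:
  fixes R :: "real \<Rightarrow> real ^ 'm::finite ^ 'm"
  assumes R: "R \<in> borel_measurable (lebesgue_on S)" and S: "S \<in> sets lebesgue"
    and inv: "AE t in lebesgue_on S. R t ** J t = mat 1"
  shows "J \<in> borel_measurable (lebesgue_on S)"
proof (rule borel_measurable_lebesgue_on_AE_eq[OF _ S])
  \<comment> \<open>Determinants are polynomials in the entries, so this expression is measurable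
    outright; Cramer's rule identifies it with \<open>J\<close> wherever \<open>J\<close> is a right
    inverse.\<close>
  define C where "C t = (\<chi> k l. det (\<chi> i j. if j = k then axis l 1 $ i else R t $ i $ j) / det (R t))" for t
  have Rij: "(\<lambda>t. R t $ i $ j) \<in> borel_measurable (lebesgue_on S)" for i j
    by (intro borel_measurable_vec_nth R)
  have det: "(\<lambda>t. det (N t)) \<in> borel_measurable (lebesgue_on S)"
    if "\<And>i j. (\<lambda>t. N t $ i $ j) \<in> borel_measurable (lebesgue_on S)" for N :: "real \<Rightarrow> real ^ 'm ^ 'm"
    unfolding det_def by (intro borel_measurable_sum borel_measurable_times borel_measurable_prod that) auto
  show "C \<in> borel_measurable (lebesgue_on S)"
  proof (intro borel_measurable_vecI)
    fix k l
    have "(\<lambda>t. (\<chi> i j. if j = k then axis l 1 $ i else R t $ i $ j) $ i $ j) \<in> borel_measurable (lebesgue_on S)" for i j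
      using Rij by (cases "j = k") auto
    then have "(\<lambda>t. det (\<chi> i j. if j = k then axis l 1 $ i else R t $ i $ j)) \<in> borel_measurable (lebesgue_on S)"
      by (rule det)
    then show "(\<lambda>t. C t $ k $ l) \<in> borel_measurable (lebesgue_on S)"
      unfolding C_def using det[OF Rij] by (simp add: borel_measurable_divide)
  qed
  show "AE t in lebesgue_on S. C t = J t"
    using inv
  proof eventually_elim
    case (elim t)
    have "det (R t) \<noteq> 0"
      using elim by (metis det_I det_mul mult_zero_left zero_neq_one)
    moreover have "R t *v (J t *v axis l 1) = axis l 1" for l
      using elim by (simp add: matrix_vector_mul_assoc)
    ultimately have "J t *v axis l 1 = (\<chi> k. det (\<chi> i j. if j = k then axis l 1 $ i else R t $ i $ j) / det (R t))" for l
      using cramer by blast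
    then have "J t $ k $ l = C t $ k $ l" for k l
      unfolding C_def by (metis (no_types, lifting) column_def matrix_vector_mult_basis vec_lambda_beta)
    then show ?case by (simp add: vec_eq_iff)
  qed
qed

lemma has_integral_lebesgue_on_eq:
  fixes f :: "'a::euclidean_space \<Rightarrow> 'b::euclidean_space"
  assumes "integrable (lebesgue_on S) f" "S \<in> sets lebesgue" "(f has_integral I) S"
  shows "integral\<^sup>L (lebesgue_on S) f = I"
  using assms by (simp add: lebesgue_integral_eq_integral integral_unique)

lemma finite_measure_lebesgue_on_interval: "finite_measure (lebesgue_on {a..b::real})"
  by (rule finite_measureI) (simp add: space_restrict_space emeasure_restrict_space emeasure_lborel_Icc_eq)

lemma measure_lebesgue_on_interval: "a \<le> b \<Longrightarrow> measure (lebesgue_on {a..b}) {a..b::real} = b - a"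
  by (simp add: measure_restrict_space)

lemma integrable_lebesgue_on_bounded:
  fixes f :: "real \<Rightarrow> 'b::euclidean_space"
  assumes f: "f \<in> borel_measurable (lebesgue_on {a..b})"
    and g: "integrable (lebesgue_on {a..b}) g"
    and le: "\<And>t. t \<in> {a..b} \<Longrightarrow> norm (f t) \<le> c + d * g t"
  shows "integrable (lebesgue_on {a..b}) f"
proof -
  interpret finite_measure "lebesgue_on {a..b}" by (rule finite_measure_lebesgue_on_interval)
  have "integrable (lebesgue_on {a..b}) (\<lambda>t. c + d * g t)" using g by simp
  then show ?thesis
    by (rule measurable_bounded_by_integrable_imp_lebesgue_integrable[OF f _ le]) auto
qed

text \<open>Cauchy-Schwarz against the constant 1, obtained by expanding the nonnegative variance of
  the norm of \<open>w\<close> about its mean \<open>m / T\<close>.\<close>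

lemma lebesgue_integral_norm_squared_le:
  fixes w :: "real \<Rightarrow> 'b::euclidean_space"
  assumes T: "T > 0" and w: "w \<in> borel_measurable (lebesgue_on {0..T})"
    and w2: "integrable (lebesgue_on {0..T}) (\<lambda>t. (norm (w t))\<^sup>2)"
  shows "integrable (lebesgue_on {0..T}) (\<lambda>t. norm (w t))"
    and "(LINT t|lebesgue_on {0..T}. norm (w t))\<^sup>2 \<le> T * (LINT t|lebesgue_on {0..T}. (norm (w t))\<^sup>2)"
proof -
  interpret finite_measure "lebesgue_on {0..T}" by (rule finite_measure_lebesgue_on_interval)
  have "norm (norm (w t)) \<le> 1 + 1 * (norm (w t))\<^sup>2" for t
  proof -
    have "2 * norm (w t) \<le> (norm (w t))\<^sup>2 + 1" using sum_squares_bound[of "norm (w t)" 1] by simp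
    moreover have "norm (w t) \<ge> 0" by simp
    ultimately show ?thesis unfolding real_norm_def abs_norm_cancel by linarith
  qed
  then show i: "integrable (lebesgue_on {0..T}) (\<lambda>t. norm (w t))"
    using w by (intro integrable_lebesgue_on_bounded[OF _ w2, of _ 1 1]) auto
  define m where "m = (LINT t|lebesgue_on {0..T}. norm (w t))"
  note mT = measure_lebesgue_on_interval[of 0 T]
  have "0 \<le> (LINT t|lebesgue_on {0..T}. (norm (w t) - m / T)\<^sup>2)" by simp
  also have "\<dots> = (LINT t|lebesgue_on {0..T}. (norm (w t))\<^sup>2 - 2 * (m / T) * norm (w t) + (m / T)\<^sup>2)"
    by (simp add: power2_diff algebra_simps)
  also have "\<dots> = (LINT t|lebesgue_on {0..T}. (norm (w t))\<^sup>2) - 2 * (m / T) * m + T * (m / T)\<^sup>2"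
    using i w2 T mT by (simp add: m_def[symmetric])
  also have "\<dots> = (LINT t|lebesgue_on {0..T}. (norm (w t))\<^sup>2) - m\<^sup>2 / T"
    using T by (simp add: power2_eq_square field_simps)
  finally show "(LINT t|lebesgue_on {0..T}. norm (w t))\<^sup>2 \<le> T * (LINT t|lebesgue_on {0..T}. (norm (w t))\<^sup>2)"
    using T by (simp add: m_def[symmetric] field_simps)
qed

section \<open>The linear-quadratic problem\<close>

text \<open>The linearised problem with abstract bounded measurable coefficients. A single
  \<open>K\<close> bounds all of them and also serves as Lipschitz constant of the state
  equation.\<close>

locale linear_quadratic =
  fixes T K :: real
    and A :: "real \<Rightarrow> real ^ 'n::finite ^ 'n" and B :: "real \<Rightarrow> real ^ 'm::finite ^ 'n"
    and Q :: "real \<Rightarrow> real ^ 'n ^ 'n" and S :: "real \<Rightarrow> real ^ 'n ^ 'm"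
    and R :: "real \<Rightarrow> real ^ 'm ^ 'm" and G :: "real ^ 'n ^ 'n"
  assumes T: "T > 0" and K: "K > 0"
    and A_meas: "A \<in> borel_measurable (lebesgue_on {0..T})"
    and B_meas: "B \<in> borel_measurable (lebesgue_on {0..T})"
    and Q_meas: "Q \<in> borel_measurable (lebesgue_on {0..T})"
    and S_meas: "S \<in> borel_measurable (lebesgue_on {0..T})"
    and R_meas: "R \<in> borel_measurable (lebesgue_on {0..T})"
    and bounds: "\<And>t. t \<in> {0..T} \<Longrightarrow> norm (A t) \<le> K" "\<And>t. t \<in> {0..T} \<Longrightarrow> norm (B t) \<le> K"
      "\<And>t. t \<in> {0..T} \<Longrightarrow> norm (Q t) \<le> K" "\<And>t. t \<in> {0..T} \<Longrightarrow> norm (S t) \<le> K"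
      "\<And>t. t \<in> {0..T} \<Longrightarrow> norm (R t) \<le> K"
    and Q_sym: "\<And>t. t \<in> {0..T} \<Longrightarrow> transpose (Q t) = Q t"
    and R_sym: "\<And>t. t \<in> {0..T} \<Longrightarrow> transpose (R t) = R t"
    and G_sym: "transpose G = G"
begin

abbreviation \<mu> :: "real measure" where "\<mu> \<equiv> lebesgue_on {0..T}"

definition lin_state :: "(real \<Rightarrow> real ^ 'm) \<Rightarrow> (real \<Rightarrow> real ^ 'n) \<Rightarrow> bool" where
  "lin_state v y \<longleftrightarrow> solves_ode T (\<lambda>t \<eta>. A t *v \<eta> + B t *v v t) y \<and> y 0 = 0"

definition form :: "real \<Rightarrow> real ^ 'n \<Rightarrow> real ^ 'm \<Rightarrow> real" where
  "form t y v = y \<bullet> (Q t *v y) + 2 * (v \<bullet> (S t *v y)) + v \<bullet> (R t *v v)"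

definition coercive_form :: "real \<Rightarrow> bool" where
  "coercive_form \<alpha> \<longleftrightarrow> (\<forall>v\<in>L2 T. \<forall>y. lin_state v y \<longrightarrow>
     (LINT t|\<mu>. form t (y t) (v t)) + y T \<bullet> (G *v y T) \<ge> \<alpha> * (L2_norm T v)\<^sup>2)"

lemma inner_mult_le:
  fixes M :: "real ^ 'k::finite ^ 'l::finite"
  assumes "norm M \<le> K"
  shows "\<bar>x \<bullet> (M *v y)\<bar> \<le> K * (norm x * norm y)"
proof -
  have "\<bar>x \<bullet> (M *v y)\<bar> \<le> norm x * (norm M * norm y)"
    using Cauchy_Schwarz_ineq2[of x "M *v y"] norm_matrix_vector_mult_le[of M y]
    by (meson mult_left_mono norm_ge_zero order_trans)
  also have "\<dots> \<le> norm x * (K * norm y)"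
    using assms by (intro mult_left_mono mult_right_mono) auto
  finally show ?thesis by (simp add: mult_ac)
qed

lemma norm_mult_le:
  fixes M :: "real ^ 'k::finite ^ 'l::finite"
  assumes "norm M \<le> c"
  shows "norm (M *v x) \<le> c * norm x"
  using norm_matrix_vector_mult_le[of M x] mult_right_mono[OF assms norm_ge_zero[of x]] by linarith

lemma form_bound:
  assumes t: "t \<in> {0..T}"
  shows "\<bar>form t y v\<bar> \<le> 2 * K * ((norm y)\<^sup>2 + (norm v)\<^sup>2)"
proof -
  have 1: "\<bar>y \<bullet> (Q t *v y)\<bar> \<le> K * (norm y)\<^sup>2" "\<bar>v \<bullet> (R t *v v)\<bar> \<le> K * (norm v)\<^sup>2"
    "\<bar>v \<bullet> (S t *v y)\<bar> \<le> K * (norm v * norm y)"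
    using inner_mult_le[OF bounds(3)[OF t], of y y] inner_mult_le[OF bounds(5)[OF t], of v v]
      inner_mult_le[OF bounds(4)[OF t], of v y] by (simp_all add: power2_eq_square)
  have "K * (2 * (norm v * norm y)) \<le> K * ((norm y)\<^sup>2 + (norm v)\<^sup>2)"
    using sum_squares_bound[of "norm v" "norm y"] K by (intro mult_left_mono) auto
  with 1 show ?thesis unfolding form_def by (simp add: algebra_simps abs_le_iff)
qed

lemma form_measurable:
  assumes "y \<in> borel_measurable \<mu>" "v \<in> borel_measurable \<mu>"
  shows "(\<lambda>t. form t (y t) (v t)) \<in> borel_measurable \<mu>"
  unfolding form_def
  by (intro borel_measurable_add borel_measurable_times borel_measurable_const borel_measurable_matrix_intros
      assms Q_meas S_meas R_meas)

lemma continuous_on_measurable: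
  fixes y :: "real \<Rightarrow> 'a::euclidean_space"
  assumes "continuous_on {0..T} y"
  shows "y \<in> borel_measurable \<mu>"
  by (rule continuous_imp_measurable_on_sets_lebesgue[OF assms]) simp

lemma continuous_on_bounded:
  fixes y :: "real \<Rightarrow> 'a::euclidean_space"
  assumes "continuous_on {0..T} y"
  obtains b where "b > 0" "\<And>t. t \<in> {0..T} \<Longrightarrow> norm (y t) \<le> b"
proof -
  have "bounded (y ` {0..T})" by (intro compact_imp_bounded compact_continuous_image assms) simp
  then obtain b where b: "\<And>t. t \<in> {0..T} \<Longrightarrow> norm (y t) \<le> b" unfolding bounded_iff by blast
  then have "norm (y t) \<le> \<bar>b\<bar> + 1" if "t \<in> {0..T}" for t using b[OF that] by linarith
  then show thesis using that[of "\<bar>b\<bar> + 1"] abs_ge_zero[of b] by fastforce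
qed

lemma form_integrable:
  assumes y: "continuous_on {0..T} y" and v: "v \<in> L2 T"
  shows "integrable \<mu> (\<lambda>t. form t (y t) (v t))"
proof -
  obtain b where b: "b > 0" "\<And>t. t \<in> {0..T} \<Longrightarrow> norm (y t) \<le> b"
    using continuous_on_bounded[OF y] by blast
  have vm: "v \<in> borel_measurable \<mu>" and v2: "integrable \<mu> (\<lambda>t. (norm (v t))\<^sup>2)"
    using v by (simp_all add: L2_def)
  show ?thesis
  proof (rule integrable_lebesgue_on_bounded[OF form_measurable[OF continuous_on_measurable[OF y] vm] v2])
    fix t assume t: "t \<in> {0..T}"
    have "2 * K * (norm (y t))\<^sup>2 \<le> 2 * K * b\<^sup>2"
      using b(2)[OF t] K by (intro mult_left_mono power_mono) auto
    then show "norm (form t (y t) (v t)) \<le> 2 * K * b\<^sup>2 + 2 * K * (norm (v t))\<^sup>2"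
      using form_bound[OF t, of "y t" "v t"] by (simp add: algebra_simps)
  qed
qed

text \<open>The bound uses the integral of the norm of the control and not its square mean. For a
  control of fixed height on a set of measure m this gives a state of order m, whereas the square
  mean would give only the square root of m.\<close>

lemma lin_state_norm_le:
  assumes ls: "lin_state v y" and v: "v \<in> L2 T" and t: "t \<in> {0..T}"
  shows "norm (y t) \<le> K * (LINT t|\<mu>. norm (v t)) * exp (K * T)"
proof -
  have "integrable \<mu> (\<lambda>t. norm (v t))"
    using lebesgue_integral_norm_squared_le(1)[OF T, of v] v by (simp add: L2_def)
  then have k: "integrable \<mu> (\<lambda>t. K * norm (v t))" by simp
  have "norm (A t *v y t + B t *v v t) \<le> K * norm (y t) + K * norm (v t)" if "t \<in> {0..T}" for t
    using norm_triangle_ineq[of "A t *v y t" "B t *v v t"]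
      norm_mult_le[OF bounds(1)[OF that], of "y t"] norm_mult_le[OF bounds(2)[OF that], of "v t"] by linarith
  then have "AE t in \<mu>. norm (A t *v y t + B t *v v t) \<le> K * norm (y t) + K * norm (v t)"
    by (intro AE_I2) simp
  then have "norm (y t) \<le> (LINT t|\<mu>. K * norm (v t)) * exp (K * t)"
    using ls K by (intro solves_ode_norm_bound[OF _ _ _ _ k _ t, where F = "\<lambda>t \<eta>. A t *v \<eta> + B t *v v t"])
      (auto simp: lin_state_def)
  also have "\<dots> \<le> (LINT t|\<mu>. K * norm (v t)) * exp (K * T)"
    using t K by (intro mult_left_mono integral_nonneg) auto
  finally show ?thesis by simp
qed

text \<open>The inverse is replaced by 0 at the times where the lower bound fails. This makes the
  norm bound hold at every time, as the existence theorem for differential equations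
  requires.\<close>

definition R_inv :: "real \<Rightarrow> real \<Rightarrow> real ^ 'm ^ 'm" where
  "R_inv c t = (if \<forall>w. c * (norm w)\<^sup>2 \<le> w \<bullet> (R t *v w) then matrix_inv (R t) else 0)"

section \<open>Uniformly positive \<open>R\<close>: its bounded inverse, and coercivity from a
  Riccati solution\<close>

context
  fixes c :: real
  assumes c: "c > 0" and R_ge: "AE t in \<mu>. \<forall>w. c * (norm w)\<^sup>2 \<le> w \<bullet> (R t *v w)"
begin

lemma R_inv_AE: "AE t in \<mu>. R t ** R_inv c t = mat 1 \<and> R_inv c t = matrix_inv (R t)"
  using R_ge
proof eventually_elim
  case (elim t)
  then have "c * norm w \<le> norm (R t *v w)" for w by (intro bounded_below_of_coercive_form) blast
  from matrix_inv_of_bounded_below(1)[OF c this] show ?case using elim by (simp add: R_inv_def)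
qed

lemma R_inv_measurable: "R_inv c \<in> borel_measurable \<mu>"
proof (rule borel_measurable_matrix_inv[OF R_meas])
  show "AE t in \<mu>. R t ** R_inv c t = mat 1" using R_inv_AE by (rule eventually_mono) blast
qed simp

lemma R_inv_norm_le: "norm (R_inv c t) \<le> CARD('m) * (CARD('m) * (1 / c))"
proof (rule norm_matrix_le_of_vectors[of "R_inv c t" "1 / c"])
  fix x
  show "norm (R_inv c t *v x) \<le> 1 / c * norm x"
  proof (cases "\<forall>w. c * (norm w)\<^sup>2 \<le> w \<bullet> (R t *v w)")
    case True
    then have "c * norm w \<le> norm (R t *v w)" for w by (intro bounded_below_of_coercive_form) blast
    from matrix_inv_of_bounded_below(3)[OF c this] show ?thesis using True by (simp add: R_inv_def)
  next
    case False
    then have "R_inv c t = 0" unfolding R_inv_def by (rule if_not_P)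
    then show ?thesis using c by simp
  qed
qed

text \<open>Along the linearised state the quadratic form differs from the derivative of \<open>- y \<bullet> P y\<close> by a
  complete square in \<open>v + R\<inverse> (B\<^sup>T P + S) y\<close>.\<close>

theorem riccati_imp_coercive_form:
  assumes P: "riccati_solution T A B Q S R G P"
  shows "\<exists>\<alpha>>0. coercive_form \<alpha>"
proof -
  have P_ac: "abs_continuous_on {0..T} P" and P_sym: "\<And>t. t \<in> {0..T} \<Longrightarrow> transpose (P t) = P t"
    and P_T: "P T = G"
    and P_der: "AE t in \<mu>. \<exists>P'. (P has_vector_derivative P') (at t within {0..T}) \<and>
        P' + P t ** A t + transpose (A t) ** P t + Q t
          - transpose (transpose (B t) ** P t + S t) ** matrix_inv (R t)
              ** (transpose (B t) ** P t + S t) = 0"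
    using P by (auto simp: riccati_solution_def)
  have P_cont: "continuous_on {0..T} P" by (rule abs_continuous_on_imp_continuous_on[OF P_ac])
  obtain p where p: "p > 0" "\<And>t. t \<in> {0..T} \<Longrightarrow> norm (P t) \<le> p" using continuous_on_bounded[OF P_cont] by blast
  define \<Phi> where "\<Phi> t = transpose (B t) ** P t + S t" for t
  \<comment> \<open>The feedback gain: \<open>w = v + \<Theta> y\<close> is the deviation of the
    control from the feedback law of the Riccati solution. Below, \<open>q\<close> bounds the
    gain.\<close>
  define \<Theta> where "\<Theta> t = R_inv c t ** \<Phi> t" for t
  define r where "r = CARD('m) * (CARD('m) * (1 / c))"
  define q where "q = r * (K * p + K)"
  have r: "r \<ge> 0" using c by (simp add: r_def)
  then have q: "q \<ge> 0" using p K by (simp add: q_def)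
  have \<Theta>_meas: "\<Theta> \<in> borel_measurable \<mu>"
    unfolding \<Theta>_def \<Phi>_def
    by (intro borel_measurable_add borel_measurable_matrix_intros B_meas S_meas R_inv_measurable
        continuous_on_measurable P_cont)
  have \<Theta>_le: "norm (\<Theta> t) \<le> q" if t: "t \<in> {0..T}" for t
  proof -
    have "norm (transpose (B t) ** P t) \<le> K * p"
      using norm_matrix_mult_le[of "transpose (B t)" "P t"]
        mult_mono[OF bounds(2)[OF t] p(2)[OF t]] K by (simp add: norm_transpose)
    then have "norm (\<Phi> t) \<le> K * p + K"
      unfolding \<Phi>_def using bounds(4)[OF t] norm_triangle_mono by blast
    moreover have "norm (\<Theta> t) \<le> norm (R_inv c t) * norm (\<Phi> t)"
      unfolding \<Theta>_def by (rule norm_matrix_mult_le)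
    moreover have "norm (R_inv c t) * norm (\<Phi> t) \<le> r * (K * p + K)"
      using R_inv_norm_le[of t] calculation(1) r by (intro mult_mono) (auto simp: r_def)
    ultimately show ?thesis by (simp add: q_def)
  qed
  \<comment> \<open>\<beta> is the Gronwall constant of the closed-loop equation, which has growth
    rate \<open>K + K * q\<close> and forcing \<open>K * norm w\<close>. \<open>D\<close> results
    from v = w - \<Theta> y: the 2 from splitting the square, one factor \<open>T\<close> from
    integrating in time, the other from Cauchy-Schwarz.\<close>
  define \<beta> where "\<beta> = exp ((K + K * q) * T) * K"
  define D where "D = 2 + 2 * q\<^sup>2 * T * (\<beta>\<^sup>2 * T)"
  have D: "D > 0" unfolding D_def using T by (intro add_pos_nonneg mult_nonneg_nonneg) auto
  have "coercive_form (c / D)"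
    unfolding coercive_form_def
  proof (intro ballI allI impI)
    fix v y assume v: "v \<in> L2 T" and ls: "lin_state v y"
    have vm: "v \<in> borel_measurable \<mu>" and v2: "integrable \<mu> (\<lambda>t. (norm (v t))\<^sup>2)"
      using v by (simp_all add: L2_def)
    have y_ac: "abs_continuous_on {0..T} y" and y0: "y 0 = 0"
      and y_der: "AE t in \<mu>. (y has_vector_derivative A t *v y t + B t *v v t) (at t within {0..T})"
      using ls by (auto simp: lin_state_def solves_ode_def)
    have y_cont: "continuous_on {0..T} y" by (rule abs_continuous_on_imp_continuous_on[OF y_ac])
    have ym: "y \<in> borel_measurable \<mu>" by (rule continuous_on_measurable[OF y_cont])
    obtain b where b: "b > 0" "\<And>t. t \<in> {0..T} \<Longrightarrow> norm (y t) \<le> b" using continuous_on_bounded[OF y_cont] by blast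
    define w where "w t = v t + \<Theta> t *v y t" for t
    have wm: "w \<in> borel_measurable \<mu>"
      unfolding w_def by (intro borel_measurable_add borel_measurable_matrix_intros vm ym \<Theta>_meas)
    have \<Theta>y: "norm (\<Theta> t *v y t) \<le> q * norm (y t)" if "t \<in> {0..T}" for t
      by (rule norm_mult_le[OF \<Theta>_le[OF that]])
    have w2: "integrable \<mu> (\<lambda>t. (norm (w t))\<^sup>2)"
    proof (rule integrable_lebesgue_on_bounded[OF _ v2])
      fix t assume t: "t \<in> {0..T}"
      have "norm (w t) \<le> norm (v t) + q * b"
        using norm_triangle_ineq[of "v t" "\<Theta> t *v y t"] \<Theta>y[OF t] mult_left_mono[OF b(2)[OF t] q]
        unfolding w_def by linarith
      then have "(norm (w t))\<^sup>2 \<le> (norm (v t) + q * b)\<^sup>2" by (intro power_mono) auto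
      also have "\<dots> \<le> 2 * (q * b)\<^sup>2 + 2 * (norm (v t))\<^sup>2"
        using sum_squares_bound[of "norm (v t)" "q * b"] by (simp add: power2_sum)
      finally show "norm ((norm (w t))\<^sup>2) \<le> 2 * (q * b)\<^sup>2 + 2 * (norm (v t))\<^sup>2" by simp
    qed (use wm in auto)
    have wRw: "integrable \<mu> (\<lambda>t. w t \<bullet> (R t *v w t))"
    proof (rule integrable_lebesgue_on_bounded[OF _ w2])
      show "(\<lambda>t. w t \<bullet> (R t *v w t)) \<in> borel_measurable \<mu>"
        by (intro borel_measurable_matrix_intros wm R_meas)
      show "norm (w t \<bullet> (R t *v w t)) \<le> 0 + K * (norm (w t))\<^sup>2" if "t \<in> {0..T}" for t
        using inner_mult_le[OF bounds(5)[OF that], of "w t" "w t"] by (simp add: power2_eq_square)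
    qed
    have fi: "integrable \<mu> (\<lambda>t. form t (y t) (v t))" by (rule form_integrable[OF y_cont v])
    define \<phi> where "\<phi> t = y t \<bullet> (P t *v y t)" for t
    have \<phi>_ac: "abs_continuous_on {0..T} \<phi>"
      unfolding \<phi>_def
      by (intro abs_continuous_on_bilinear[OF bounded_bilinear_inner]
          abs_continuous_on_bilinear[OF bounded_bilinear_matrix_vector_mult] y_ac P_ac)
    have "AE t in \<mu>. t \<in> {0..T}" by (rule AE_I2) simp
    with P_der y_der R_inv_AE
    have "AE t in \<mu>. (\<phi> has_vector_derivative w t \<bullet> (R t *v w t) - form t (y t) (v t)) (at t within {0..T})"
    proof eventually_elim
      case (elim t)
      let ?y' = "A t *v y t + B t *v v t"
      from elim obtain P' where P': "(P has_vector_derivative P') (at t within {0..T})"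
        and eq: "P' + P t ** A t + transpose (A t) ** P t + Q t - transpose (\<Phi> t) ** R_inv c t ** \<Phi> t = 0"
        unfolding \<Phi>_def by auto
      have P'eq: "P' = transpose (\<Phi> t) ** R_inv c t ** \<Phi> t - P t ** A t - transpose (A t) ** P t - Q t"
        using eq by (simp add: algebra_simps eq_diff_eq)
      have sP: "x \<bullet> (P t *v z) = (P t *v x) \<bullet> z" for x z
        by (rule symmetric_inner_commute) (use P_sym elim in blast)
      have sR: "x \<bullet> (R t *v z) = (R t *v x) \<bullet> z" for x z
        by (rule symmetric_inner_commute) (use R_sym elim in blast)
      have RR: "R t *v (R_inv c t *v z) = z" for z
      proof -
        have "R t ** R_inv c t = mat 1" using elim by blast
        then show ?thesis by (simp only: matrix_vector_mul_assoc matrix_vector_mul_lid)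
      qed
      have \<Phi>v: "v t \<bullet> (\<Phi> t *v y t) = (B t *v v t) \<bullet> (P t *v y t) + v t \<bullet> (S t *v y t)"
        by (simp add: \<Phi>_def matrix_vector_mult_add_rdistrib inner_add_right inner_transpose_mult
            del: transpose_matrix_vector flip: matrix_vector_mul_assoc)
      have der: "(\<phi> has_vector_derivative (y t \<bullet> (P t *v ?y' + P' *v y t) + ?y' \<bullet> (P t *v y t))) (at t within {0..T})"
        unfolding \<phi>_def
        by (intro bounded_bilinear.has_vector_derivative[OF bounded_bilinear_inner]
            bounded_bilinear.has_vector_derivative[OF bounded_bilinear_matrix_vector_mult] P') (use elim in auto)
      have "y t \<bullet> (P t *v ?y' + P' *v y t) + ?y' \<bullet> (P t *v y t) =
          (\<Phi> t *v y t) \<bullet> (R_inv c t *v (\<Phi> t *v y t)) - y t \<bullet> (Q t *v y t) + 2 * ((B t *v v t) \<bullet> (P t *v y t))"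
      proof -
        have "y t \<bullet> (P' *v y t) = (\<Phi> t *v y t) \<bullet> (R_inv c t *v (\<Phi> t *v y t))
            - (P t *v y t) \<bullet> (A t *v y t) - (A t *v y t) \<bullet> (P t *v y t) - y t \<bullet> (Q t *v y t)"
          by (simp add: P'eq matrix_vector_mult_diff_rdistrib inner_diff_right inner_transpose_mult sP
              del: transpose_matrix_vector flip: matrix_vector_mul_assoc)
        moreover have "y t \<bullet> (P t *v ?y') = (P t *v y t) \<bullet> (A t *v y t) + (P t *v y t) \<bullet> (B t *v v t)"
          by (simp add: sP inner_add_right)
        ultimately show ?thesis
          by (simp add: inner_add_right inner_add_left inner_commute)
      qed
      \<comment> \<open>Since \<open>R\<close> sends \<open>z\<close> to \<open>\<Phi> y\<close>,
        the cross term is \<open>2 * (v \<bullet> \<Phi> y)\<close>, and the term left over is the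
        quadratic term of the Riccati equation.\<close>
      moreover have "w t \<bullet> (R t *v w t) =
          v t \<bullet> (R t *v v t) + 2 * (v t \<bullet> (\<Phi> t *v y t)) + (\<Phi> t *v y t) \<bullet> (R_inv c t *v (\<Phi> t *v y t))"
      proof -
        define z where "z = R_inv c t *v (\<Phi> t *v y t)"
        have "w t = v t + z" by (simp add: w_def \<Theta>_def z_def matrix_vector_mul_assoc)
        moreover have "R t *v z = \<Phi> t *v y t" unfolding z_def by (rule RR)
        moreover have "z \<bullet> (R t *v v t) = (R t *v z) \<bullet> v t" by (rule sR)
        ultimately show ?thesis
          by (simp add: matrix_vector_right_distrib inner_add_left inner_add_right inner_commute z_def[symmetric])
      qed
      ultimately have "y t \<bullet> (P t *v ?y' + P' *v y t) + ?y' \<bullet> (P t *v y t) = w t \<bullet> (R t *v w t) - form t (y t) (v t)"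
        by (simp add: form_def \<Phi>v)
      then show ?case using der by simp
    qed
    then have "((\<lambda>t. w t \<bullet> (R t *v w t) - form t (y t) (v t)) has_integral (\<phi> T - \<phi> 0)) {0..T}"
      using T by (intro abs_continuous_on_has_integral \<phi>_ac) auto
    then have "(LINT t|\<mu>. w t \<bullet> (R t *v w t) - form t (y t) (v t)) = \<phi> T"
      using y0 wRw fi by (subst has_integral_lebesgue_on_eq) (auto simp: \<phi>_def)
    then have "(LINT t|\<mu>. form t (y t) (v t)) + \<phi> T = (LINT t|\<mu>. w t \<bullet> (R t *v w t))"
      using wRw fi by simp
    also have "\<dots> \<ge> (LINT t|\<mu>. c * (norm (w t))\<^sup>2)"
      using R_ge by (intro integral_mono_AE wRw) (auto simp: w2 elim!: eventually_mono)
    finally have 1: "(LINT t|\<mu>. form t (y t) (v t)) + \<phi> T \<ge> c * (LINT t|\<mu>. (norm (w t))\<^sup>2)" by simp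
    define m where "m = (LINT t|\<mu>. norm (w t))"
    have m0: "m \<ge> 0" by (simp add: m_def)
    note m = lebesgue_integral_norm_squared_le[OF T wm w2, folded m_def]
    have y_le: "norm (y t) \<le> \<beta> * m" if t: "t \<in> {0..T}" for t
    proof -
      \<comment> \<open>Inserting v = w - \<Theta> y closes the loop: the state is now forced by
        \<open>w\<close> alone, at the price of a larger growth rate.\<close>
      have "norm (A t *v y t + B t *v v t) \<le> (K + K * q) * norm (y t) + K * norm (w t)" if t: "t \<in> {0..T}" for t
      proof -
        have "norm (v t) \<le> norm (w t) + q * norm (y t)"
          using norm_triangle_ineq4[of "w t" "\<Theta> t *v y t"] \<Theta>y[OF t] by (simp add: w_def)
        then have "K * norm (v t) \<le> K * (norm (w t) + q * norm (y t))" using K by (intro mult_left_mono) auto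
        then show ?thesis
          using norm_triangle_ineq[of "A t *v y t" "B t *v v t"]
            norm_mult_le[OF bounds(1)[OF t], of "y t"] norm_mult_le[OF bounds(2)[OF t], of "v t"]
          by (simp add: algebra_simps)
      qed
      then have ae: "AE t in \<mu>. norm (A t *v y t + B t *v v t) \<le> (K + K * q) * norm (y t) + K * norm (w t)"
        by (intro AE_I2) simp
      have Kw: "integrable \<mu> (\<lambda>t. K * norm (w t))" using m(1) by simp
      have "norm (y t) \<le> (LINT t|\<mu>. K * norm (w t)) * exp ((K + K * q) * t)"
        using ls K q by (intro solves_ode_norm_bound[OF _ _ _ _ Kw _ t, where F = "\<lambda>t \<eta>. A t *v \<eta> + B t *v v t"] ae)
          (auto simp: lin_state_def)
      also have "\<dots> = K * m * exp ((K + K * q) * t)" by (simp add: m_def)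
      also have "\<dots> \<le> K * m * exp ((K + K * q) * T)"
        using t K q m0 by (intro mult_left_mono) (auto intro!: mult_left_mono mult_nonneg_nonneg)
      finally show ?thesis by (simp add: \<beta>_def mult_ac)
    qed
    have v_le: "(norm (v t))\<^sup>2 \<le> 2 * (norm (w t))\<^sup>2 + 2 * q\<^sup>2 * (\<beta>\<^sup>2 * m\<^sup>2)" if t: "t \<in> {0..T}" for t
    proof -
      have "norm (v t) \<le> norm (w t) + q * (\<beta> * m)"
        using norm_triangle_ineq4[of "w t" "\<Theta> t *v y t"] \<Theta>y[OF t] mult_left_mono[OF y_le[OF t] q] by (simp add: w_def)
      then have "(norm (v t))\<^sup>2 \<le> (norm (w t) + q * (\<beta> * m))\<^sup>2" by (intro power_mono) auto
      also have "\<dots> \<le> 2 * (norm (w t))\<^sup>2 + 2 * (q * (\<beta> * m))\<^sup>2"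
        using sum_squares_bound[of "norm (w t)" "q * (\<beta> * m)"] by (simp add: power2_sum)
      finally show ?thesis by (simp add: power_mult_distrib algebra_simps)
    qed
    interpret finite_measure \<mu> by (rule finite_measure_lebesgue_on_interval)
    note mT = measure_lebesgue_on_interval[of 0 T]
    have "(LINT t|\<mu>. (norm (v t))\<^sup>2) \<le> (LINT t|\<mu>. 2 * (norm (w t))\<^sup>2 + 2 * q\<^sup>2 * (\<beta>\<^sup>2 * m\<^sup>2))"
      using v_le by (intro integral_mono v2) (auto simp: w2)
    also have "\<dots> = 2 * (LINT t|\<mu>. (norm (w t))\<^sup>2) + T * (2 * q\<^sup>2 * (\<beta>\<^sup>2 * m\<^sup>2))"
      using w2 T mT by simp
    also have "\<dots> \<le> 2 * (LINT t|\<mu>. (norm (w t))\<^sup>2) + T * (2 * q\<^sup>2 * (\<beta>\<^sup>2 * (T * (LINT t|\<mu>. (norm (w t))\<^sup>2))))"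
      using m(2) T by (intro add_left_mono mult_left_mono) auto
    also have "\<dots> = D * (LINT t|\<mu>. (norm (w t))\<^sup>2)" by (simp add: D_def algebra_simps)
    finally have "(LINT t|\<mu>. (norm (v t))\<^sup>2) / D \<le> (LINT t|\<mu>. (norm (w t))\<^sup>2)"
      using D by (simp add: field_simps)
    then have "c * ((LINT t|\<mu>. (norm (v t))\<^sup>2) / D) \<le> c * (LINT t|\<mu>. (norm (w t))\<^sup>2)"
      using c by (intro mult_left_mono) auto
    then show "c / D * (L2_norm T v)\<^sup>2 \<le> (LINT t|\<mu>. form t (y t) (v t)) + y T \<bullet> (G *v y T)"
      using 1 by (simp add: L2_norm_def \<phi>_def P_T)
  qed
  then show ?thesis using c D by (intro exI[of _ "c / D"]) simp
qed

end

end

text \<open>The variation of the control gives information only about sets of small measure. Cutting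
  the set into finitely many short pieces transfers it to the whole set.\<close>

lemma negligible_of_small_subsets:
  fixes E :: "real set"
  assumes E: "E \<in> sets lebesgue" "E \<subseteq> {0..T}" and T: "T > 0" and d: "d > 0"
    and small: "\<And>E'. E' \<subseteq> E \<Longrightarrow> E' \<in> sets lebesgue \<Longrightarrow> measure lebesgue E' < d \<Longrightarrow> measure lebesgue E' = 0"
  shows "negligible E"
proof -
  \<comment> \<open>Pieces of length \<open>T / N\<close> are shorter than \<open>d\<close>.\<close>
  obtain N :: nat where N: "T / d < real N" using reals_Archimedean2 by blast
  then have N0: "N > 0" using T d by (cases "N = 0") (auto simp: field_simps)
  have neg: "negligible (E \<inter> {real i * T / N..(real i + 1) * T / N})" for i
  proof -
    let ?I = "{real i * T / N..(real i + 1) * T / N}" and ?E' = "E \<inter> {real i * T / N..(real i + 1) * T / N}"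
    have m: "?E' \<in> sets lebesgue" using E by (intro sets.Int) auto
    have fm: "?I \<in> lmeasurable" by (metis lmeasurable_cbox box_real(2))
    have "measure lebesgue ?E' \<le> measure lebesgue ?I"
      by (intro measure_mono_fmeasurable m fm) auto
    also have "\<dots> = T / N" using N0 T by (simp add: field_simps)
    also have "\<dots> < d" using N N0 d by (simp add: field_simps)
    finally have "measure lebesgue ?E' = 0" using m by (intro small) auto
    moreover have "?E' \<in> lmeasurable" by (rule fmeasurableI2[OF fm _ m]) auto
    ultimately show ?thesis by (simp add: negligible_iff_measure)
  qed
  have "E \<subseteq> (\<Union>i. E \<inter> {real i * T / N..(real i + 1) * T / N})"
  proof
    fix x assume x: "x \<in> E"
    define i where "i = nat \<lfloor>x * N / T\<rfloor>"
    have "x \<ge> 0" using x E by auto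
    then have "real i \<le> x * N / T" "x * N / T \<le> real i + 1"
      unfolding i_def using T by (simp_all add: of_nat_nat floor_correct) 
    then have "x \<in> {real i * T / N..(real i + 1) * T / N}"
      using T N0 by (simp add: field_simps)
    then show "x \<in> (\<Union>i. E \<inter> {real i * T / N..(real i + 1) * T / N})" using x by blast
  qed
  then show ?thesis using negligible_Union_nat[of "\<lambda>i. E \<inter> {real i * T / N..(real i + 1) * T / N}", OF neg]
    by (rule negligible_subset[rotated])
qed

section \<open>Lower bound on \<open>R\<close> from coercivity\<close>

context linear_quadratic
begin

text \<open>A bounded control makes the inhomogeneity bounded, as the existence theorem demands; the
  test controls, multiples of indicators, are bounded.\<close>

lemma lin_state_exists:
  assumes v: "v \<in> borel_measurable \<mu>" "\<And>t. t \<in> {0..T} \<Longrightarrow> norm (v t) \<le> N"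
  obtains y where "lin_state v y"
proof -
  define F where "F t \<eta> = A t *v \<eta> + B t *v v t" for t \<eta>
  obtain y C where "solves_ode T F y" "y 0 = 0"
  proof (rule caratheodory_lipschitz_ode_exists[of 0 T K F "K * N" 0])
    show "(\<lambda>t. F t (z t)) \<in> borel_measurable \<mu>" if "continuous_on {0..T} z" for z
      unfolding F_def
      by (intro borel_measurable_add borel_measurable_matrix_intros A_meas B_meas v continuous_on_measurable that)
    show "norm (F t x - F t y) \<le> K * norm (x - y)" if "t \<in> {0..T}" for t x y
      using norm_mult_le[OF bounds(1)[OF that], of "x - y"] by (simp add: F_def matrix_vector_mult_diff_distrib)
    show "norm (F t 0) \<le> K * N" if "t \<in> {0..T}" for t
      using order_trans[OF norm_mult_le[OF bounds(2)[OF that], of "v t"] mult_left_mono[OF v(2)[OF that], of K]] K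
      by (simp add: F_def)
  qed (use T K in auto)
  moreover have "F = (\<lambda>t \<eta>. A t *v \<eta> + B t *v v t)" by (simp add: F_def fun_eq_iff)
  ultimately show thesis using that[of y] by (simp add: lin_state_def)
qed

text \<open>Testing with controls supported on a small set of measure \<open>\<epsilon>\<close>: the state is then of order \<open>\<epsilon>\<close>,
  so only the term in \<open>R\<close> contributes to first order.\<close>

lemma coercive_form_imp_R_ge_on_vector:
  assumes co: "coercive_form \<alpha>" and \<epsilon>: "\<epsilon> > 0"
  shows "AE t in \<mu>. (\<alpha> - \<epsilon>) * (norm w)\<^sup>2 \<le> w \<bullet> (R t *v w)"
proof (cases "w = 0")
  case False
  define E where "E = {t \<in> {0..T}. w \<bullet> (R t *v w) < (\<alpha> - \<epsilon>) * (norm w)\<^sup>2}"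
  have "(\<lambda>t. w \<bullet> (R t *v w)) \<in> borel_measurable \<mu>"
    by (intro borel_measurable_matrix_intros R_meas) auto
  then have "{t \<in> space \<mu>. w \<bullet> (R t *v w) < (\<alpha> - \<epsilon>) * (norm w)\<^sup>2} \<in> sets \<mu>"
    by measurable
  then have "E \<in> sets \<mu>" by (simp add: E_def)
  then have E: "E \<in> sets lebesgue" "E \<subseteq> {0..T}"
    using sets_restrict_space_iff[of "{0..T}" lebesgue E] by simp_all
  \<comment> \<open>The state driven by \<open>w\<close> on a set of measure m is bounded by
    \<open>b * m\<close>.\<close>
  define b where "b = K * norm w * exp (K * T)"
  have b: "b > 0" using K False by (simp add: b_def)
  \<comment> \<open>The coefficients of the second-order terms in m: the integral of the
    \<open>Q\<close> term, the terminal term, and the cross term, whose support contributes the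
    second factor m.\<close>
  define D where "D = T * K * b\<^sup>2 + norm G * b\<^sup>2 + 2 * K * norm w * b"
  have "T * K * b\<^sup>2 \<ge> 0" "norm G * b\<^sup>2 \<ge> 0" "2 * K * norm w * b > 0" using K b T False by auto
  then have D: "D > 0" unfolding D_def by linarith
  have "negligible E"
  proof (rule negligible_of_small_subsets[OF E T])
    show "\<epsilon> * (norm w)\<^sup>2 / D > 0" using \<epsilon> False D by simp
    fix E' assume E': "E' \<subseteq> E" "E' \<in> sets lebesgue" "measure lebesgue E' < \<epsilon> * (norm w)\<^sup>2 / D"
    define m where "m = measure lebesgue E'"
    have m0: "m \<ge> 0" by (simp add: m_def)
    have sub: "E' \<subseteq> {0..T}" using E' E by blast
    have E'm: "E' \<in> sets \<mu>"
      using E' sub sets_restrict_space_iff[of "{0..T}" lebesgue E'] by simp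
    have E'l: "E' \<in> lmeasurable"
      by (rule fmeasurableI2[of "{0..T}"]) (use sub E' in \<open>auto simp: lmeasurable_interval\<close>)
    have ind: "(LINT t|\<mu>. indicator E' t :: real) = m" and indi: "integrable \<mu> (indicator E' :: real \<Rightarrow> real)"
    proof -
      interpret finite_measure \<mu> by (rule finite_measure_lebesgue_on_interval)
      show "integrable \<mu> (indicator E' :: real \<Rightarrow> real)" using E'm by (simp add: emeasure_finite less_top[symmetric])
      show "(LINT t|\<mu>. indicator E' t :: real) = m"
        using E'm sub by (simp add: m_def measure_restrict_space Int_absorb2 inf.absorb1)
    qed
    define v where "v t = indicator E' t *\<^sub>R w" for t
    have vm: "v \<in> borel_measurable \<mu>" unfolding v_def using E'm by measurable
    have vn: "norm (v t) = norm w * indicator E' t" for t by (simp add: v_def indicator_def)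
    have vn2: "(norm (v t))\<^sup>2 = (norm w)\<^sup>2 * indicator E' t" for t by (simp add: v_def indicator_def)
    have vL2: "v \<in> L2 T" using vm indi by (simp add: L2_def vn2)
    obtain y where ls: "lin_state v y"
      by (rule lin_state_exists[OF vm, of "norm w"]) (auto simp: v_def indicator_def)
    have "(LINT t|\<mu>. norm (v t)) = norm w * m" using ind by (simp add: vn)
    then have y: "norm (y t) \<le> b * m" if "t \<in> {0..T}" for t
      using lin_state_norm_le[OF ls vL2 that] by (simp add: b_def mult_ac)
    have yc: "continuous_on {0..T} y"
      using ls by (auto simp: lin_state_def solves_ode_def intro: abs_continuous_on_imp_continuous_on)
    \<comment> \<open>The term in \<open>R\<close> is estimated by the definition of
      \<open>E\<close>, because the control is supported there. The other terms use the smallness of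
      the state.\<close>
    have "form t (y t) (v t) \<le> K * (b * m)\<^sup>2 + (2 * K * norm w * (b * m) + (\<alpha> - \<epsilon>) * (norm w)\<^sup>2) * indicator E' t"
      if t: "t \<in> {0..T}" for t
    proof -
      have "y t \<bullet> (Q t *v y t) \<le> K * (b * m)\<^sup>2"
      proof -
        have "y t \<bullet> (Q t *v y t) \<le> K * (norm (y t) * norm (y t))"
          using inner_mult_le[OF bounds(3)[OF t], of "y t" "y t"] by linarith
        also have "\<dots> \<le> K * ((b * m) * (b * m))"
          using K y[OF t] b m0 by (intro mult_left_mono mult_mono) auto
        finally show ?thesis by (simp add: power2_eq_square)
      qed
      moreover have "2 * (v t \<bullet> (S t *v y t)) \<le> 2 * K * norm w * (b * m) * indicator E' t"
      proof -
        have "v t \<bullet> (S t *v y t) \<le> K * (norm (v t) * norm (y t))"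
          using inner_mult_le[OF bounds(4)[OF t], of "v t" "y t"] by linarith
        also have "\<dots> \<le> K * (norm (v t) * (b * m))"
          using K y[OF t] by (intro mult_left_mono) auto
        finally show ?thesis by (simp add: vn mult_ac)
      qed
      moreover have "v t \<bullet> (R t *v v t) \<le> (\<alpha> - \<epsilon>) * (norm w)\<^sup>2 * indicator E' t"
        using E' by (auto simp: v_def E_def indicator_def less_imp_le)
      ultimately show ?thesis by (simp add: form_def algebra_simps)
    qed
    then have "(LINT t|\<mu>. form t (y t) (v t)) \<le>
        (LINT t|\<mu>. K * (b * m)\<^sup>2 + (2 * K * norm w * (b * m) + (\<alpha> - \<epsilon>) * (norm w)\<^sup>2) * indicator E' t)"
    proof (intro integral_mono form_integrable[OF yc vL2])
      interpret finite_measure \<mu> by (rule finite_measure_lebesgue_on_interval)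
      show "integrable \<mu> (\<lambda>t. K * (b * m)\<^sup>2 + (2 * K * norm w * (b * m) + (\<alpha> - \<epsilon>) * (norm w)\<^sup>2) * indicator E' t)"
        using indi by simp
    qed simp
    also have "\<dots> = T * (K * (b * m)\<^sup>2) + (2 * K * norm w * (b * m) + (\<alpha> - \<epsilon>) * (norm w)\<^sup>2) * m"
    proof -
      interpret finite_measure \<mu> by (rule finite_measure_lebesgue_on_interval)
      show ?thesis using indi ind measure_lebesgue_on_interval[of 0 T] T by simp
    qed
    finally have 1: "(LINT t|\<mu>. form t (y t) (v t)) \<le>
        T * (K * (b * m)\<^sup>2) + (2 * K * norm w * (b * m) + (\<alpha> - \<epsilon>) * (norm w)\<^sup>2) * m" .
    have "(L2_norm T v)\<^sup>2 = (norm w)\<^sup>2 * m"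
      using ind m0 by (simp add: L2_norm_def vn2)
    then have "\<alpha> * ((norm w)\<^sup>2 * m) \<le> (LINT t|\<mu>. form t (y t) (v t)) + y T \<bullet> (G *v y T)"
      using co[unfolded coercive_form_def, rule_format, OF vL2 ls] by simp
    moreover have "y T \<bullet> (G *v y T) \<le> norm G * (b * m)\<^sup>2"
    proof -
      have "y T \<bullet> (G *v y T) \<le> norm (y T) * (norm G * norm (y T))"
        using Cauchy_Schwarz_ineq2[of "y T" "G *v y T"]
          mult_left_mono[OF norm_matrix_vector_mult_le[of G "y T"] norm_ge_zero[of "y T"]] by linarith
      also have "\<dots> = norm G * (norm (y T) * norm (y T))" by simp
      also have "\<dots> \<le> norm G * ((b * m) * (b * m))"
        using y[of T] T b m0 by (intro mult_left_mono mult_mono) auto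
      finally show ?thesis by (simp add: power2_eq_square)
    qed
    ultimately have "\<alpha> * ((norm w)\<^sup>2 * m) \<le> T * (K * (b * m)\<^sup>2) +
        (2 * K * norm w * (b * m) + (\<alpha> - \<epsilon>) * (norm w)\<^sup>2) * m + norm G * (b * m)\<^sup>2"
      using 1 by linarith
    \<comment> \<open>After cancellation of \<alpha>, the gap \<epsilon> remains at first order
      against second-order terms. Hence m is zero or at least
      \<open>\<epsilon> * (norm w)\<^sup>2 / D\<close>, and the latter is excluded.\<close>
    then have le: "\<epsilon> * (norm w)\<^sup>2 * m \<le> D * m * m"
      by (simp add: D_def power2_eq_square algebra_simps)
    show "measure lebesgue E' = 0"
    proof (rule ccontr)
      assume "measure lebesgue E' \<noteq> 0"
      then have "m > 0" using m0 unfolding m_def by linarith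
      then have "\<epsilon> * (norm w)\<^sup>2 \<le> D * m" using le by (simp add: mult_le_cancel_right)
      moreover have "D * m < \<epsilon> * (norm w)\<^sup>2" using E'(3) D by (simp add: m_def field_simps)
      ultimately show False by linarith
    qed
  qed
  then show ?thesis
    by (subst AE_lebesgue_on_iff_negligible) (auto simp: E_def not_le)
qed simp

text \<open>The null set depends on the vector and on \<epsilon>. Only countably many are united,
  for a dense set of vectors and \<epsilon> = 1/(n+1); continuity of the quadratic form covers all
  remaining vectors.\<close>

theorem coercive_form_imp_R_ge:
  assumes co: "coercive_form \<alpha>"
  shows "AE t in \<mu>. \<forall>w. \<alpha> * (norm w)\<^sup>2 \<le> w \<bullet> (R t *v w)"
proof -
  obtain W :: "(real ^ 'm) set" where W: "countable W" "\<And>X. open X \<Longrightarrow> X \<noteq> {} \<Longrightarrow> \<exists>w\<in>W. w \<in> X"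
    using countable_dense_exists by blast
  have "AE t in \<mu>. \<forall>n. (\<alpha> - 1 / real (Suc n)) * (norm w)\<^sup>2 \<le> w \<bullet> (R t *v w)" for w
    unfolding AE_all_countable by (intro allI coercive_form_imp_R_ge_on_vector[OF co]) simp
  then have "AE t in \<mu>. \<forall>w\<in>W. \<forall>n. (\<alpha> - 1 / real (Suc n)) * (norm w)\<^sup>2 \<le> w \<bullet> (R t *v w)"
    using W(1) by (subst AE_ball_countable) auto
  then show ?thesis
  proof eventually_elim
    case (elim t)
    have "\<alpha> * (norm w)\<^sup>2 \<le> w \<bullet> (R t *v w)" if w: "w \<in> W" for w
    proof (rule LIMSEQ_le_const2)
      have "(\<lambda>n. (\<alpha> - 1 / real (Suc n)) * (norm w)\<^sup>2) \<longlonglongrightarrow> (\<alpha> - 0) * (norm w)\<^sup>2"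
        by (intro tendsto_intros LIMSEQ_Suc[OF lim_1_over_n])
      then show "(\<lambda>n. (\<alpha> - 1 / real (Suc n)) * (norm w)\<^sup>2) \<longlonglongrightarrow> \<alpha> * (norm w)\<^sup>2" by simp
    qed (use elim w in blast)
    then have "W \<subseteq> {w. \<alpha> * (norm w)\<^sup>2 \<le> w \<bullet> (R t *v w)}" by blast
    moreover have "closed {w. \<alpha> * (norm w)\<^sup>2 \<le> w \<bullet> (R t *v w)}"
      by (intro closed_Collect_le continuous_intros matrix_vector_mult_linear_continuous_on)
    ultimately have "- {w. \<alpha> * (norm w)\<^sup>2 \<le> w \<bullet> (R t *v w)} = {}"
      using W(2)[of "- {w. \<alpha> * (norm w)\<^sup>2 \<le> w \<bullet> (R t *v w)}"] by (auto simp: open_Compl)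
    then show ?case by blast
  qed
qed

end

text \<open>The bound forces \<open>f t = 0\<close> and difference quotients of order s - t. It
  disposes of the remainder in the expansion of an inverse matrix.\<close>

lemma has_vector_derivative_zero_of_quadratic:
  fixes f :: "real \<Rightarrow> 'a::real_normed_vector"
  assumes t: "t \<in> S" and le: "\<And>s. s \<in> S \<Longrightarrow> norm (f s) \<le> M * (s - t)\<^sup>2"
  shows "(f has_vector_derivative 0) (at t within S)"
  unfolding has_vector_derivative_def has_derivative_within_alt
proof (intro conjI allI impI)
  fix e :: real assume e: "e > 0"
  have f0: "f t = 0" using le[OF t] by simp
  show "\<exists>d>0. \<forall>s\<in>S. norm (s - t) < d \<longrightarrow> norm (f s - f t - (s - t) *\<^sub>R 0) \<le> e * norm (s - t)"
  proof (intro exI[of _ "e / (\<bar>M\<bar> + 1)"] conjI ballI impI)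
    fix s assume s: "s \<in> S" "norm (s - t) < e / (\<bar>M\<bar> + 1)"
    have "norm (f s) \<le> (\<bar>M\<bar> + 1) * (\<bar>s - t\<bar> * \<bar>s - t\<bar>)"
    proof -
      have "M * (s - t)\<^sup>2 \<le> (\<bar>M\<bar> + 1) * (s - t)\<^sup>2" by (intro mult_right_mono) auto
      then show ?thesis using le[OF s(1)] by (simp add: power2_eq_square)
    qed
    also have "\<dots> = ((\<bar>M\<bar> + 1) * \<bar>s - t\<bar>) * \<bar>s - t\<bar>" by simp
    also have "\<dots> \<le> e * \<bar>s - t\<bar>"
      using s(2) by (intro mult_right_mono) (auto simp: field_simps)
    finally show "norm (f s - f t - (s - t) *\<^sub>R 0) \<le> e * norm (s - t)" using f0 by simp
  qed (use e in auto)
qed simp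

section \<open>Inverses of Lipschitz matrix functions\<close>

context
  fixes X Z :: "real \<Rightarrow> real ^ 'n::finite ^ 'n" and a b C N :: real
  assumes C: "C \<ge> 0" and lip: "\<And>s t. s \<in> {a..b} \<Longrightarrow> t \<in> {a..b} \<Longrightarrow> norm (X t - X s) \<le> C * \<bar>t - s\<bar>"
    and inv: "\<And>t. t \<in> {a..b} \<Longrightarrow> X t ** Z t = mat 1" "\<And>t. t \<in> {a..b} \<Longrightarrow> Z t ** X t = mat 1"
    and bnd: "\<And>t. t \<in> {a..b} \<Longrightarrow> norm (Z t) \<le> N"
begin

interpretation mm: bounded_bilinear "(**) :: real ^ 'n ^ 'n \<Rightarrow> real ^ 'n ^ 'n \<Rightarrow> real ^ 'n ^ 'n"
  by (rule bounded_bilinear_matrix_mult)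

text \<open>The resolvent identity; it reduces every increment of \<open>Z\<close> to an increment
  of \<open>X\<close>.\<close>

lemma matrix_inverse_diff:
  assumes "s \<in> {a..b}" "t \<in> {a..b}"
  shows "Z t - Z s = Z t ** (X s - X t) ** Z s"
proof -
  have "Z t ** (X s - X t) ** Z s = Z t ** (X s ** Z s) - (Z t ** X t) ** Z s"
    by (simp only: mm.diff_left mm.diff_right matrix_mul_assoc)
  then show ?thesis using inv assms by simp
qed

lemma matrix_inverse_lipschitz:
  assumes st: "s \<in> {a..b}" "t \<in> {a..b}"
  shows "norm (Z t - Z s) \<le> N * C * N * \<bar>t - s\<bar>"
proof -
  have N: "N \<ge> 0" using bnd[OF st(1)] norm_ge_zero order_trans by blast
  have "norm (Z t - Z s) \<le> norm (Z t) * norm (X s - X t) * norm (Z s)"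
    unfolding matrix_inverse_diff[OF st]
    by (meson norm_matrix_mult_le mult_right_mono norm_ge_zero order_trans)
  also have "\<dots> \<le> N * (C * \<bar>t - s\<bar>) * N"
    using bnd[OF st(1)] bnd[OF st(2)] lip[OF st(2,1)] N
    by (intro mult_mono mult_nonneg_nonneg) (auto simp: abs_minus_commute C)
  finally show ?thesis by (simp add: mult_ac)
qed

text \<open>Exchanging \<open>Z s\<close> for \<open>Z t\<close> in the resolvent identity leaves
  the remainder \<open>E\<close>, a product of an increment of \<open>Z\<close> and one of
  \<open>X\<close>. Both are Lipschitz, so \<open>E\<close> is quadratic, and the main part is
  linear in \<open>X\<close>.\<close>

lemma has_vector_derivative_matrix_inverse:
  assumes t: "t \<in> {a..b}" and X': "(X has_vector_derivative X') (at t within {a..b})"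
  shows "(Z has_vector_derivative - (Z t ** X' ** Z t)) (at t within {a..b})"
proof -
  define E where "E s = (Z t - Z s) ** (X s - X t) ** Z t" for s
  have "(E has_vector_derivative 0) (at t within {a..b})"
  proof (rule has_vector_derivative_zero_of_quadratic[OF t])
    fix s assume s: "s \<in> {a..b}"
    have N: "N \<ge> 0" using bnd[OF t] norm_ge_zero order_trans by blast
    have "norm (E s) \<le> norm (Z t - Z s) * norm (X s - X t) * norm (Z t)"
      unfolding E_def by (meson norm_matrix_mult_le mult_right_mono norm_ge_zero order_trans)
    also have "\<dots> \<le> (N * C * N * \<bar>t - s\<bar>) * (C * \<bar>s - t\<bar>) * N"
      using matrix_inverse_lipschitz[OF s t] lip[OF t s] bnd[OF t] N
      by (intro mult_mono mult_nonneg_nonneg) (auto simp: C)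
    also have "\<dots> = (N * C * N * C * N) * (s - t)\<^sup>2"
      by (simp add: abs_minus_commute[of t s] power2_eq_square)
    finally show "norm (E s) \<le> (N * C * N * C * N) * (s - t)\<^sup>2" .
  qed
  moreover have "((\<lambda>s. Z t - Z t ** (X s - X t) ** Z t) has_vector_derivative - (Z t ** X' ** Z t)) (at t within {a..b})"
  proof -
    have "bounded_linear (\<lambda>M. Z t ** M ** Z t)"
      by (rule bounded_linear_compose[OF mm.bounded_linear_left mm.bounded_linear_right])
    moreover have "((\<lambda>s. X s - X t) has_vector_derivative X') (at t within {a..b})"
      using has_vector_derivative_diff[OF X' has_vector_derivative_const[of "X t"]] by simp
    ultimately have "((\<lambda>s. Z t ** (X s - X t) ** Z t) has_vector_derivative Z t ** X' ** Z t) (at t within {a..b})"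
      by (rule bounded_linear.has_vector_derivative)
    from has_vector_derivative_diff[OF has_vector_derivative_const[of "Z t"] this]
    show ?thesis by simp
  qed
  ultimately have "((\<lambda>s. (Z t - Z t ** (X s - X t) ** Z t) + E s) has_vector_derivative - (Z t ** X' ** Z t)) (at t within {a..b})"
    using has_vector_derivative_add by fastforce
  moreover have "Z s = (Z t - Z t ** (X s - X t) ** Z t) + E s" if s: "s \<in> {a..b}" for s
  proof -
    have "Z t - Z s = Z s ** (X s - X t) ** Z t"
      using matrix_inverse_diff[OF t s] mm.minus_left mm.minus_right
      by (metis minus_diff_eq)
    moreover have "E s = Z t ** (X s - X t) ** Z t - Z s ** (X s - X t) ** Z t"
      unfolding E_def by (simp only: mm.diff_left)
    moreover have "x = (y - p) + q" if "y - x = w" "q = p - w" for p q w x y :: "real ^ 'n ^ 'n"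
      using that by (auto simp: algebra_simps)
    ultimately show ?thesis by blast
  qed
  ultimately show ?thesis by (rule has_vector_derivative_transform[OF t, rotated])
qed

end

section \<open>From coercivity to a Riccati solution\<close>

context linear_quadratic
begin

text \<open>The linear Hamiltonian system of the problem, whose solution \<open>(X, Y)\<close> with terminal value
  \<open>(1, G)\<close> yields \<open>P = Y X\<inverse>\<close>.\<close>

theorem coercive_form_imp_riccati:
  assumes co: "coercive_form \<alpha>" and \<alpha>: "\<alpha> > 0"
  shows "\<exists>P. riccati_solution T A B Q S R G P"
proof -
  note R_ge = coercive_form_imp_R_ge[OF co]
  note J_AE = R_inv_AE[OF \<alpha> R_ge] and J_meas = R_inv_measurable[OF \<alpha> R_ge]
  define J where "J = R_inv \<alpha>"
  define r where "r = CARD('m) * (CARD('m) * (1 / \<alpha>))"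
  have r: "r \<ge> 0" using \<alpha> by (simp add: r_def)
  have J_le: "norm (J t) \<le> r" for t using R_inv_norm_le[OF \<alpha> R_ge] by (simp add: J_def r_def)
  \<comment> \<open>The control that makes the quadratic Hamiltonian stationary, R V + B^T y + S x =
    0, for all columns of the matrix system at once.\<close>
  define V where "V t x y = - (J t ** (transpose (B t) ** y + S t ** x))" for t and x y :: "real ^ 'n ^ 'n"
  define F where "F t z = (A t ** fst z + B t ** V t (fst z) (snd z),
      - (Q t ** fst z + transpose (A t) ** snd z + transpose (S t) ** V t (fst z) (snd z)))" for t z
  have V_diff: "V t x y - V t x' y' = V t (x - x') (y - y')" for t x y x' y'
    by (simp add: V_def bounded_bilinear.diff_right[OF bounded_bilinear_matrix_mult]
        bounded_bilinear.add_right[OF bounded_bilinear_matrix_mult])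
  \<comment> \<open>\<open>F t\<close> is linear, so the growth bound \<open>F_le\<close> is also
    its Lipschitz bound.\<close>
  have F_diff: "F t z - F t z' = F t (z - z')" for t z z'
    by (simp add: F_def bounded_bilinear.diff_right[OF bounded_bilinear_matrix_mult] flip: V_diff)
  have mult_le: "norm (M ** x) \<le> c * d"
    if "norm M \<le> c" "norm x \<le> d" for M :: "real ^ 'k::finite ^ 'l::finite" and x :: "real ^ 'n ^ 'k" and c d
  proof -
    have "norm M * norm x \<le> c * d" using that by (intro mult_mono) (auto intro: order_trans[OF norm_ge_zero])
    then show ?thesis using norm_matrix_mult_le[of M x] by linarith
  qed
  have V_le: "norm (V t x y) \<le> r * (2 * K * n)" if t: "t \<in> {0..T}" and "norm x \<le> n" "norm y \<le> n" for t x y n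
  proof -
    have "norm (transpose (B t) ** y) \<le> K * n" "norm (S t ** x) \<le> K * n"
      using that bounds[OF t] by (auto intro!: mult_le simp: norm_transpose)
    then have "norm (transpose (B t) ** y + S t ** x) \<le> 2 * K * n"
      using norm_triangle_ineq[of "transpose (B t) ** y" "S t ** x"] by linarith
    then show ?thesis unfolding V_def norm_minus_cancel by (intro mult_le J_le)
  qed
  \<comment> \<open>\<open>A\<close>, \<open>Q\<close> and the transpose of \<open>A\<close>
    contribute \<open>3 * K\<close>; each of the two terms containing \<open>V\<close> contributes
    \<open>2 * K * r * K\<close>.\<close>
  define L where "L = 3 * K + 4 * K * r * K"
  have L: "L > 0" using K r by (simp add: L_def add_pos_nonneg)
  have F_le: "norm (F t z) \<le> L * norm z" if t: "t \<in> {0..T}" for t z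
  proof -
    let ?n = "norm z"
    have xy: "norm (fst z) \<le> ?n" "norm (snd z) \<le> ?n"
      by (metis norm_fst_le prod.collapse, metis norm_snd_le prod.collapse)
    note v = V_le[OF t xy]
    have "norm (A t ** fst z) \<le> K * ?n" "norm (B t ** V t (fst z) (snd z)) \<le> K * (r * (2 * K * ?n))"
      "norm (Q t ** fst z) \<le> K * ?n" "norm (transpose (A t) ** snd z) \<le> K * ?n"
      "norm (transpose (S t) ** V t (fst z) (snd z)) \<le> K * (r * (2 * K * ?n))"
      using bounds[OF t] xy v by (simp_all add: mult_le norm_transpose)
    then have "norm (fst (F t z)) \<le> K * ?n + K * (r * (2 * K * ?n))"
      "norm (snd (F t z)) \<le> K * ?n + K * ?n + K * (r * (2 * K * ?n))"
      unfolding F_def fst_conv snd_conv norm_minus_cancel by (meson norm_triangle_mono)+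
    moreover have "norm (F t z) \<le> norm (fst (F t z)) + norm (snd (F t z))"
      by (metis norm_Pair_le prod.collapse)
    ultimately show ?thesis by (simp add: L_def algebra_simps)
  qed
  have F_meas: "(\<lambda>t. F t (z t)) \<in> borel_measurable \<mu>" if z: "continuous_on {0..T} z" for z
  proof -
    have x: "(\<lambda>t. fst (z t)) \<in> borel_measurable \<mu>" "(\<lambda>t. snd (z t)) \<in> borel_measurable \<mu>"
      by (intro continuous_on_measurable continuous_intros z)+
    show ?thesis
      unfolding F_def V_def J_def
      by (intro borel_measurable_Pair borel_measurable_add borel_measurable_uminus borel_measurable_matrix_intros
          A_meas B_meas Q_meas S_meas J_meas x)
  qed
  \<comment> \<open>The initial time of the existence theorem is taken at the right end
    \<open>T\<close>, where the data are prescribed.\<close>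
  obtain z C where zC: "\<And>s t. s \<in> {0..T} \<Longrightarrow> t \<in> {0..T} \<Longrightarrow> norm (z t - z s) \<le> C * \<bar>t - s\<bar>"
    and zF: "solves_ode T F z" and zT: "z T = (mat 1, G)"
  proof (rule caratheodory_lipschitz_ode_exists[of T T L F 0 "(mat 1, G)"])
    show "norm (F t x - F t y) \<le> L * norm (x - y)" if "t \<in> {0..T}" for t x y
      unfolding F_diff by (rule F_le[OF that])
    show "norm (F t 0) \<le> 0" if "t \<in> {0..T}" for t using F_le[OF that, of 0] by simp
  qed (use T L F_meas in auto)
  define X where "X t = fst (z t)" for t
  define Y where "Y t = snd (z t)" for t
  define U where "U t = V t (X t) (Y t)" for t
  have X_lip: "norm (X t - X s) \<le> C * \<bar>t - s\<bar>" and Y_lip: "norm (Y t - Y s) \<le> C * \<bar>t - s\<bar>"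
    if "s \<in> {0..T}" "t \<in> {0..T}" for s t
  proof -
    have "norm (fst (z t - z s)) \<le> norm (z t - z s)" "norm (snd (z t - z s)) \<le> norm (z t - z s)"
      by (metis norm_fst_le prod.collapse, metis norm_snd_le prod.collapse)
    then show "norm (X t - X s) \<le> C * \<bar>t - s\<bar>" "norm (Y t - Y s) \<le> C * \<bar>t - s\<bar>"
      using zC[OF that] by (simp_all add: X_def Y_def)
  qed
  have C: "C \<ge> 0"
    using order_trans[OF norm_ge_zero X_lip[of 0 T]] T by (simp add: zero_le_mult_iff)
  have XT: "X T = mat 1" and YT: "Y T = G" by (simp_all add: X_def Y_def zT)
  have X_cont: "continuous_on {0..T} X" and Y_cont: "continuous_on {0..T} Y"
    by (auto intro: abs_continuous_on_imp_continuous_on lipschitz_imp_abs_continuous_on X_lip Y_lip)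
  have U_meas: "U \<in> borel_measurable \<mu>"
    unfolding U_def V_def J_def
    by (intro borel_measurable_add borel_measurable_uminus borel_measurable_matrix_intros
        B_meas S_meas J_meas continuous_on_measurable X_cont Y_cont)
  obtain u where u: "\<And>t. t \<in> {0..T} \<Longrightarrow> norm (U t) \<le> u"
  proof -
    obtain x where x: "\<And>t. t \<in> {0..T} \<Longrightarrow> norm (X t) \<le> x" using continuous_on_bounded[OF X_cont] by blast
    obtain y where y: "\<And>t. t \<in> {0..T} \<Longrightarrow> norm (Y t) \<le> y" using continuous_on_bounded[OF Y_cont] by blast
    show thesis
    proof (rule that)
      fix t assume t: "t \<in> {0..T}"
      show "norm (U t) \<le> r * (2 * K * max x y)"
        unfolding U_def using x[OF t] y[OF t] by (intro V_le[OF t]) auto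
    qed
  qed
  \<comment> \<open>All facts that hold almost everywhere are collected here, so that the pointwise
    computations below refer to a single exceptional set.\<close>
  define good where "good t \<longleftrightarrow> t \<in> {0..T} \<and> R t ** J t = mat 1 \<and> J t = matrix_inv (R t)
    \<and> (X has_vector_derivative A t ** X t + B t ** U t) (at t within {0..T})
    \<and> (Y has_vector_derivative - (Q t ** X t + transpose (A t) ** Y t + transpose (S t) ** U t)) (at t within {0..T})" for t
  have good: "AE t in \<mu>. good t"
  proof -
    have "AE t in \<mu>. (z has_vector_derivative F t (z t)) (at t within {0..T})"
      using zF by (simp add: solves_ode_def)
    moreover have "AE t in \<mu>. t \<in> {0..T}" by (rule AE_I2) simp
    ultimately show ?thesis using J_AE
    proof eventually_elim
      case (elim t)
      have "(X has_vector_derivative fst (F t (z t))) (at t within {0..T})"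
        unfolding X_def[abs_def] by (rule bounded_linear.has_vector_derivative[OF bounded_linear_fst elim(1)])
      moreover have "(Y has_vector_derivative snd (F t (z t))) (at t within {0..T})"
        unfolding Y_def[abs_def] by (rule bounded_linear.has_vector_derivative[OF bounded_linear_snd elim(1)])
      moreover have "fst (F t (z t)) = A t ** X t + B t ** U t"
        "snd (F t (z t)) = - (Q t ** X t + transpose (A t) ** Y t + transpose (S t) ** U t)"
        by (simp_all only: F_def X_def Y_def U_def fst_conv snd_conv)
      ultimately show ?case
        using elim(2,3) unfolding good_def J_def by metis
    qed
  qed
  \<comment> \<open>For a vector \<open>c\<close>, the functions \<xi>, \<eta> and \<nu> are the
    state, costate and control of one trajectory of the Hamiltonian system; its state has the value
    \<open>c\<close> at time \<open>T\<close>.\<close>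
  define \<xi> where "\<xi> t c = X t *v c" for t c
  define \<eta> where "\<eta> t c = Y t *v c" for t c
  define \<nu> where "\<nu> t c = U t *v c" for t c
  have \<xi>_der: "((\<lambda>t. \<xi> t c) has_vector_derivative A t *v \<xi> t c + B t *v \<nu> t c) (at t within {0..T})"
    and \<eta>_der: "((\<lambda>t. \<eta> t c) has_vector_derivative
        - (Q t *v \<xi> t c + transpose (A t) *v \<eta> t c + transpose (S t) *v \<nu> t c)) (at t within {0..T})"
    and \<nu>_eq: "R t *v \<nu> t c = - (transpose (B t) *v \<eta> t c + S t *v \<xi> t c)"
    if "good t" for t c
  proof -
    interpret mv: bounded_bilinear "(*v) :: real ^ 'n ^ 'n \<Rightarrow> real ^ 'n \<Rightarrow> real ^ 'n"
      by (rule bounded_bilinear_matrix_vector_mult)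
    have x: "(X has_vector_derivative A t ** X t + B t ** U t) (at t within {0..T})"
      and y: "(Y has_vector_derivative - (Q t ** X t + transpose (A t) ** Y t + transpose (S t) ** U t)) (at t within {0..T})"
      and RJ: "R t ** J t = mat 1"
      using that by (auto simp: good_def)
    show "((\<lambda>t. \<xi> t c) has_vector_derivative A t *v \<xi> t c + B t *v \<nu> t c) (at t within {0..T})"
      using bounded_linear.has_vector_derivative[OF mv.bounded_linear_left x, of c]
      by (simp add: \<xi>_def \<nu>_def mv.add_left matrix_vector_mul_assoc)
    show "((\<lambda>t. \<eta> t c) has_vector_derivative
        - (Q t *v \<xi> t c + transpose (A t) *v \<eta> t c + transpose (S t) *v \<nu> t c)) (at t within {0..T})"
      using bounded_linear.has_vector_derivative[OF mv.bounded_linear_left y, of c]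
      by (simp add: \<xi>_def \<eta>_def \<nu>_def mv.add_left mv.diff_left mv.minus_left matrix_vector_mul_assoc del: transpose_matrix_vector)
    have "R t ** U t = - ((R t ** J t) ** (transpose (B t) ** Y t + S t ** X t))"
      by (simp add: U_def V_def matrix_mul_assoc bounded_bilinear.minus_right[OF bounded_bilinear_matrix_mult])
    then have "R t ** U t = - (transpose (B t) ** Y t + S t ** X t)" using RJ by simp
    then have "R t *v \<nu> t c = - (transpose (B t) ** Y t + S t ** X t) *v c"
      by (simp add: \<nu>_def matrix_vector_mul_assoc)
    then show "R t *v \<nu> t c = - (transpose (B t) *v \<eta> t c + S t *v \<xi> t c)"
      by (simp add: \<xi>_def \<eta>_def matrix_vector_mult_diff_rdistrib
          bounded_bilinear.minus_left[OF bounded_bilinear_matrix_vector_mult] matrix_vector_mul_assoc del: transpose_matrix_vector)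
  qed
  have \<xi>_lip: "norm (\<xi> t c - \<xi> s c) \<le> (C * norm c) * \<bar>t - s\<bar>" and \<eta>_lip: "norm (\<eta> t c - \<eta> s c) \<le> (C * norm c) * \<bar>t - s\<bar>"
    if "s \<in> {0..T}" "t \<in> {0..T}" for s t c
    using norm_mult_le[OF X_lip[OF that], of c] norm_mult_le[OF Y_lip[OF that], of c]
    by (simp_all add: \<xi>_def \<eta>_def matrix_vector_mult_diff_rdistrib mult_ac)
  \<comment> \<open>The symplectic pairing of two trajectories is constant in time because
    \<open>Q\<close> and \<open>R\<close> are symmetric, and it vanishes at \<open>T\<close> because
    \<open>G\<close> is. In terms of \<open>P\<close> this is the symmetry of
    \<open>P\<close>.\<close>
  have conj_sym: "\<xi> t c \<bullet> \<eta> t d = \<eta> t c \<bullet> \<xi> t d" if t: "t \<in> {0..T}" for t c d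
  proof -
    define \<omega> where "\<omega> t = \<xi> t c \<bullet> \<eta> t d - \<eta> t c \<bullet> \<xi> t d" for t
    have ac: "abs_continuous_on {0..T} (\<lambda>t. \<xi> t c)" "abs_continuous_on {0..T} (\<lambda>t. \<eta> t c)" for c
      by (auto intro: lipschitz_imp_abs_continuous_on \<xi>_lip \<eta>_lip)
    have "abs_continuous_on {0..T} \<omega>"
      unfolding \<omega>_def
    proof (rule abs_continuous_on_dominated)
      show "abs_continuous_on {0..T} (\<lambda>t. \<xi> t c \<bullet> \<eta> t d)" "abs_continuous_on {0..T} (\<lambda>t. \<eta> t c \<bullet> \<xi> t d)"
        by (intro abs_continuous_on_bilinear[OF bounded_bilinear_inner] ac)+
    qed (auto intro: order_trans[OF _ eq_refl[OF mult_1[symmetric]]])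
    then have ac\<omega>: "abs_continuous_on {t..T} \<omega>" by (rule abs_continuous_on_subset) (use t in auto)
    have der0: "(\<omega> has_vector_derivative 0) (at s within {0..T})" if s: "good s" for s
    proof -
      have sQ: "x \<bullet> (Q s *v y) = (Q s *v x) \<bullet> y" and sR: "a \<bullet> (R s *v b) = (R s *v a) \<bullet> b" for x y a b
        using symmetric_inner_commute[OF Q_sym] symmetric_inner_commute[OF R_sym] s by (auto simp: good_def)
      have "\<nu> s c \<bullet> (R s *v \<nu> s d) = (R s *v \<nu> s c) \<bullet> \<nu> s d" by (rule sR)
      then have e: "\<nu> s c \<bullet> (transpose (B s) *v \<eta> s d) + \<nu> s c \<bullet> (S s *v \<xi> s d) =
          \<nu> s d \<bullet> (transpose (B s) *v \<eta> s c) + \<nu> s d \<bullet> (S s *v \<xi> s c)"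
        unfolding \<nu>_eq[OF s]
        by (simp add: inner_diff_left inner_diff_right inner_commute algebra_simps del: transpose_matrix_vector)
      have "(\<omega> has_vector_derivative
         (\<xi> s c \<bullet> (- (Q s *v \<xi> s d + transpose (A s) *v \<eta> s d + transpose (S s) *v \<nu> s d))
           + (A s *v \<xi> s c + B s *v \<nu> s c) \<bullet> \<eta> s d)
         - (\<eta> s c \<bullet> (A s *v \<xi> s d + B s *v \<nu> s d)
           + (- (Q s *v \<xi> s c + transpose (A s) *v \<eta> s c + transpose (S s) *v \<nu> s c)) \<bullet> \<xi> s d)) (at s within {0..T})"
        unfolding \<omega>_def
        by (intro has_vector_derivative_diff bounded_bilinear.has_vector_derivative[OF bounded_bilinear_inner]
            \<xi>_der \<eta>_der s)
      moreover have "(\<xi> s c \<bullet> (- (Q s *v \<xi> s d + transpose (A s) *v \<eta> s d + transpose (S s) *v \<nu> s d))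
           + (A s *v \<xi> s c + B s *v \<nu> s c) \<bullet> \<eta> s d)
         - (\<eta> s c \<bullet> (A s *v \<xi> s d + B s *v \<nu> s d)
           + (- (Q s *v \<xi> s c + transpose (A s) *v \<eta> s c + transpose (S s) *v \<nu> s c)) \<bullet> \<xi> s d) = 0"
        using e sQ[of "\<xi> s c" "\<xi> s d"]
        by (simp add: inner_add_left inner_add_right inner_diff_left inner_diff_right inner_transpose_mult inner_commute[of "transpose M *v x" for M x]
             inner_commute[of "\<eta> s c"] inner_commute[of "\<nu> s d" "S s *v _"] inner_commute[of "\<nu> s c" "S s *v _"] del: transpose_matrix_vector)
      ultimately show ?thesis by simp
    qed
    have "negligible {s \<in> {0..T}. \<not> good s}"
      using good by (subst (asm) AE_lebesgue_on_iff_negligible) auto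
    moreover have "{s \<in> {t..T}. \<not> (\<omega> has_vector_derivative 0) (at s within {t..T})} \<subseteq> {s \<in> {0..T}. \<not> good s}"
      using has_vector_derivative_within_subset[OF der0, of _ "{t..T}"] t by auto
    ultimately have "negligible {s \<in> {t..T}. \<not> (\<omega> has_vector_derivative 0) (at s within {t..T})}"
      by (rule negligible_subset)
    then have "AE s in lebesgue_on {t..T}. (\<omega> has_vector_derivative 0) (at s within {t..T})"
      by (subst AE_lebesgue_on_iff_negligible) auto
    then have "((\<lambda>_. 0) has_integral (\<omega> T - \<omega> t)) {t..T}"
      using t by (intro abs_continuous_on_has_integral ac\<omega>) auto
    then have "\<omega> T - \<omega> t = 0" using has_integral_unique has_integral_0 by blast
    moreover have "\<omega> T = 0"
      using symmetric_inner_commute[OF G_sym, of c d] by (simp add: \<omega>_def \<xi>_def \<eta>_def XT YT)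
    ultimately show ?thesis by (simp add: \<omega>_def)
  qed
  have X_inj: "c = 0" if s: "s \<in> {0..T}" and Xc: "X s *v c = 0" for s c
  proof -
    define y where "y t = \<xi> (max s t) c" for t
    \<comment> \<open>The costate is frozen at its value at \<open>s\<close>, since setting it to
      zero would create a jump. As \<open>y\<close> vanishes up to \<open>s\<close>, the product
      \<open>y \<bullet> e\<close> vanishes there all the same.\<close>
    define e where "e t = \<eta> (max s t) c" for t
    define v where "v t = indicator {s..T} t *\<^sub>R \<nu> t c" for t
    have y_lip: "norm (y t' - y t) \<le> (C * norm c) * \<bar>t' - t\<bar>" and e_lip: "norm (e t' - e t) \<le> (C * norm c) * \<bar>t' - t\<bar>"
      if "t \<in> {0..T}" "t' \<in> {0..T}" for t t'
    proof -
      have "(C * norm c) * \<bar>max s t' - max s t\<bar> \<le> (C * norm c) * \<bar>t' - t\<bar>"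
        using C by (intro mult_left_mono) auto
      moreover have "max s t \<in> {0..T}" "max s t' \<in> {0..T}" using s that by auto
      ultimately show "norm (y t' - y t) \<le> (C * norm c) * \<bar>t' - t\<bar>" "norm (e t' - e t) \<le> (C * norm c) * \<bar>t' - t\<bar>"
        unfolding y_def e_def using \<xi>_lip[of "max s t" "max s t'" c] \<eta>_lip[of "max s t" "max s t'" c] by linarith+
    qed
    have y_ac: "abs_continuous_on {0..T} y" and e_ac: "abs_continuous_on {0..T} e"
      by (auto intro: lipschitz_imp_abs_continuous_on y_lip e_lip)
    have y_cont: "continuous_on {0..T} y" by (rule abs_continuous_on_imp_continuous_on[OF y_ac])
    have y_before: "y t = 0" "v t = 0" if "t < s" for t
      using that Xc by (simp_all add: y_def v_def \<xi>_def max_def)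
    have y_after: "y t = \<xi> t c" "e t = \<eta> t c" if "t > s" for t
      using that by (simp_all add: y_def e_def max_def)
    have v_after: "v t = \<nu> t c" if "t > s" "t \<in> {0..T}" for t
      using that by (simp add: v_def)
    have v_meas: "v \<in> borel_measurable \<mu>"
    proof -
      have "(indicator {s..T} :: real \<Rightarrow> real) \<in> borel_measurable \<mu>"
        by (intro measurable_restrict_space1 borel_measurable_indicator) simp
      then show ?thesis
        unfolding v_def \<nu>_def by (intro borel_measurable_scaleR borel_measurable_matrix_intros U_meas) auto
    qed
    have v_le: "norm (v t) \<le> u * norm c" if "t \<in> {0..T}" for t
      using norm_mult_le[OF u[OF that], of c] norm_ge_zero[of "\<nu> t c"]
      by (auto simp: v_def \<nu>_def indicator_def intro: order_trans[OF norm_ge_zero])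
    have v_L2: "v \<in> L2 T"
    proof -
      have "integrable \<mu> (\<lambda>t. (norm (v t))\<^sup>2)"
      proof (rule integrable_lebesgue_on_bounded[where g = "\<lambda>_. 0"])
        show "norm ((norm (v t))\<^sup>2) \<le> (u * norm c)\<^sup>2 + 0 * 0" if "t \<in> {0..T}" for t
          using power_mono[OF v_le[OF that], of 2] by simp
      qed (use v_meas in auto)
      then show ?thesis using v_meas by (simp add: L2_def)
    qed
    have "negligible {t \<in> {0..T}. \<not> good t}"
      using good by (subst (asm) AE_lebesgue_on_iff_negligible) auto
    then have "negligible ({t \<in> {0..T}. \<not> good t} \<union> {s})" by (intro negligible_Un) auto
    then have "negligible {t \<in> {0..T}. \<not> (good t \<and> t \<noteq> s)}"
      by (rule negligible_subset) blast
    then have good': "AE t in \<mu>. good t \<and> t \<noteq> s"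
      by (subst AE_lebesgue_on_iff_negligible) auto
    \<comment> \<open>Away from \<open>s\<close>, a neighbourhood of \<open>t\<close> stays on one
      side of \<open>s\<close>, so the derivative may be computed from the formula valid on that
      side.\<close>
    have local: "(f has_vector_derivative f') (at t within {0..T})"
      if "(g has_vector_derivative f') (at t within {0..T})" and "t \<in> {0..T}" and "t \<noteq> s"
        and "\<And>t'. (t' < s \<longleftrightarrow> t < s) \<Longrightarrow> t' \<noteq> s \<Longrightarrow> g t' = f t'" for f g :: "real \<Rightarrow> 'b::real_normed_vector" and f' t
    proof (rule has_vector_derivative_transform_within[OF that(1), of "\<bar>t - s\<bar>"])
      fix t' assume "t' \<in> {0..T}" "dist t' t < \<bar>t - s\<bar>"
      then show "g t' = f t'" by (intro that(4)) (auto simp: dist_real_def)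
    qed (use that in auto)
    have "solves_ode T (\<lambda>t \<eta>. A t *v \<eta> + B t *v v t) y"
      unfolding solves_ode_def
    proof
      show "AE t in \<mu>. (y has_vector_derivative A t *v y t + B t *v v t) (at t within {0..T})"
        using good'
      proof eventually_elim
        case (elim t)
        then have t: "t \<in> {0..T}" "t \<noteq> s" and g: "good t" by (auto simp: good_def)
        show ?case
        proof (cases "t < s")
          case True
          show ?thesis
            by (rule local[of "\<lambda>_. 0", OF _ t]) (use True y_before in simp_all)
        next
          case False
          then have "A t *v y t + B t *v v t = A t *v \<xi> t c + B t *v \<nu> t c"
            using t y_after v_after by simp
          then have d: "((\<lambda>t. \<xi> t c) has_vector_derivative A t *v y t + B t *v v t) (at t within {0..T})"
            using \<xi>_der[OF g, of c] by simp
          show ?thesis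
            by (rule local[of "\<lambda>t. \<xi> t c", OF d t]) (use False y_after in simp)
        qed
      qed
    qed (rule y_ac)
    moreover have "y 0 = 0" using s Xc by (simp add: y_def \<xi>_def)
    ultimately have ls: "lin_state v y" by (simp add: lin_state_def)
    \<comment> \<open>Its derivative is minus the quadratic integrand, and it runs from 0 to the
      terminal cost; this is why the total cost of the truncated trajectory is zero.\<close>
    define \<psi> where "\<psi> t = y t \<bullet> e t" for t
    have \<psi>_ac: "abs_continuous_on {0..T} \<psi>"
      unfolding \<psi>_def by (intro abs_continuous_on_bilinear[OF bounded_bilinear_inner] y_ac e_ac)
    have "AE t in \<mu>. (\<psi> has_vector_derivative - form t (y t) (v t)) (at t within {0..T})"
      using good'
    proof eventually_elim
      case (elim t)
      then have t: "t \<in> {0..T}" "t \<noteq> s" and g: "good t" by (auto simp: good_def)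
      show ?case
      proof (cases "t < s")
        case True
        then have f0: "form t (y t) (v t) = 0" using y_before by (simp add: form_def)
        show ?thesis
          by (rule local[of "\<lambda>_. 0", OF _ t]) (use True y_before f0 in \<open>simp_all add: \<psi>_def\<close>)
      next
        case False
        have d: "((\<lambda>t. \<xi> t c \<bullet> \<eta> t c) has_vector_derivative
            (\<xi> t c \<bullet> (- (Q t *v \<xi> t c + transpose (A t) *v \<eta> t c + transpose (S t) *v \<nu> t c))
              + (A t *v \<xi> t c + B t *v \<nu> t c) \<bullet> \<eta> t c)) (at t within {0..T})"
          by (intro bounded_bilinear.has_vector_derivative[OF bounded_bilinear_inner] \<xi>_der \<eta>_der g)
        have "\<nu> t c \<bullet> (R t *v \<nu> t c) = - ((B t *v \<nu> t c) \<bullet> \<eta> t c + \<nu> t c \<bullet> (S t *v \<xi> t c))"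
          unfolding \<nu>_eq[OF g] by (simp add: inner_diff_right inner_transpose_mult del: transpose_matrix_vector)
        then have "\<xi> t c \<bullet> (- (Q t *v \<xi> t c + transpose (A t) *v \<eta> t c + transpose (S t) *v \<nu> t c))
              + (A t *v \<xi> t c + B t *v \<nu> t c) \<bullet> \<eta> t c = - form t (\<xi> t c) (\<nu> t c)"
          by (simp add: form_def inner_add_right inner_add_left inner_diff_right inner_transpose_mult
              inner_commute[of "S t *v _"] del: transpose_matrix_vector)
        moreover have "form t (y t) (v t) = form t (\<xi> t c) (\<nu> t c)"
          using False t y_after v_after by simp
        ultimately have d': "((\<lambda>t. \<xi> t c \<bullet> \<eta> t c) has_vector_derivative - form t (y t) (v t)) (at t within {0..T})"
          using d by simp
        show ?thesis
          by (rule local[of "\<lambda>t. \<xi> t c \<bullet> \<eta> t c", OF d' t]) (use False y_after in \<open>simp add: \<psi>_def\<close>)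
      qed
    qed
    then have "((\<lambda>t. - form t (y t) (v t)) has_integral (\<psi> T - \<psi> 0)) {0..T}"
      using T by (intro abs_continuous_on_has_integral \<psi>_ac) auto
    then have "(LINT t|\<mu>. - form t (y t) (v t)) = \<psi> T - \<psi> 0"
      using form_integrable[OF y_cont v_L2] by (intro has_integral_lebesgue_on_eq) auto
    moreover have "y T = c" "\<psi> T = c \<bullet> (G *v c)" "\<psi> 0 = 0"
      using s \<open>y 0 = 0\<close> by (simp_all add: \<psi>_def y_def e_def \<xi>_def \<eta>_def XT YT max_def)
    ultimately have "(LINT t|\<mu>. form t (y t) (v t)) + y T \<bullet> (G *v y T) = 0"
      by simp
    then have "\<alpha> * (L2_norm T v)\<^sup>2 \<le> 0"
      using co[unfolded coercive_form_def, rule_format, OF v_L2 ls] by simp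
    then have "(LINT t|\<mu>. (norm (v t))\<^sup>2) \<le> 0"
      using \<alpha> by (simp add: L2_norm_def mult_le_0_iff)
    moreover have "(LINT t|\<mu>. norm (v t))\<^sup>2 \<le> T * (LINT t|\<mu>. (norm (v t))\<^sup>2)"
      using v_L2 by (intro lebesgue_integral_norm_squared_le(2) T) (auto simp: L2_def)
    ultimately have "(LINT t|\<mu>. norm (v t))\<^sup>2 \<le> 0"
      using T by (smt (verit) mult_nonneg_nonpos)
    then have "(LINT t|\<mu>. norm (v t)) = 0" by simp
    \<comment> \<open>The state bound is proportional to the integral of the norm of
      \<open>v\<close>, which has just been shown to vanish.\<close>
    then have "norm (y T) \<le> 0" using lin_state_norm_le[OF ls v_L2, of T] T by simp
    then show "c = 0" using \<open>y T = c\<close> by simp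
  qed
  \<comment> \<open>The minimum of a continuous positive function on a compact set. It bounds the
    inverse of \<open>X\<close> uniformly in time, and this bound makes the inverse
    Lipschitz.\<close>
  obtain \<kappa> where \<kappa>: "\<kappa> > 0" "\<And>t c. t \<in> {0..T} \<Longrightarrow> \<kappa> * norm c \<le> norm (X t *v c)"
  proof -
    let ?D = "{0..T} \<times> sphere (0 :: real ^ 'n) 1"
    have "axis undefined 1 \<in> sphere (0 :: real ^ 'n) 1" by simp
    then have ne: "?D \<noteq> {}" using T by fastforce
    have comp: "compact ?D" by (intro compact_Times compact_Icc compact_sphere)
    have "continuous_on ?D (\<lambda>q. norm (X (fst q) *v snd q))"
      by (intro continuous_on_norm bounded_bilinear.continuous_on[OF bounded_bilinear_matrix_vector_mult]
          continuous_on_compose2[OF X_cont] continuous_intros) auto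
    then obtain q where q: "q \<in> ?D" "\<And>q'. q' \<in> ?D \<Longrightarrow> norm (X (fst q) *v snd q) \<le> norm (X (fst q') *v snd q')"
      using continuous_attains_inf[OF comp ne] by blast
    show thesis
    proof (rule that)
      have "snd q \<noteq> 0" "fst q \<in> {0..T}" using q(1) by auto
      then show "norm (X (fst q) *v snd q) > 0" using X_inj by auto
      fix t c assume t: "t \<in> {0..T}"
      show "norm (X (fst q) *v snd q) * norm c \<le> norm (X t *v c)"
      proof (cases "c = 0")
        case False
        have "norm (X (fst q) *v snd q) \<le> norm (X t *v (c /\<^sub>R norm c))"
          using q(2)[of "(t, c /\<^sub>R norm c)"] t False by simp
        also have "\<dots> = norm (X t *v c) / norm c"
          by (simp add: matrix_vector_mult_scaleR divide_inverse mult.commute)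
        finally show ?thesis using False by (simp add: field_simps)
      qed simp
    qed
  qed
  define Z where "Z t = matrix_inv (X t)" for t
  have XZ: "X t ** Z t = mat 1" and ZX: "Z t ** X t = mat 1"
    and Z_le: "norm (Z t) \<le> CARD('n) * (CARD('n) * (1 / \<kappa>))" if t: "t \<in> {0..T}" for t
    using matrix_inv_of_bounded_below[OF \<kappa>(1) \<kappa>(2)[OF t]] norm_matrix_le_of_vectors[of "Z t" "1 / \<kappa>"]
    by (auto simp: Z_def)
  define N where "N = CARD('n) * (CARD('n) * (1 / \<kappa>))"
  have Z_lip: "norm (Z t - Z s) \<le> N * C * N * \<bar>t - s\<bar>" if "s \<in> {0..T}" "t \<in> {0..T}" for s t
    by (rule matrix_inverse_lipschitz[where X = X and a = 0 and b = T])
      (use C X_lip XZ ZX Z_le that in \<open>auto simp: N_def\<close>)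
  have Z_der: "(Z has_vector_derivative - (Z t ** X' ** Z t)) (at t within {0..T})"
    if "t \<in> {0..T}" "(X has_vector_derivative X') (at t within {0..T})" for t X'
    by (rule has_vector_derivative_matrix_inverse[where X = X and C = C and N = N])
      (use C X_lip XZ ZX Z_le that in \<open>auto simp: N_def\<close>)
  define P where "P t = Y t ** Z t" for t
  have Z_ac: "abs_continuous_on {0..T} Z" by (rule lipschitz_imp_abs_continuous_on[OF Z_lip])
  have Y_ac: "abs_continuous_on {0..T} Y" by (rule lipschitz_imp_abs_continuous_on[OF Y_lip])
  have P_ac: "abs_continuous_on {0..T} P"
    unfolding P_def by (rule abs_continuous_on_bilinear[OF bounded_bilinear_matrix_mult Y_ac Z_ac])
  have P_sym: "transpose (P t) = P t" if t: "t \<in> {0..T}" for t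
  proof (rule symmetricI)
    fix x y :: "real ^ 'n"
    have "\<xi> t (Z t *v x) = x" for x using XZ[OF t] by (simp add: \<xi>_def matrix_vector_mul_assoc)
    moreover have "\<eta> t (Z t *v x) = P t *v x" for x by (simp add: \<eta>_def P_def matrix_vector_mul_assoc)
    ultimately show "x \<bullet> (P t *v y) = (P t *v x) \<bullet> y"
      using conj_sym[OF t, of "Z t *v x" "Z t *v y"] by simp
  qed
  have P_ode: "\<exists>P'. (P has_vector_derivative P') (at t within {0..T}) \<and>
        P' + P t ** A t + transpose (A t) ** P t + Q t
          - transpose (transpose (B t) ** P t + S t) ** matrix_inv (R t)
              ** (transpose (B t) ** P t + S t) = 0" if g: "good t" for t
  proof -
    have t: "t \<in> {0..T}" and RJ: "matrix_inv (R t) = J t"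
      and X': "(X has_vector_derivative A t ** X t + B t ** U t) (at t within {0..T})"
      and Y': "(Y has_vector_derivative - (Q t ** X t + transpose (A t) ** Y t + transpose (S t) ** U t)) (at t within {0..T})"
      using g by (auto simp: good_def)
    define \<Phi> where "\<Phi> = transpose (B t) ** P t + S t"
    \<comment> \<open>In terms of \<open>P\<close> the control becomes the Riccati feedback; this
      produces the quadratic term of the equation.\<close>
    have UZ: "U t ** Z t = - (J t ** \<Phi>)"
    proof -
      have "U t ** Z t = - (J t ** (transpose (B t) ** (Y t ** Z t) + S t ** (X t ** Z t)))"
        by (simp add: U_def V_def bounded_bilinear.minus_left[OF bounded_bilinear_matrix_mult]
            bounded_bilinear.diff_left[OF bounded_bilinear_matrix_mult]
            matrix_mult_add_rdistrib matrix_add_ldistrib matrix_mul_assoc)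
      then show ?thesis using XZ[OF t] by (simp add: \<Phi>_def P_def)
    qed
    have \<Phi>T: "transpose \<Phi> = P t ** B t + transpose (S t)"
      using P_sym[OF t] by (simp add: \<Phi>_def linear_add[OF bounded_linear.linear[OF bounded_linear_transpose]] matrix_transpose_mul)
    define P' where "P' = Y t ** - (Z t ** (A t ** X t + B t ** U t) ** Z t)
        + - (Q t ** X t + transpose (A t) ** Y t + transpose (S t) ** U t) ** Z t"
    have "(P has_vector_derivative P') (at t within {0..T})"
      unfolding P_def P'_def
      by (intro bounded_bilinear.has_vector_derivative[OF bounded_bilinear_matrix_mult] Y' Z_der[OF t X'])
    moreover have "P' = - (P t ** (A t ** (X t ** Z t) + B t ** (U t ** Z t)))
        - (Q t ** (X t ** Z t) + transpose (A t) ** P t + transpose (S t) ** (U t ** Z t))"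
      by (simp add: P'_def P_def bounded_bilinear.minus_left[OF bounded_bilinear_matrix_mult]
          bounded_bilinear.minus_right[OF bounded_bilinear_matrix_mult]
          bounded_bilinear.diff_left[OF bounded_bilinear_matrix_mult]
          bounded_bilinear.diff_right[OF bounded_bilinear_matrix_mult]
          matrix_mult_add_rdistrib matrix_add_ldistrib matrix_mul_assoc)
    then have "P' = - (P t ** A t) + (P t ** B t) ** (J t ** \<Phi>) - Q t - transpose (A t) ** P t + transpose (S t) ** (J t ** \<Phi>)"
      unfolding XZ[OF t] UZ
      by (simp add: bounded_bilinear.minus_right[OF bounded_bilinear_matrix_mult] matrix_add_ldistrib matrix_mul_assoc
          bounded_bilinear.diff_right[OF bounded_bilinear_matrix_mult])
    then have "P' + P t ** A t + transpose (A t) ** P t + Q t - transpose \<Phi> ** J t ** \<Phi> = 0"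
      unfolding \<Phi>T by (simp add: matrix_mult_add_rdistrib matrix_mul_assoc)
    ultimately show ?thesis unfolding RJ \<Phi>_def by blast
  qed
  have "Z T = mat 1" using XZ[of T] T by (simp add: XT)
  then have "riccati_solution T A B Q S R G P"
    unfolding riccati_solution_def
    using P_ac P_sym eventually_mono[OF good P_ode] by (simp add: P_def YT)
  then show ?thesis by blast
qed

end

section \<open>The Hamiltonian of the control problem\<close>

lemma sym_matrix_le_scaleR_mat:
  assumes "transpose M = M"
  shows "sym_matrix_le (c *\<^sub>R mat 1) M \<longleftrightarrow> (\<forall>w. c * (norm w)\<^sup>2 \<le> w \<bullet> (M *v w))"
  using assms by (simp add: sym_matrix_le_def transpose_scalar scaleR_matrix_vector_assoc[symmetric] power2_norm_eq_inner)

lemma linear_norm_bound: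
  fixes h :: "'a::euclidean_space \<Rightarrow> 'b::real_normed_vector"
  assumes "linear h"
  obtains k where "k \<ge> 0" "\<And>x. norm (h x) \<le> k * norm x"
  using linear_bounded_pos[OF assms] by (metis less_imp_le)

text \<open>Along the reference trajectory the second-order coefficients are blocks of one matrix,
  the joint Hessian of the Hamiltonian. Once that matrix is known to be measurable, bounded and
  symmetric, the results on the linear-quadratic problem apply.\<close>

theorem theorem4p7:
  fixes T :: real and x0 :: "real ^ 'n::finite"
    and b :: "real \<Rightarrow> real ^ 'n \<Rightarrow> real ^ 'm::finite \<Rightarrow> real ^ 'n"
    and f :: "real \<Rightarrow> real ^ 'n \<Rightarrow> real ^ 'm \<Rightarrow> real"
    and g :: "real ^ 'n \<Rightarrow> real"
    and ubar :: "real \<Rightarrow> real ^ 'm"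
    and xbar pbar :: "real \<Rightarrow> real ^ 'n"
  assumes "T > 0"
    and "standing_assumptions T b f g"
    and "optimal_control T x0 b f g ubar"
    and "is_state T x0 b ubar xbar"
    and "is_adjoint T b f g ubar xbar pbar"
  shows "((\<exists>\<alpha>>0. coercive T b f g ubar xbar pbar \<alpha>) \<longleftrightarrow>
           has_strongly_regular_solution T
             (\<lambda>t. jac_x (b t) (xbar t) (ubar t))
             (\<lambda>t. jac_u (b t) (xbar t) (ubar t))
             (\<lambda>t. H_xx b f t (xbar t) (ubar t) (pbar t))
             (\<lambda>t. H_ux b f t (xbar t) (ubar t) (pbar t))
             (\<lambda>t. H_uu b f t (xbar t) (ubar t) (pbar t))
             (hessian g (xbar T)))
       \<and> (\<forall>\<alpha>>0. coercive T b f g ubar xbar pbar \<alpha> \<longrightarrow>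
           (AE t in lebesgue_on {0..T}.
              sym_matrix_le (\<alpha> *\<^sub>R mat 1) (H_uu b f t (xbar t) (ubar t) (pbar t))))"
proof -
  let ?M = "lebesgue_on {0..T}"
  define \<zeta> where "\<zeta> t = join (xbar t) (ubar t)" for t
  \<comment> \<open>Scalar components in the joint variable, the form in which gradients and
    Hessians are available.\<close>
  define bi where "bi i t = on_join (\<lambda>x u. b t x u $ i)" for i t
  have b_meas: "(\<lambda>(t, x, u). b t x u) \<in> borel_measurable (lebesgue_on ({0..T} \<times> UNIV))"
    and f_meas: "(\<lambda>(t, x, u). f t x u) \<in> borel_measurable (lebesgue_on ({0..T} \<times> UNIV))"
    and b_td: "\<And>t i. t \<in> {0..T} \<Longrightarrow> twice_differentiable (bi i t)"
    and f_td: "\<And>t. t \<in> {0..T} \<Longrightarrow> twice_differentiable (on_join (f t))"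
    and g_td: "twice_differentiable g"
    using assms(2) by (auto simp: standing_assumptions_def bi_def)
  obtain L where L: "L > 0"
    and jac_le: "\<And>t x u. t \<in> {0..T} \<Longrightarrow> norm (jac_x (b t) x u) + norm (jac_u (b t) x u) \<le> L"
    and b_hess_le: "\<And>t x u. t \<in> {0..T} \<Longrightarrow> norm (hessian_xu_vec (b t) x u) \<le> L"
    and f_hess_le: "\<And>t x u. t \<in> {0..T} \<Longrightarrow> norm (hessian_xu (f t) x u) \<le> L"
  proof -
    from assms(2) obtain L where "L > 0" and *: "\<forall>t\<in>{0..T}. \<forall>x x' u u'.
        norm (b t x u) \<le> L * (norm x + norm u + 1) \<and>
        norm (jac_x (b t) x u) + norm (jac_u (b t) x u) \<le> L \<and>
        norm (hessian_xu_vec (b t) x u) \<le> L \<and>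
        norm (hessian_xu_vec (b t) x u - hessian_xu_vec (b t) x' u')
          \<le> L * (norm (x - x') + norm (u - u')) \<and>
        \<bar>f t x u\<bar> \<le> L * ((norm x)\<^sup>2 + (norm u)\<^sup>2 + 1) \<and>
        norm (grad_x (f t) x u) + norm (grad_u (f t) x u) \<le> L * (norm x + norm u + 1) \<and>
        norm (hessian_xu (f t) x u) \<le> L \<and>
        norm (hessian_xu (f t) x u - hessian_xu (f t) x' u')
          \<le> L * (norm (x - x') + norm (u - u')) \<and>
        \<bar>g x\<bar> \<le> L * ((norm x)\<^sup>2 + 1) \<and>
        norm (grad g x) \<le> L * (norm x + 1) \<and>
        norm (hessian g x) \<le> L \<and>
        norm (hessian g x - hessian g x') \<le> L * norm (x - x')"
      unfolding standing_assumptions_def by blast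
    show thesis by (rule that[OF \<open>L > 0\<close>]) (use * in blast)+
  qed
  \<comment> \<open>Joint Lebesgue measurability alone does not make every section measurable; the
    continuity contained in twice differentiability does.\<close>
  have on_join_meas: "(\<lambda>t. on_join (\<phi> t) z) \<in> borel_measurable ?M"
    if m: "(\<lambda>(t, x, u). \<phi> t x u) \<in> borel_measurable (lebesgue_on ({0..T} \<times> UNIV))"
      and td: "\<And>t. t \<in> {0..T} \<Longrightarrow> twice_differentiable (on_join (\<phi> t))"
    for \<phi> :: "real \<Rightarrow> real ^ 'n \<Rightarrow> real ^ 'm \<Rightarrow> real" and z
  proof -
    have "(\<lambda>t. (\<lambda>(x, u). \<phi> t x u) (\<chi> i. z $ Inl i, \<chi> j. z $ Inr j)) \<in> borel_measurable ?M"
    proof (rule borel_measurable_section)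
      show "(\<lambda>(t, p). (\<lambda>(x, u). \<phi> t x u) p) \<in> borel_measurable (lebesgue_on ({0..T} \<times> UNIV))"
        using m by (simp add: split_def)
      fix t assume "t \<in> {0..T}"
      then have "continuous_on UNIV (on_join (\<phi> t))"
        using td by (auto simp: twice_differentiable_def differentiable_on_def intro!: differentiable_imp_continuous_on)
      then have "continuous_on UNIV (\<lambda>p. on_join (\<phi> t) (case p of (x, u) \<Rightarrow> join x u))"
        by (rule continuous_on_compose2) (auto intro: linear_continuous_on bounded_linear_join)
      then show "continuous_on UNIV (\<lambda>(x, u). \<phi> t x u)" by (simp add: split_def)
    qed
    then show ?thesis by (simp add: on_join_def)
  qed
  have x_cont: "continuous_on {0..T} xbar"
    using assms(4) by (auto simp: is_state_def solves_ode_def intro: abs_continuous_on_imp_continuous_on)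
  have p_cont: "continuous_on {0..T} pbar"
    using assms(5) by (auto simp: is_adjoint_def solves_ode_def intro: abs_continuous_on_imp_continuous_on)
  have x_meas: "xbar \<in> borel_measurable ?M" and p_meas: "pbar \<in> borel_measurable ?M"
    using x_cont p_cont by (auto intro: continuous_imp_measurable_on_sets_lebesgue)
  have u_meas: "ubar \<in> borel_measurable ?M"
    using assms(3) by (simp add: optimal_control_def L2_def)
  have \<zeta>_meas: "\<zeta> \<in> borel_measurable ?M"
    using borel_measurable_linear[OF bounded_linear_join borel_measurable_Pair[OF x_meas u_meas]]
    by (simp add: \<zeta>_def[abs_def])
  have bi_meas: "(\<lambda>t. bi i t z) \<in> borel_measurable ?M" for i z
  proof -
    have "(\<lambda>(t, x, u). b t x u $ i) \<in> borel_measurable (lebesgue_on ({0..T} \<times> UNIV))"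
      using borel_measurable_vec_nth[OF b_meas, of i] by (simp add: split_def)
    then show ?thesis unfolding bi_def by (rule on_join_meas) (use b_td in \<open>simp add: bi_def\<close>)
  qed
  have grad_meas: "(\<lambda>t. grad (bi i t) (\<zeta> t)) \<in> borel_measurable ?M" for i
    by (rule borel_measurable_grad[OF bi_meas _ \<zeta>_meas]) (use b_td in simp)
  have hb_meas: "(\<lambda>t. hessian (bi i t) (\<zeta> t)) \<in> borel_measurable ?M" for i
    by (rule borel_measurable_hessian[OF bi_meas _ \<zeta>_meas]) (use b_td in simp)
  have hf_meas: "(\<lambda>t. hessian (on_join (f t)) (\<zeta> t)) \<in> borel_measurable ?M"
    by (rule borel_measurable_hessian[OF on_join_meas[OF f_meas f_td] _ \<zeta>_meas]) (use f_td in simp_all)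
  \<comment> \<open>The joint Hessian of the Hamiltonian with the adjoint frozen at time
    \<open>t\<close>, written so that its measurability in \<open>t\<close> is visible.\<close>
  define H where "H t = (\<Sum>i\<in>UNIV. pbar t $ i *\<^sub>R hessian (bi i t) (\<zeta> t)) + hessian (on_join (f t)) (\<zeta> t)" for t
  have H_meas: "H \<in> borel_measurable ?M"
    unfolding H_def
    by (intro borel_measurable_add borel_measurable_sum borel_measurable_scaleR borel_measurable_vec_nth
        p_meas hb_meas hf_meas)
  have ham: "twice_differentiable (on_join (\<lambda>x u. hamiltonian b f t x u (pbar t)))"
    and H_full: "H_xu_full b f t (xbar t) (ubar t) (pbar t) = H t"
    and Q_eq: "H_xx b f t (xbar t) (ubar t) (pbar t) = block_xx (H t)"
    and S_eq: "H_ux b f t (xbar t) (ubar t) (pbar t) = transpose (block_xu (H t))"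
    and R_eq: "H_uu b f t (xbar t) (ubar t) (pbar t) = block_uu (H t)"
    if t: "t \<in> {0..T}" for t
  proof -
    note lc = linear_combination_hessian[OF b_td[OF t] f_td[OF t]]
    show td: "twice_differentiable (on_join (\<lambda>x u. hamiltonian b f t x u (pbar t)))"
      unfolding on_join_hamiltonian bi_def[symmetric] by (rule lc(1))
    show full: "H_xu_full b f t (xbar t) (ubar t) (pbar t) = H t"
      unfolding H_xu_full_def hessian_xu_def on_join_hamiltonian bi_def[symmetric] H_def \<zeta>_def by (rule lc(2))
    show "H_xx b f t (xbar t) (ubar t) (pbar t) = block_xx (H t)"
      "H_uu b f t (xbar t) (ubar t) (pbar t) = block_uu (H t)"
      "H_ux b f t (xbar t) (ubar t) (pbar t) = transpose (block_xu (H t))"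
      unfolding full[symmetric] H_xx_def H_uu_def H_ux_def H_xu_def H_xu_full_def
      by (simp_all add: hessian_x_eq_block[OF td] hessian_u_eq_block[OF td] jac_u_grad_x_eq_block[OF td])
  qed
  have H_sym: "transpose (H t) = H t" if "t \<in> {0..T}" for t
    unfolding H_full[OF that, symmetric] H_xu_full_def hessian_xu_def by (rule transpose_hessian[OF ham[OF that]])
  obtain q where q: "\<And>t. t \<in> {0..T} \<Longrightarrow> norm (pbar t) \<le> q"
  proof -
    have "bounded (pbar ` {0..T})" by (intro compact_imp_bounded compact_continuous_image p_cont) simp
    then show thesis using that unfolding bounded_iff by blast
  qed
  \<comment> \<open>Each component of \<open>b\<close> contributes at most \<open>q * L\<close>,
    weighted by an entry of the adjoint, and the running cost contributes \<open>L\<close>.\<close>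
  define N where "N = CARD('n) * (q * L) + L"
  have H_le: "norm (H t) \<le> N" if t: "t \<in> {0..T}" for t
  proof -
    have "norm (pbar t $ i *\<^sub>R hessian (bi i t) (\<zeta> t)) \<le> q * L" for i
    proof -
      have "hessian (bi i t) (\<zeta> t) = hessian_xu_vec (b t) (xbar t) (ubar t) $ i"
        by (simp add: hessian_xu_vec_def hessian_xu_def bi_def \<zeta>_def)
      then have "norm (hessian (bi i t) (\<zeta> t)) \<le> L"
        using Finite_Cartesian_Product.norm_nth_le[of "hessian_xu_vec (b t) (xbar t) (ubar t)" i] b_hess_le[OF t] order_trans by metis
      moreover have "\<bar>pbar t $ i\<bar> \<le> q" using component_le_norm_cart[of "pbar t" i] q[OF t] by linarith
      ultimately show ?thesis by (auto intro!: mult_mono intro: order_trans[OF abs_ge_zero])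
    qed
    then have "norm (\<Sum>i\<in>UNIV. pbar t $ i *\<^sub>R hessian (bi i t) (\<zeta> t)) \<le> CARD('n) * (q * L)"
      using sum_norm_bound[of UNIV "\<lambda>i. pbar t $ i *\<^sub>R hessian (bi i t) (\<zeta> t)" "q * L"] by simp
    moreover have "norm (hessian (on_join (f t)) (\<zeta> t)) \<le> L"
      using f_hess_le[OF t, of "xbar t" "ubar t"] by (simp add: hessian_xu_def \<zeta>_def)
    ultimately show ?thesis unfolding H_def N_def using norm_triangle_mono by blast
  qed
  have N: "N \<ge> 0" using order_trans[OF norm_ge_zero H_le[of 0]] assms(1) by simp
  obtain k1 where k1: "k1 \<ge> 0" "\<And>M. norm (block_xx M :: real ^ 'n ^ 'n) \<le> k1 * norm (M :: real ^ ('n + 'm) ^ ('n + 'm))"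
    using linear_norm_bound[OF linear_blocks(1)] by blast
  obtain k2 where k2: "k2 \<ge> 0" "\<And>M. norm (block_xu M :: real ^ 'm ^ 'n) \<le> k2 * norm (M :: real ^ ('n + 'm) ^ ('n + 'm))"
    using linear_norm_bound[OF linear_blocks(2)] by blast
  obtain k3 where k3: "k3 \<ge> 0" "\<And>M. norm (block_uu M :: real ^ 'm ^ 'm) \<le> k3 * norm (M :: real ^ ('n + 'm) ^ ('n + 'm))"
    using linear_norm_bound[OF linear_blocks(3)] by blast
  \<comment> \<open>\<open>L\<close> covers the Jacobians and the other summands cover the three
    blocks; a sum of nonnegative terms dominates each of them.\<close>
  define K where "K = L + k1 * N + k2 * N + k3 * N"
  have kN: "k1 * N \<ge> 0" "k2 * N \<ge> 0" "k3 * N \<ge> 0" using k1 k2 k3 N by simp_all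
  have jac_eq: "jac_x (b t) (xbar t) (ubar t) = (\<chi> i j. grad (bi i t) (\<zeta> t) $ Inl j)"
    "jac_u (b t) (xbar t) (ubar t) = (\<chi> i j. grad (bi i t) (\<zeta> t) $ Inr j)" if "t \<in> {0..T}" for t
    using b_td[OF that] jac_x_eq[of "b t" "xbar t" "ubar t"] jac_u_eq[of "b t" "xbar t" "ubar t"]
    by (simp_all add: bi_def \<zeta>_def twice_differentiable_def)
  \<comment> \<open>The block identities hold only for times in the interval, so measurability is
    transferred on the interval alone.\<close>
  have cong: "h \<in> borel_measurable ?M" if "k \<in> borel_measurable ?M" "\<And>t. t \<in> {0..T} \<Longrightarrow> h t = k t"
    for h k :: "real \<Rightarrow> 'z::topological_space"
    using that measurable_cong[of ?M h k borel] by simp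
  interpret lq: linear_quadratic T K "\<lambda>t. jac_x (b t) (xbar t) (ubar t)"
    "\<lambda>t. jac_u (b t) (xbar t) (ubar t)" "\<lambda>t. H_xx b f t (xbar t) (ubar t) (pbar t)"
    "\<lambda>t. H_ux b f t (xbar t) (ubar t) (pbar t)" "\<lambda>t. H_uu b f t (xbar t) (ubar t) (pbar t)"
    "hessian g (xbar T)"
  proof unfold_locales
    show "T > 0" by fact
    show "K > 0" using L kN by (simp add: K_def)
    show "(\<lambda>t. jac_x (b t) (xbar t) (ubar t)) \<in> borel_measurable ?M"
      by (rule cong[OF _ jac_eq(1)], intro borel_measurable_vecI)
        (simp add: borel_measurable_vec_nth[OF grad_meas])
    show "(\<lambda>t. jac_u (b t) (xbar t) (ubar t)) \<in> borel_measurable ?M"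
      by (rule cong[OF _ jac_eq(2)], intro borel_measurable_vecI)
        (simp add: borel_measurable_vec_nth[OF grad_meas])
    show "(\<lambda>t. H_xx b f t (xbar t) (ubar t) (pbar t)) \<in> borel_measurable ?M"
      by (rule cong[OF _ Q_eq])
        (rule borel_measurable_linear[OF linear_blocks(1)[THEN linear_conv_bounded_linear[THEN iffD1]] H_meas])
    show "(\<lambda>t. H_ux b f t (xbar t) (ubar t) (pbar t)) \<in> borel_measurable ?M"
      by (rule cong[OF _ S_eq], rule borel_measurable_linear[OF bounded_linear_transpose])
        (rule borel_measurable_linear[OF linear_blocks(2)[THEN linear_conv_bounded_linear[THEN iffD1]] H_meas])
    show "(\<lambda>t. H_uu b f t (xbar t) (ubar t) (pbar t)) \<in> borel_measurable ?M"
      by (rule cong[OF _ R_eq])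
        (rule borel_measurable_linear[OF linear_blocks(3)[THEN linear_conv_bounded_linear[THEN iffD1]] H_meas])
    show "transpose (hessian g (xbar T)) = hessian g (xbar T)" by (rule transpose_hessian[OF g_td])
    fix t assume t: "t \<in> {0..T}"
    show "norm (jac_x (b t) (xbar t) (ubar t)) \<le> K" "norm (jac_u (b t) (xbar t) (ubar t)) \<le> K"
      using jac_le[OF t, of "xbar t" "ubar t"] kN norm_ge_zero[of "jac_x (b t) (xbar t) (ubar t)"]
        norm_ge_zero[of "jac_u (b t) (xbar t) (ubar t)"] unfolding K_def by linarith+
    show "norm (H_xx b f t (xbar t) (ubar t) (pbar t)) \<le> K"
      using order_trans[OF k1(2) mult_left_mono[OF H_le[OF t] k1(1)]] L kN by (simp add: K_def Q_eq[OF t])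
    show "norm (H_ux b f t (xbar t) (ubar t) (pbar t)) \<le> K"
      using order_trans[OF k2(2) mult_left_mono[OF H_le[OF t] k2(1)]] L kN by (simp add: K_def S_eq[OF t] norm_transpose)
    show "norm (H_uu b f t (xbar t) (ubar t) (pbar t)) \<le> K"
      using order_trans[OF k3(2) mult_left_mono[OF H_le[OF t] k3(1)]] L kN by (simp add: K_def R_eq[OF t])
    show "transpose (H_xx b f t (xbar t) (ubar t) (pbar t)) = H_xx b f t (xbar t) (ubar t) (pbar t)"
      "transpose (H_uu b f t (xbar t) (ubar t) (pbar t)) = H_uu b f t (xbar t) (ubar t) (pbar t)"
      using transpose_blocks[OF H_sym[OF t]] by (simp_all add: Q_eq[OF t] R_eq[OF t])
  qed
  have co: "coercive T b f g ubar xbar pbar \<alpha> \<longleftrightarrow> lq.coercive_form \<alpha>" for \<alpha>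
  proof -
    have "(LINT t|?M. join (y t) (v t) \<bullet> (H_xu_full b f t (xbar t) (ubar t) (pbar t) *v join (y t) (v t))) =
        (LINT t|?M. lq.form t (y t) (v t))" for y v
      by (rule Bochner_Integration.integral_cong)
        (simp_all add: H_full inner_block_form[OF H_sym] lq.form_def Q_eq S_eq R_eq del: transpose_matrix_vector)
    then show ?thesis
      by (simp add: coercive_def lq.coercive_form_def is_linearized_state_def lq.lin_state_def)
  qed
  have R_iff: "(AE t in ?M. sym_matrix_le (c *\<^sub>R mat 1) (H_uu b f t (xbar t) (ubar t) (pbar t))) \<longleftrightarrow>
      (AE t in ?M. \<forall>w. c * (norm w)\<^sup>2 \<le> w \<bullet> (H_uu b f t (xbar t) (ubar t) (pbar t) *v w))" for c
    by (rule AE_cong) (simp add: sym_matrix_le_scaleR_mat lq.R_sym)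
  show ?thesis
    unfolding has_strongly_regular_solution_def co R_iff
    using lq.riccati_imp_coercive_form lq.coercive_form_imp_riccati lq.coercive_form_imp_R_ge by blast
qed

end
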